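(* Let $\Bbbk$ be an algebraically closed field of characteristic zero, $N > 1$ an odd integer, $q \in \Bbbk$ a primitive $N$-th root of unity, and let $\lambda,\mu \in \Bbbk$ satisfy $(1-q^2)\lambda\mu = 1$. Put $\tilde F = (q-q^{-1})KF$ and let $B_{\lambda,\mu} = \langle E + \lambda K, \tilde F + \mu K \rangle$, a right coideal subalgebra of $\overline{U}_q(\mathfrak{sl}_2)$. Let $(B_{\lambda,\mu})^\dagger = \{ f \in \overline{\mathcal{O}}_q(SL_2) \mid f \leftharpoonup h = \varepsilon(h) f \text{ for all } h \in B_{\lambda,\mu}\}$. Let $\Lambda$ be a non-zero right integral of $B_{\lambda,\mu}$ and set $$w = x^{N-1}y^{N-1}z \leftharpoonup \Lambda, \qquad x = bd^{-1},\ y = cd,\ z = d^2 .$$ Then the algebra $(B_{\lambda,\mu})^\dagger$ is generated by $w$, and the minimal polynomial of $w$ is $X^N - \varepsilon(w)^N$. Furthermore, $\varepsilon(w) \ne 0$, and thus $(B_{\lambda,\mu})^\dagger$ is semisimple as an algebra.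
   Context: $\overline{U}_q(\mathfrak{sl}_2)$ is the algebra generated by $K, E, F$ subject to $K^N = 1$, $KE = q^2 EK$, $KF = q^{-2}FK$, $E^N = F^N = 0$, $EF - FE = (K - K^{-1})/(q - q^{-1})$; it is a Hopf algebra with $\Delta(K) = K \otimes K$, $\Delta(E) = E \otimes K + 1 \otimes E$, $\Delta(F) = F \otimes 1 + K^{-1} \otimes F$, $\varepsilon(K)=1$, $\varepsilon(E)=\varepsilon(F)=0$. $\overline{\mathcal{O}}_q(SL_2)$ is the algebra generated by $a,b,c,d$ subject to $ba = qab$, $ca = qac$, $bc = cb$, $db = qbd$, $dc = qcd$, $ad - q^{-1}bc = da - qbc = a^N = d^N = 1$, $b^N = c^N = 0$; it is a Hopf algebra with $\Delta(a) = a\otimes a + b \otimes c$, $\Delta(b) = a \otimes b + b \otimes d$, $\Delta(c) = c \otimes a + d \otimes c$, $\Delta(d) = c \otimes b + d \otimes d$, $\varepsilon(a)=\varepsilon(d)=1$, $\varepsilon(b)=\varepsilon(c)=0$. Note $d^{-1}=d^{N-1}$. There is a unique isomorphism of Hopf algebras $\phi : \overline{\mathcal{O}}_q(SL_2) \to \overline{U}_q(\mathfrak{sl}_2)^*$ such that $\begin{pmatrix} \langle\phi(a),h\rangle & \langle\phi(b),h\rangle \\ \langle\phi(c),h\rangle & \langle\phi(d),h\rangle \end{pmatrix} = \rho(h)$, where $\rho$ is the representation with $\rho(E) = \begin{pmatrix} 0&1\\0&0\end{pmatrix}$, $\rho(F) = \begin{pmatrix} 0&0\\1&0\end{pmatrix}$,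 $\rho(K) = \begin{pmatrix} q&0\\0&q^{-1}\end{pmatrix}$. Put $(f,h) = \langle \phi(f), h\rangle$ and $f \leftharpoonup h = (f_{(1)}, h) f_{(2)}$, a right action of $\overline{U}_q(\mathfrak{sl}_2)$ on $\overline{\mathcal{O}}_q(SL_2)$. A right integral of a right coideal subalgebra $A$ of a finite-dimensional Hopf algebra is an element $\Lambda \in A$ with $\Lambda a = \varepsilon(a)\Lambda$ for all $a \in A$; a non-zero one exists and is unique up to scalar. $\langle\cdots\rangle$ denotes the unital subalgebra generated by the indicated elements. *)

theory Defs
  imports
    "HOL-Library.Poly_Mapping"
    "HOL-Library.Product_Plus"
    "HOL-Library.FuncSet"
    "HOL-Computational_Algebra.Polynomial"
    "HOL-Analysis.Cartesian_Space"
    "HOL-Algebra.QuotRing"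
    "HOL-Algebra.Subrings"
    "HOL-Algebra.Module"
begin

section \<open>Free algebras and their tensor squares\<close>

text \<open>
  The free monoid is made into an (additively written) monoid, so that the free \<open>k\<close>-algebra
  on a set of generators is the monoid algebra of finitely supported functions on words, with the
  ring structure (convolution) of \<^theory>\<open>HOL-Library.Poly_Mapping\<close>.
\<close>

datatype 'g word = Word (letters: "'g list")

instantiation word :: (type) monoid_add
begin

definition zero_word :: "'a word" where "0 = Word []"

definition plus_word :: "'a word \<Rightarrow> 'a word \<Rightarrow> 'a word"
  where "u + v = Word (letters u @ letters v)"

instance by standard (simp_all add: zero_word_def plus_word_def)

end

type_synonym ('g, 'k) free_alg = "'g word \<Rightarrow>\<^sub>0 'k"

text \<open>
  Likewise \<open>k[W] \<otimes> k[W] = k[W \<times> W]\<close> for the free monoid \<open>W\<close>: the basis element indexed by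
  \<open>(u, v)\<close> is \<open>u \<otimes> v\<close>, and the componentwise addition of pairs of words yields the usual
  product \<open>(x \<otimes> y)(x' \<otimes> y') = xx' \<otimes> yy'\<close>.
\<close>

type_synonym ('g, 'k) free_alg2 = "('g word \<times> 'g word) \<Rightarrow>\<^sub>0 'k"

definition monom_of :: "'w \<Rightarrow> 'w \<Rightarrow>\<^sub>0 'k::zero_neq_one"
  where "monom_of u = Poly_Mapping.single u 1"

definition scalar :: "'k \<Rightarrow> 'w::zero \<Rightarrow>\<^sub>0 'k::zero"
  where "scalar c = Poly_Mapping.single 0 c"

definition gen :: "'g \<Rightarrow> ('g, 'k::zero_neq_one) free_alg"
  where "gen g = monom_of (Word [g])"

definition tens :: "('g, 'k) free_alg \<Rightarrow> ('g, 'k) free_alg \<Rightarrow> ('g, 'k::comm_ring_1) free_alg2"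
  (infixl \<open>\<otimes>\<^sub>t\<close> 72)
  where "p \<otimes>\<^sub>t r = (\<Sum>u\<in>Poly_Mapping.keys p. \<Sum>v\<in>Poly_Mapping.keys r.
      Poly_Mapping.single (u, v) (Poly_Mapping.lookup p u * Poly_Mapping.lookup r v))"

text \<open>The algebra map on the free algebra with prescribed values \<open>f\<close> on the generators; \<open>s\<close> is
  the structure map of the target algebra.\<close>

definition free_ext :: "('k::zero \<Rightarrow> 'r) \<Rightarrow> ('g \<Rightarrow> 'r) \<Rightarrow> ('g, 'k) free_alg \<Rightarrow> 'r::ring_1"
  where "free_ext s f p =
    (\<Sum>u\<in>Poly_Mapping.keys p. s (Poly_Mapping.lookup p u) * prod_list (map f (letters u)))"

definition free_ring :: "('g, 'k::comm_ring_1) free_alg ring"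
  where "free_ring = \<lparr>carrier = UNIV, monoid.mult = (*), one = 1, zero = 0, add = (+)\<rparr>"

lemma ring_free_ring: "ring (free_ring :: ('g, 'k::comm_ring_1) free_alg ring)"
proof (rule ringI)
  have "\<exists>y. y + x = 0" for x :: "('g, 'k) free_alg"
    by (rule exI[of _ "- x"]) simp
  then show "abelian_group (free_ring :: ('g, 'k) free_alg ring)"
    by (intro abelian_groupI) (simp_all add: free_ring_def ac_simps)
qed (unfold_locales, simp_all add: free_ring_def mult.assoc distrib_left distrib_right)


section \<open>Presented algebras\<close>

text \<open>A \<open>k\<close>-algebra is represented by the record \<^type>\<open>module\<close>, which has both the ring operations and
  the scalar multiplication; the scalars are the elements of the type \<open>'k\<close>.\<close>

record (overloaded) ('g, 'k::zero) bialg_pres =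
  rels :: "('g, 'k) free_alg set"
  comult_gen :: "'g \<Rightarrow> ('g, 'k) free_alg2"
  counit_gen :: "'g \<Rightarrow> 'k"

definition pideal :: "('g, 'k::comm_ring_1) bialg_pres \<Rightarrow> ('g, 'k) free_alg set"
  where "pideal P = genideal free_ring (rels P)"

definition pcls :: "('g, 'k::comm_ring_1) bialg_pres \<Rightarrow> ('g, 'k) free_alg \<Rightarrow> ('g, 'k) free_alg set"
  where "pcls P p = pideal P +>\<^bsub>free_ring\<^esub> p"

definition palg :: "('g, 'k::comm_ring_1) bialg_pres \<Rightarrow> ('k, ('g, 'k) free_alg set) module"
  where "palg P = ring.extend (free_ring Quot pideal P)
    (module.fields (\<lambda>c X. pcls P (scalar c) \<otimes>\<^bsub>free_ring Quot pideal P\<^esub> X))"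

text \<open>
  Functions on a presented algebra that are given by a function on the free algebra which is
  constant on cosets are defined as \<open>\<lambda>X. the_elem (h ` X)\<close>. The following definitions use the
  comultiplication and counit only for presentations for which they descend to the quotient.
\<close>

definition counit :: "('g, 'k::comm_ring_1) bialg_pres \<Rightarrow> ('g, 'k) free_alg set \<Rightarrow> 'k"
  where "counit P X = the_elem (free_ext (\<lambda>c. c) (counit_gen P) ` X)"

definition free_comult ::
    "('g, 'k::comm_ring_1) bialg_pres \<Rightarrow> ('g, 'k) free_alg \<Rightarrow> ('g, 'k) free_alg2"
  where "free_comult P = free_ext scalar (comult_gen P)"

text \<open>\<open>comult_eval P \<alpha> \<beta> X = \<alpha>(X\<^sub>(\<^sub>1\<^sub>)) \<beta>(X\<^sub>(\<^sub>2\<^sub>))\<close> for linear functionals \<open>\<alpha>\<close>, \<open>\<beta>\<close>, in Sweedler notation.\<close>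

definition comult_eval :: "('g, 'k::comm_ring_1) bialg_pres \<Rightarrow> (('g, 'k) free_alg set \<Rightarrow> 'k) \<Rightarrow>
    (('g, 'k) free_alg set \<Rightarrow> 'k) \<Rightarrow> ('g, 'k) free_alg set \<Rightarrow> 'k"
  where "comult_eval P \<alpha> \<beta> X = the_elem ((\<lambda>p.
    \<Sum>(u, v)\<in>Poly_Mapping.keys (free_comult P p). Poly_Mapping.lookup (free_comult P p) (u, v) *
       \<alpha> (pcls P (monom_of u)) * \<beta> (pcls P (monom_of v))) ` X)"

text \<open>\<open>comult_contract P \<alpha> X = \<alpha>(X\<^sub>(\<^sub>1\<^sub>)) X\<^sub>(\<^sub>2\<^sub>)\<close> for a linear functional \<open>\<alpha>\<close>.\<close>

definition comult_contract :: "('g, 'k::comm_ring_1) bialg_pres \<Rightarrow> (('g, 'k) free_alg set \<Rightarrow> 'k) \<Rightarrow>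
    ('g, 'k) free_alg set \<Rightarrow> ('g, 'k) free_alg set"
  where "comult_contract P \<alpha> X = the_elem ((\<lambda>p. pcls P (
    \<Sum>(u, v)\<in>Poly_Mapping.keys (free_comult P p).
       scalar (Poly_Mapping.lookup (free_comult P p) (u, v) * \<alpha> (pcls P (monom_of u))) *
       monom_of v)) ` X)"


section \<open>Notions for algebras\<close>

definition linear_dual :: "('k::comm_ring_1, 'a) module \<Rightarrow> ('a \<Rightarrow> 'k) set"
  where "linear_dual A = {\<alpha> \<in> extensional (carrier A).
    (\<forall>x\<in>carrier A. \<forall>y\<in>carrier A. \<alpha> (x \<oplus>\<^bsub>A\<^esub> y) = \<alpha> x + \<alpha> y) \<and>
    (\<forall>c. \<forall>x\<in>carrier A. \<alpha> (c \<odot>\<^bsub>A\<^esub> x) = c * \<alpha> x)}"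

text \<open>
  An isomorphism from the Hopf algebra presented by \<open>P\<close> to the dual of the finite-dimensional Hopf
  algebra presented by \<open>Q\<close>. The dual carries the convolution product, with unit the counit of \<open>Q\<close>;
  its comultiplication and counit are the transposes of the multiplication and unit of \<open>Q\<close>.
  Compatibility with the antipodes is automatic for bialgebra maps between Hopf algebras.
\<close>

definition hopf_iso_dual :: "('g, 'k::comm_ring_1) bialg_pres \<Rightarrow> ('h, 'k) bialg_pres \<Rightarrow>
    (('g, 'k) free_alg set \<Rightarrow> ('h, 'k) free_alg set \<Rightarrow> 'k) \<Rightarrow> bool"
  where "hopf_iso_dual P Q \<phi> \<longleftrightarrow>
    bij_betw \<phi> (carrier (palg P)) (linear_dual (palg Q)) \<and>
    (\<forall>f\<in>carrier (palg P). \<forall>g\<in>carrier (palg P). \<forall>X\<in>carrier (palg Q).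
       \<phi> (f \<oplus>\<^bsub>palg P\<^esub> g) X = \<phi> f X + \<phi> g X) \<and>
    (\<forall>c. \<forall>f\<in>carrier (palg P). \<forall>X\<in>carrier (palg Q). \<phi> (c \<odot>\<^bsub>palg P\<^esub> f) X = c * \<phi> f X) \<and>
    (\<forall>f\<in>carrier (palg P). \<forall>g\<in>carrier (palg P). \<forall>X\<in>carrier (palg Q).
       \<phi> (f \<otimes>\<^bsub>palg P\<^esub> g) X = comult_eval Q (\<phi> f) (\<phi> g) X) \<and>
    (\<forall>X\<in>carrier (palg Q). \<phi> \<one>\<^bsub>palg P\<^esub> X = counit Q X) \<and>
    (\<forall>f\<in>carrier (palg P). \<forall>X\<in>carrier (palg Q). \<forall>Y\<in>carrier (palg Q).
       \<phi> f (X \<otimes>\<^bsub>palg Q\<^esub> Y) = comult_eval P (\<lambda>g. \<phi> g X) (\<lambda>g. \<phi> g Y) f) \<and>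
    (\<forall>f\<in>carrier (palg P). \<phi> f \<one>\<^bsub>palg Q\<^esub> = counit P f)"

definition is_subalgebra :: "'a set \<Rightarrow> ('k, 'a) module \<Rightarrow> bool"
  where "is_subalgebra B A \<longleftrightarrow> subring B A \<and> (\<forall>c. \<forall>x\<in>B. c \<odot>\<^bsub>A\<^esub> x \<in> B)"

definition subalgebra_gen :: "('k, 'a) module \<Rightarrow> 'a set \<Rightarrow> 'a set"
  where "subalgebra_gen A S = \<Inter>{B. is_subalgebra B A \<and> S \<subseteq> B}"

definition poly_eval :: "('k::comm_ring_1, 'a) module \<Rightarrow> 'k poly \<Rightarrow> 'a \<Rightarrow> 'a"
  where "poly_eval A p x = (\<Oplus>\<^bsub>A\<^esub>i\<in>{..Polynomial.degree p}. Polynomial.coeff p i \<odot>\<^bsub>A\<^esub> (x [^]\<^bsub>A\<^esub> i))"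

definition is_minimal_poly :: "('k::comm_ring_1, 'a) module \<Rightarrow> 'a \<Rightarrow> 'k poly \<Rightarrow> bool"
  where "is_minimal_poly A x p \<longleftrightarrow> lead_coeff p = 1 \<and> poly_eval A p x = \<zero>\<^bsub>A\<^esub> \<and>
    (\<forall>r. r \<noteq> 0 \<and> poly_eval A r x = \<zero>\<^bsub>A\<^esub> \<longrightarrow> Polynomial.degree p \<le> Polynomial.degree r)"

definition left_ideal :: "'a set \<Rightarrow> ('a, 'm) ring_scheme \<Rightarrow> bool"
  where "left_ideal L R \<longleftrightarrow> subgroup L (add_monoid R) \<and>
    (\<forall>r\<in>carrier R. \<forall>x\<in>L. r \<otimes>\<^bsub>R\<^esub> x \<in> L)"

text \<open>Semisimplicity of the left regular module: every submodule is a direct summand.\<close>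

definition semisimple :: "('a, 'm) ring_scheme \<Rightarrow> bool"
  where "semisimple R \<longleftrightarrow> (\<forall>L. left_ideal L R \<longrightarrow>
    (\<exists>L'. left_ideal L' R \<and> L \<inter> L' = {\<zero>\<^bsub>R\<^esub>} \<and> L <+>\<^bsub>R\<^esub> L' = carrier R))"


section \<open>The small quantum group and the small quantum function algebra\<close>

text \<open>In the free algebra \<open>K\<^sup>-\<^sup>1\<close> is written as \<open>K\<^sup>N\<^sup>-\<^sup>1\<close>, which is legitimate because of \<open>K\<^sup>N = 1\<close>.\<close>

datatype U_gen = Gen_E | Gen_F | Gen_K

definition U_pres :: "'k::field \<Rightarrow> nat \<Rightarrow> (U_gen, 'k) bialg_pres"
  where "U_pres q N = (let E = gen Gen_E; F = gen Gen_F; K = gen Gen_K; K' = K ^ (N - 1) in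
    \<lparr>rels =
      {K ^ N - 1,
       K * E - scalar (q ^ 2) * E * K,
       K * F - scalar (inverse (q ^ 2)) * F * K,
       E ^ N,
       F ^ N,
       E * F - F * E - scalar (1 / (q - inverse q)) * (K - K')},
     comult_gen = (\<lambda>g. case g of
        Gen_K \<Rightarrow> K \<otimes>\<^sub>t K
      | Gen_E \<Rightarrow> E \<otimes>\<^sub>t K + 1 \<otimes>\<^sub>t E
      | Gen_F \<Rightarrow> F \<otimes>\<^sub>t 1 + K' \<otimes>\<^sub>t F),
     counit_gen = (\<lambda>g. case g of Gen_K \<Rightarrow> 1 | Gen_E \<Rightarrow> 0 | Gen_F \<Rightarrow> 0)\<rparr>)"

abbreviation U_alg :: "'k::field \<Rightarrow> nat \<Rightarrow> ('k, (U_gen, 'k) free_alg set) module"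
  where "U_alg q N \<equiv> palg (U_pres q N)"

abbreviation U_elt :: "'k::field \<Rightarrow> nat \<Rightarrow> U_gen \<Rightarrow> (U_gen, 'k) free_alg set"
  where "U_elt q N g \<equiv> pcls (U_pres q N) (gen g)"

datatype O_gen = Gen_a | Gen_b | Gen_c | Gen_d

definition O_pres :: "'k::field \<Rightarrow> nat \<Rightarrow> (O_gen, 'k) bialg_pres"
  where "O_pres q N = (let a = gen Gen_a; b = gen Gen_b; c = gen Gen_c; d = gen Gen_d in
    \<lparr>rels =
      {b * a - scalar q * a * b,
       c * a - scalar q * a * c,
       b * c - c * b,
       d * b - scalar q * b * d,
       d * c - scalar q * c * d,
       a * d - scalar (inverse q) * b * c - 1,
       d * a - scalar q * b * c - 1,
       a ^ N - 1,
       d ^ N - 1,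
       b ^ N,
       c ^ N},
     comult_gen = (\<lambda>g. case g of
        Gen_a \<Rightarrow> a \<otimes>\<^sub>t a + b \<otimes>\<^sub>t c
      | Gen_b \<Rightarrow> a \<otimes>\<^sub>t b + b \<otimes>\<^sub>t d
      | Gen_c \<Rightarrow> c \<otimes>\<^sub>t a + d \<otimes>\<^sub>t c
      | Gen_d \<Rightarrow> c \<otimes>\<^sub>t b + d \<otimes>\<^sub>t d),
     counit_gen = (\<lambda>g. case g of Gen_a \<Rightarrow> 1 | Gen_b \<Rightarrow> 0 | Gen_c \<Rightarrow> 0 | Gen_d \<Rightarrow> 1)\<rparr>)"

abbreviation O_alg :: "'k::field \<Rightarrow> nat \<Rightarrow> ('k, (O_gen, 'k) free_alg set) module"
  where "O_alg q N \<equiv> palg (O_pres q N)"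

abbreviation O_elt :: "'k::field \<Rightarrow> nat \<Rightarrow> O_gen \<Rightarrow> (O_gen, 'k) free_alg set"
  where "O_elt q N g \<equiv> pcls (O_pres q N) (gen g)"

fun rho_gen :: "'k::field \<Rightarrow> U_gen \<Rightarrow> 'k ^ 2 ^ 2"
  where
    "rho_gen q Gen_E = vector [vector [0, 1], vector [0, 0]]"
  | "rho_gen q Gen_F = vector [vector [0, 0], vector [1, 0]]"
  | "rho_gen q Gen_K = vector [vector [q, 0], vector [0, inverse q]]"

definition rho :: "'k::field \<Rightarrow> (U_gen, 'k) free_alg set \<Rightarrow> 'k ^ 2 ^ 2"
  where "rho q X = the_elem ((\<lambda>p. \<Sum>u\<in>Poly_Mapping.keys p.
    mat (Poly_Mapping.lookup p u) ** foldr (\<lambda>g M. rho_gen q g ** M) (letters u) (mat 1)) ` X)"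

text \<open>The property that characterizes the isomorphism \<open>\<phi>\<close> uniquely; the pairing \<open>(f, h)\<close> is then
  \<open>\<phi> f h\<close>.\<close>

definition is_phi :: "'k::field \<Rightarrow> nat \<Rightarrow>
    ((O_gen, 'k) free_alg set \<Rightarrow> (U_gen, 'k) free_alg set \<Rightarrow> 'k) \<Rightarrow> bool"
  where "is_phi q N \<phi> \<longleftrightarrow> hopf_iso_dual (O_pres q N) (U_pres q N) \<phi> \<and>
    (\<forall>h\<in>carrier (U_alg q N).
      (vector [vector [\<phi> (O_elt q N Gen_a) h, \<phi> (O_elt q N Gen_b) h],
               vector [\<phi> (O_elt q N Gen_c) h, \<phi> (O_elt q N Gen_d) h]] :: 'k ^ 2 ^ 2) = rho q h)"

text \<open>\<open>ract q N \<phi> f h\<close> is \<open>f \<leftharpoonup> h = (f\<^sub>(\<^sub>1\<^sub>), h) f\<^sub>(\<^sub>2\<^sub>)\<close>.\<close>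

definition ract :: "'k::field \<Rightarrow> nat \<Rightarrow>
    ((O_gen, 'k) free_alg set \<Rightarrow> (U_gen, 'k) free_alg set \<Rightarrow> 'k) \<Rightarrow>
    (O_gen, 'k) free_alg set \<Rightarrow> (U_gen, 'k) free_alg set \<Rightarrow> (O_gen, 'k) free_alg set"
  where "ract q N \<phi> f h = comult_contract (O_pres q N) (\<lambda>g. \<phi> g h) f"

definition Ftilde :: "'k::field \<Rightarrow> nat \<Rightarrow> (U_gen, 'k) free_alg set"
  where "Ftilde q N =
    (q - inverse q) \<odot>\<^bsub>U_alg q N\<^esub> (U_elt q N Gen_K \<otimes>\<^bsub>U_alg q N\<^esub> U_elt q N Gen_F)"

definition B_alg :: "'k::field \<Rightarrow> nat \<Rightarrow> 'k \<Rightarrow> 'k \<Rightarrow> (U_gen, 'k) free_alg set set"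
  where "B_alg q N lam mu = subalgebra_gen (U_alg q N)
    {U_elt q N Gen_E \<oplus>\<^bsub>U_alg q N\<^esub> (lam \<odot>\<^bsub>U_alg q N\<^esub> U_elt q N Gen_K),
     Ftilde q N \<oplus>\<^bsub>U_alg q N\<^esub> (mu \<odot>\<^bsub>U_alg q N\<^esub> U_elt q N Gen_K)}"

definition dagger :: "'k::field \<Rightarrow> nat \<Rightarrow>
    ((O_gen, 'k) free_alg set \<Rightarrow> (U_gen, 'k) free_alg set \<Rightarrow> 'k) \<Rightarrow>
    (U_gen, 'k) free_alg set set \<Rightarrow> (O_gen, 'k) free_alg set set"
  where "dagger q N \<phi> B = {f \<in> carrier (O_alg q N).
    \<forall>h\<in>B. ract q N \<phi> f h = counit (U_pres q N) h \<odot>\<^bsub>O_alg q N\<^esub> f}"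

definition right_integral ::
    "('g, 'k::comm_ring_1) bialg_pres \<Rightarrow> ('g, 'k) free_alg set set \<Rightarrow> ('g, 'k) free_alg set \<Rightarrow> bool"
  where "right_integral P A \<Lambda> \<longleftrightarrow>
    \<Lambda> \<in> A \<and> (\<forall>x\<in>A. \<Lambda> \<otimes>\<^bsub>palg P\<^esub> x = counit P x \<odot>\<^bsub>palg P\<^esub> \<Lambda>)"

end

theory Submission
  imports Defs
begin

text \<open>
  Write \<open>(f, h)\<close> for the pairing, \<open>e = E + \<lambda>K\<close> and \<open>f = (q - q\<^sup>-\<^sup>1)KF + \<mu>K\<close> for the generators of
  \<open>B\<close>. If \<open>u\<close> is \<open>B\<close>-invariant then \<open>(u, eh) = \<lambda>(u, h)\<close> and \<open>(u, fh) = \<mu>(u, h)\<close>, so inside the pairing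
  with \<open>u\<close> the generators \<open>E\<close> and \<open>F\<close> can be traded for powers of \<open>K\<close>, and \<open>u\<close> is determined by the
  values \<open>(u, K\<^sup>s)\<close>, \<open>s < N\<close>. As the \<open>K\<^sup>s\<close> are grouplike, the invariants embed as an algebra into
  \<open>k\<^sup>N\<close>. The left action of \<open>K\<close> has weight \<open>q\<^sup>-\<^sup>2\<close> on \<open>x\<^sup>N\<^sup>-\<^sup>1 y\<^sup>N\<^sup>-\<^sup>1 z\<close>, whence
  \<open>(w, K\<^sup>s) = \<epsilon>(w) q\<^sup>-\<^sup>2\<^sup>s\<close>. If \<open>\<epsilon>(w) \<noteq> 0\<close> these are \<open>N\<close> distinct numbers, and everything follows by
  interpolation.

  To see that \<open>\<epsilon>(w) = (v, \<Lambda>)\<close> is non-zero for \<open>v = x\<^sup>N\<^sup>-\<^sup>1 y\<^sup>N\<^sup>-\<^sup>1 z\<close>, which is proportional to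
  \<open>b\<^sup>N\<^sup>-\<^sup>1 c\<^sup>N\<^sup>-\<^sup>1 d\<^sup>2\<close>: the condition on \<open>\<lambda>\<mu>\<close> makes \<open>B\<close> a quotient of the quantum Weyl algebra,
  \<open>fe = q\<^sup>2 ef + 1\<close>, with \<open>e\<^sup>N = \<lambda>\<^sup>N\<close> and \<open>f\<^sup>N = \<mu>\<^sup>N\<close>, so the \<open>e\<^sup>i f\<^sup>j\<close> with \<open>i, j < N\<close> span \<open>B\<close>. Since \<open>e\<close>
  lowers the exponent of \<open>b\<close> and \<open>f\<close> that of \<open>c\<close> by at most one, \<open>(v, e\<^sup>i f\<^sup>j)\<close> is non-zero only
  for \<open>i = j = N - 1\<close>. Hence \<open>(v, -)\<close> is a Frobenius form on \<open>B\<close> and cannot vanish on \<open>\<Lambda> \<noteq> 0\<close>, as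
  \<open>\<Lambda>B = k\<Lambda>\<close>.
\<close>

section \<open>Linear functionals on monoid algebras\<close>

text \<open>A name of its own lets scalars be pulled out of products by rewriting, although words do
  not commute with each other.\<close>

definition smul :: "'k::comm_ring_1 \<Rightarrow> ('w::monoid_add \<Rightarrow>\<^sub>0 'k) \<Rightarrow> 'w \<Rightarrow>\<^sub>0 'k"
  where "smul c p = scalar c * p"

lemma scalar_0: "scalar 0 = (0 :: 'w::monoid_add \<Rightarrow>\<^sub>0 'k::comm_ring_1)"
  by (simp add: scalar_def)

lemma scalar_1: "scalar 1 = (1 :: 'w::monoid_add \<Rightarrow>\<^sub>0 'k::comm_ring_1)"
  by (simp add: scalar_def)

lemma scalar_add: "scalar (c + d) = (scalar c + scalar d :: 'w::monoid_add \<Rightarrow>\<^sub>0 'k::comm_ring_1)"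
  by (simp add: scalar_def single_add)

lemma scalar_mult: "scalar (c * d) = (scalar c * scalar d :: 'w::monoid_add \<Rightarrow>\<^sub>0 'k::comm_ring_1)"
  by (simp add: scalar_def mult_single)

lemma monom_of_plus: "monom_of (u + v) = (monom_of u * monom_of v :: 'w::monoid_add \<Rightarrow>\<^sub>0 'k::comm_ring_1)"
  by (simp add: monom_of_def mult_single)

lemma monom_of_0: "monom_of 0 = (1 :: 'w::monoid_add \<Rightarrow>\<^sub>0 'k::comm_ring_1)"
  by (simp add: monom_of_def)

lemma smul_monom_of: "smul c (monom_of u) = Poly_Mapping.single u c"
  by (simp add: smul_def monom_of_def scalar_def mult_single)

lemma monom_expansion:
  "(p :: 'w::monoid_add \<Rightarrow>\<^sub>0 'k::comm_ring_1) =
    (\<Sum>u\<in>Poly_Mapping.keys p. smul (Poly_Mapping.lookup p u) (monom_of u))"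
proof (rule poly_mapping_eqI)
  fix k
  have "(\<Sum>u\<in>Poly_Mapping.keys p. Poly_Mapping.lookup p u when u = k) = Poly_Mapping.lookup p k"
  proof (cases "k \<in> Poly_Mapping.keys p")
    case True
    have "(\<Sum>u\<in>Poly_Mapping.keys p. Poly_Mapping.lookup p u when u = k)
      = (\<Sum>u\<in>Poly_Mapping.keys p. if u = k then Poly_Mapping.lookup p u else 0)"
      by (simp add: when_def)
    also have "\<dots> = Poly_Mapping.lookup p k"
      using True by (simp add: sum.delta)
    finally show ?thesis .
  next
    case False
    then show ?thesis
      by (auto simp: in_keys_iff when_def intro!: sum.neutral)
  qed
  then show "Poly_Mapping.lookup p k =
      Poly_Mapping.lookup (\<Sum>u\<in>Poly_Mapping.keys p. smul (Poly_Mapping.lookup p u) (monom_of u)) k"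
    by (simp add: lookup_sum smul_monom_of lookup_single)
qed

text \<open>Zero has no case of its own, being \<open>smul 0\<close> of a basis element.\<close>

lemma monoid_alg_induct [case_names monom add smul]:
  fixes p :: "'w::monoid_add \<Rightarrow>\<^sub>0 'k::comm_ring_1"
  assumes "\<And>u. P (monom_of u)" "\<And>x y. P x \<Longrightarrow> P y \<Longrightarrow> P (x + y)" "\<And>c x. P x \<Longrightarrow> P (smul c x)"
  shows "P p"
proof -
  have 0: "P 0"
    using assms(3)[of "monom_of 0" 0] assms(1) by (simp add: smul_def scalar_0)
  have "P (\<Sum>u\<in>A. smul (Poly_Mapping.lookup p u) (monom_of u))" if "finite A" for A
    using that by (induction A) (auto simp: 0 intro: assms)
  then show ?thesis
    by (subst monom_expansion) simp
qed

lemma smul_add: "smul c (x + y) = smul c x + smul c y"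
  and add_smul: "smul (c + d) x = smul c x + smul d x"
  and smul_diff: "smul c (x - y) = smul c x - smul c y"
  and diff_smul: "smul (c - d) x = smul c x - smul d x"
  and smul_smul [simp]: "smul c (smul d x) = smul (c * d) x"
  and smul_1 [simp]: "smul 1 x = x"
  and smul_0 [simp]: "smul c 0 = 0"
  and smul_zero [simp]: "smul 0 x = 0"
  and smul_mult_left [simp]: "smul c x * y = smul c (x * y)"
  and smul_uminus: "smul c (- x) = - smul c x"
  and uminus_smul: "smul (- c) x = - smul c x"
  and smul_sum: "smul c (sum f A) = (\<Sum>i\<in>A. smul c (f i))"
proof -
  show "smul (c - d) x = smul c x - smul d x"
    by (simp add: smul_def scalar_def single_diff left_diff_distrib)
  show "smul (- c) x = - smul c x"
    by (simp add: smul_def scalar_def single_uminus)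
qed (simp_all add: smul_def scalar_add scalar_mult scalar_0 scalar_1 algebra_simps sum_distrib_left)

lemma scalar_central: "scalar c * x = x * scalar c"
  for x :: "'w::monoid_add \<Rightarrow>\<^sub>0 'k::comm_ring_1"
proof (induction x rule: monoid_alg_induct)
  case (monom u)
  show ?case
    by (simp add: monom_of_def scalar_def mult_single)
next
  case (smul d x)
  have "scalar c * smul d x = scalar (c * d) * x"
    by (simp add: smul_def scalar_mult mult.assoc)
  also have "\<dots> = scalar d * (scalar c * x)"
    by (simp add: mult.commute[of c] scalar_mult mult.assoc)
  also have "\<dots> = smul d x * scalar c"
    by (simp add: smul smul_def mult.assoc)
  finally show ?case .
qed (simp add: distrib_left distrib_right)

lemma smul_mult_right [simp]: "x * smul c y = smul c (x * y)"
  by (simp add: smul_def mult.assoc[symmetric] scalar_central[of c x, symmetric])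

lemma scalar_conv_smul: "scalar c = smul c 1"
  by (simp add: smul_def)

lemma smul_power: "smul c x ^ n = smul (c ^ n) (x ^ n)"
  by (induction n) (simp_all add: mult_ac)

definition linear_fun :: "(('w::monoid_add \<Rightarrow>\<^sub>0 'k::comm_ring_1) \<Rightarrow> 'k) \<Rightarrow> bool"
  where "linear_fun T \<longleftrightarrow> (\<forall>x y. T (x + y) = T x + T y) \<and> (\<forall>c x. T (smul c x) = c * T x)"

lemma linear_funI:
  "(\<And>x y. T (x + y) = T x + T y) \<Longrightarrow> (\<And>c x. T (smul c x) = c * T x) \<Longrightarrow> linear_fun T"
  by (simp add: linear_fun_def)

lemma linear_fun_add: "linear_fun T \<Longrightarrow> T (x + y) = T x + T y"
  and linear_fun_smul: "linear_fun T \<Longrightarrow> T (smul c x) = c * T x"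
  by (simp_all add: linear_fun_def)

lemma linear_fun_0: "linear_fun T \<Longrightarrow> T 0 = 0"
  using linear_fun_smul[of T 0 0] by simp

lemma linear_fun_uminus: "linear_fun T \<Longrightarrow> T (- x) = - T x"
  using linear_fun_smul[of T "-1" x] by (simp add: uminus_smul)

lemma linear_fun_diff: "linear_fun T \<Longrightarrow> T (x - y) = T x - T y"
  using linear_fun_add[of T x "- y"] by (simp add: linear_fun_uminus)

lemma linear_fun_sum: "linear_fun T \<Longrightarrow> T (sum f A) = (\<Sum>i\<in>A. T (f i))"
  by (induction A rule: infinite_finite_induct) (simp_all add: linear_fun_0 linear_fun_add)

lemmas linear_fun_simps =
  linear_fun_add linear_fun_smul linear_fun_0 linear_fun_uminus linear_fun_diff linear_fun_sum

lemma linear_fun_eqI: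
  assumes "linear_fun S" "linear_fun T" "\<And>u. S (monom_of u) = T (monom_of u)"
  shows "S x = T x"
  by (induction x rule: monoid_alg_induct) (simp_all add: assms linear_fun_simps)

lemma linear_fun_mult_left: "linear_fun T \<Longrightarrow> linear_fun (\<lambda>x. T (r * x))"
  and linear_fun_mult_right: "linear_fun T \<Longrightarrow> linear_fun (\<lambda>x. T (x * r))"
  by (auto intro!: linear_funI simp: linear_fun_simps distrib_left distrib_right)

definition lin_ext :: "('w \<Rightarrow> 'k) \<Rightarrow> ('w::monoid_add \<Rightarrow>\<^sub>0 'k::comm_ring_1) \<Rightarrow> 'k"
  where "lin_ext \<alpha> p = (\<Sum>u\<in>Poly_Mapping.keys p. Poly_Mapping.lookup p u * \<alpha> u)"

text \<open>A sum over the keys may be extended to any larger finite set, which makes it additive.\<close>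

lemma keys_sum_add:
  fixes p r :: "'w::monoid_add \<Rightarrow>\<^sub>0 'k::comm_ring_1"
    and f :: "'w \<Rightarrow> 'k \<Rightarrow> 'b::comm_monoid_add"
  assumes f0: "\<And>u. f u 0 = 0" and f_add: "\<And>u c d. f u (c + d) = f u c + f u d"
  shows "(\<Sum>u\<in>Poly_Mapping.keys (p + r). f u (Poly_Mapping.lookup (p + r) u)) =
    (\<Sum>u\<in>Poly_Mapping.keys p. f u (Poly_Mapping.lookup p u)) +
    (\<Sum>u\<in>Poly_Mapping.keys r. f u (Poly_Mapping.lookup r u))"
proof -
  let ?A = "Poly_Mapping.keys p \<union> Poly_Mapping.keys r"
  have *: "(\<Sum>u\<in>Poly_Mapping.keys t. f u (Poly_Mapping.lookup t u)) =
      (\<Sum>u\<in>?A. f u (Poly_Mapping.lookup t u))" if "Poly_Mapping.keys t \<subseteq> ?A" for t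
    by (rule sum.mono_neutral_left) (use that in \<open>auto simp: in_keys_iff f0\<close>)
  show ?thesis
    using *[of p] *[of r] *[OF keys_add] by (simp add: lookup_add f_add sum.distrib)
qed

lemma lookup_smul: "Poly_Mapping.lookup (smul c p) u = c * Poly_Mapping.lookup p u"
proof -
  have "smul c p = Poly_Mapping.map ((*) c) p"
    by (simp add: smul_def scalar_def mult_map_scale_conv_mult)
  then show ?thesis
    by (simp add: map.rep_eq when_def)
qed

text \<open>Scaling can remove keys, as coefficients may become zero; \<open>f u 0 = 0\<close> makes
  this harmless.\<close>

lemma keys_sum_smul:
  fixes p :: "'w::monoid_add \<Rightarrow>\<^sub>0 'k::comm_ring_1"
    and f :: "'w \<Rightarrow> 'k \<Rightarrow> 'b::comm_monoid_add"
  assumes f0: "\<And>u. f u 0 = 0"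
  shows "(\<Sum>u\<in>Poly_Mapping.keys (smul c p). f u (Poly_Mapping.lookup (smul c p) u)) =
    (\<Sum>u\<in>Poly_Mapping.keys p. f u (c * Poly_Mapping.lookup p u))"
proof -
  have "Poly_Mapping.keys (smul c p) \<subseteq> Poly_Mapping.keys p"
    by (auto simp: in_keys_iff lookup_smul)
  then have "(\<Sum>u\<in>Poly_Mapping.keys (smul c p). f u (Poly_Mapping.lookup (smul c p) u)) =
    (\<Sum>u\<in>Poly_Mapping.keys p. f u (Poly_Mapping.lookup (smul c p) u))"
    by (intro sum.mono_neutral_left) (auto simp: in_keys_iff f0)
  then show ?thesis
    by (simp add: lookup_smul)
qed

lemma lin_ext_add: "lin_ext \<alpha> (p + r) = lin_ext \<alpha> p + lin_ext \<alpha> r"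
  unfolding lin_ext_def by (rule keys_sum_add) (simp_all add: distrib_right)

lemma lin_ext_smul: "lin_ext \<alpha> (smul c p) = c * lin_ext \<alpha> p"
  unfolding lin_ext_def by (subst keys_sum_smul) (simp_all add: sum_distrib_left mult.assoc)

lemma linear_fun_lin_ext: "linear_fun (lin_ext \<alpha>)"
  by (simp add: linear_fun_def lin_ext_add lin_ext_smul)

lemma lin_ext_monom: "lin_ext \<alpha> (monom_of u) = \<alpha> u"
  by (simp add: lin_ext_def monom_of_def)

lemma linear_fun_conv_lin_ext: "linear_fun T \<Longrightarrow> T x = lin_ext (\<lambda>u. T (monom_of u)) x"
  by (rule linear_fun_eqI) (simp_all add: linear_fun_lin_ext lin_ext_monom)

section \<open>Algebra maps on free algebras\<close>

lemma monom_of_Word_Cons: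
  "monom_of (Word (g # gs)) = (gen g * monom_of (Word gs) :: ('g, 'k::comm_ring_1) free_alg)"
  by (simp add: gen_def monom_of_plus[symmetric] plus_word_def)

lemma monom_of_Word_Nil: "monom_of (Word []) = (1 :: ('g, 'k::comm_ring_1) free_alg)"
  by (simp add: monom_of_0[symmetric] zero_word_def)

lemma free_alg_induct [case_names one gen_mult add smul]:
  fixes p :: "('g, 'k::comm_ring_1) free_alg"
  assumes "P 1" "\<And>g x. P x \<Longrightarrow> P (gen g * x)"
    "\<And>x y. P x \<Longrightarrow> P y \<Longrightarrow> P (x + y)" "\<And>c x. P x \<Longrightarrow> P (smul c x)"
  shows "P p"
proof (induction p rule: monoid_alg_induct)
  case (monom u)
  have "P (monom_of (Word gs))" for gs
    by (induction gs) (simp_all add: monom_of_Word_Nil monom_of_Word_Cons assms)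
  then show ?case
    by (metis word.collapse)
qed (use assms in auto)

text \<open>There are two instances below: the scalars themselves, for the counit, and the constants
  of a monoid algebra, for the comultiplication. Centrality of \<open>s c\<close> is what makes
  \<open>free_ext\<close> multiplicative.\<close>

locale scalar_map =
  fixes s :: "'k::comm_ring_1 \<Rightarrow> 'r::ring_1"
  assumes s_0: "s 0 = 0" and s_1: "s 1 = 1"
    and s_add: "s (c + d) = s c + s d" and s_mult: "s (c * d) = s c * s d"
    and s_central: "s c * r = r * s c"
begin

lemma free_ext_add: "free_ext s f (p + r) = free_ext s f p + free_ext s f r"
  unfolding free_ext_def by (rule keys_sum_add) (simp_all add: s_0 s_add distrib_right)

lemma free_ext_smul: "free_ext s f (smul c p) = s c * free_ext s f p"
  unfolding free_ext_def
  by (subst keys_sum_smul) (simp_all add: s_0 s_mult sum_distrib_left mult.assoc)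

lemma free_ext_monom: "free_ext s f (monom_of u) = prod_list (map f (letters u))"
  by (simp add: free_ext_def monom_of_def s_1)

lemma free_ext_gen: "free_ext s f (gen g) = f g"
  by (simp add: gen_def free_ext_monom)

lemma free_ext_1: "free_ext s f 1 = 1"
  by (subst monom_of_Word_Nil[symmetric], subst free_ext_monom) simp

lemma free_ext_mult: "free_ext s f (p * r) = free_ext s f p * free_ext s f r"
proof (induction p rule: monoid_alg_induct)
  case (monom u)
  show ?case
  proof (induction r rule: monoid_alg_induct)
    case (monom v)
    show ?case
      by (simp add: monom_of_plus[symmetric] free_ext_monom plus_word_def)
  next
    case (smul c r)
    have "free_ext s f (monom_of u) * (s c * free_ext s f r) =
        s c * (free_ext s f (monom_of u) * free_ext s f r)"
      by (simp add: mult.assoc[symmetric] s_central[of c "free_ext s f (monom_of u)"])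
    then show ?case
      by (simp add: free_ext_smul smul)
  qed (simp add: free_ext_add distrib_left)
next
  case (smul c p)
  then show ?case
    by (simp add: free_ext_smul mult.assoc)
qed (simp add: free_ext_add distrib_right)

lemma free_ext_0: "free_ext s f 0 = 0"
  by (simp add: free_ext_def)

lemma free_ext_uminus: "free_ext s f (- p) = - free_ext s f p"
proof -
  have "free_ext s f (- p) + free_ext s f p = 0"
    by (simp add: free_ext_add[symmetric] free_ext_0)
  then show ?thesis
    by (simp add: eq_neg_iff_add_eq_0)
qed

lemma free_ext_diff: "free_ext s f (p - r) = free_ext s f p - free_ext s f r"
  using free_ext_add[of f p "- r"] by (simp add: free_ext_uminus)

lemma free_ext_power: "free_ext s f (p ^ n) = free_ext s f p ^ n"
  by (induction n) (simp_all add: free_ext_1 free_ext_mult)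

lemmas free_ext_simps = free_ext_add free_ext_smul free_ext_gen free_ext_1 free_ext_mult
  free_ext_0 free_ext_uminus free_ext_diff free_ext_power

end

interpretation scalar_map_id: scalar_map "\<lambda>c :: 'k::comm_ring_1. c"
  by standard (simp_all add: mult.commute distrib_right)

interpretation scalar_map_scalar: scalar_map "scalar :: 'k::comm_ring_1 \<Rightarrow> 'w::monoid_add \<Rightarrow>\<^sub>0 'k"
  by standard (rule scalar_0 scalar_1 scalar_add scalar_mult scalar_central)+

section \<open>Tensor squares\<close>

lemma tens_add_left: "(p + p') \<otimes>\<^sub>t r = p \<otimes>\<^sub>t r + p' \<otimes>\<^sub>t r"
  unfolding tens_def
  by (rule keys_sum_add) (simp_all add: distrib_right single_add sum.distrib)

lemma tens_add_right: "p \<otimes>\<^sub>t (r + r') = p \<otimes>\<^sub>t r + p \<otimes>\<^sub>t r'"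
  unfolding tens_def sum.distrib[symmetric]
  by (rule sum.cong[OF refl], rule keys_sum_add) (simp_all add: distrib_left single_add)

lemma single_mult_smul: "Poly_Mapping.single w (c * d) = smul c (Poly_Mapping.single w d)"
  by (simp add: smul_monom_of[symmetric])

lemma tens_smul_left: "smul c p \<otimes>\<^sub>t r = smul c (p \<otimes>\<^sub>t r)"
  unfolding tens_def
  by (subst keys_sum_smul) (simp_all add: smul_sum single_mult_smul mult.assoc)

lemma tens_smul_right: "p \<otimes>\<^sub>t smul c r = smul c (p \<otimes>\<^sub>t r)"
  unfolding tens_def smul_sum
  by (rule sum.cong[OF refl], subst keys_sum_smul)
    (simp_all add: smul_sum single_mult_smul mult.left_commute)

lemma tens_monom: "monom_of u \<otimes>\<^sub>t monom_of v = monom_of (u, v)"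
  by (simp add: tens_def monom_of_def)

lemma tens_mult: "(p \<otimes>\<^sub>t r) * (p' \<otimes>\<^sub>t r') = (p * p') \<otimes>\<^sub>t (r * r')"
proof (induction p rule: monoid_alg_induct)
  case (monom u)
  show ?case
  proof (induction r rule: monoid_alg_induct)
    case (monom v)
    show ?case
    proof (induction p' rule: monoid_alg_induct)
      case (monom u')
      show ?case
        by (induction r' rule: monoid_alg_induct)
          (simp_all add: tens_monom monom_of_plus[symmetric] tens_add_right tens_smul_right
            distrib_left)
    qed (simp_all add: tens_add_left tens_smul_left distrib_left)
  qed (simp_all add: tens_add_right tens_smul_right distrib_right)
qed (simp_all add: tens_add_left tens_smul_left distrib_right)

lemma tens_one: "1 \<otimes>\<^sub>t 1 = 1"
  using tens_monom[of 0 0] by (simp add: monom_of_0 zero_prod_def[symmetric])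

lemma tens_power: "(p \<otimes>\<^sub>t r) ^ n = p ^ n \<otimes>\<^sub>t r ^ n"
  by (induction n) (simp_all add: tens_one tens_mult)

lemma tens_diff_left: "(p - p') \<otimes>\<^sub>t r = p \<otimes>\<^sub>t r - p' \<otimes>\<^sub>t r"
  using tens_add_left[of "p - p'" p' r] by simp

lemma tens_diff_right: "p \<otimes>\<^sub>t (r - r') = p \<otimes>\<^sub>t r - p \<otimes>\<^sub>t r'"
  using tens_add_right[of p "r - r'" r'] by simp

text \<open>This is the functional A \<otimes> B on the tensor square. It sees \<open>A\<close> and
  \<open>B\<close> only through their values on words.\<close>

definition tens_fun :: "(('g, 'k::comm_ring_1) free_alg \<Rightarrow> 'k) \<Rightarrow> (('g, 'k) free_alg \<Rightarrow> 'k) \<Rightarrow>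
    ('g, 'k) free_alg2 \<Rightarrow> 'k"
  where "tens_fun A B = lin_ext (\<lambda>(u, v). A (monom_of u) * B (monom_of v))"

lemma linear_fun_tens_fun: "linear_fun (tens_fun A B)"
  by (simp add: tens_fun_def linear_fun_lin_ext)

lemma tens_fun_monom: "tens_fun A B (monom_of (u, v)) = A (monom_of u) * B (monom_of v)"
  by (simp add: tens_fun_def lin_ext_monom)

lemma tens_fun_tens:
  assumes "linear_fun A" "linear_fun B"
  shows "tens_fun A B (p \<otimes>\<^sub>t r) = A p * B r"
proof (induction p rule: monoid_alg_induct)
  case (monom u)
  show ?case
    by (induction r rule: monoid_alg_induct)
      (simp_all add: tens_monom tens_fun_monom tens_add_right tens_smul_right algebra_simps
        linear_fun_simps[OF linear_fun_tens_fun] linear_fun_simps[OF assms(2)])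
qed (simp_all add: tens_add_left tens_smul_left algebra_simps
      linear_fun_simps[OF linear_fun_tens_fun] linear_fun_simps[OF assms(1)])

text \<open>A factor that is a pure tensor of words can be moved into the two functionals. Since
  only values on words enter, this holds for arbitrary functions \<open>A\<close> and
  \<open>B\<close>.\<close>

lemma tens_fun_mult_monom:
  "tens_fun A B (monom_of (u, v) * t) =
    tens_fun (\<lambda>x. A (monom_of u * x)) (\<lambda>x. B (monom_of v * x)) t"
  "tens_fun A B (t * monom_of (u, v)) =
    tens_fun (\<lambda>x. A (x * monom_of u)) (\<lambda>x. B (x * monom_of v)) t"
proof -
  show "tens_fun A B (monom_of (u, v) * t) =
      tens_fun (\<lambda>x. A (monom_of u * x)) (\<lambda>x. B (monom_of v * x)) t"
    by (rule linear_fun_eqI[OF linear_fun_mult_left linear_fun_tens_fun])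
      (auto simp: linear_fun_tens_fun monom_of_plus[symmetric] tens_fun_monom)
  show "tens_fun A B (t * monom_of (u, v)) =
      tens_fun (\<lambda>x. A (x * monom_of u)) (\<lambda>x. B (x * monom_of v)) t"
    by (rule linear_fun_eqI[OF linear_fun_mult_right linear_fun_tens_fun])
      (auto simp: linear_fun_tens_fun monom_of_plus[symmetric] tens_fun_monom)
qed

lemma tens_fun_add_left: "tens_fun (\<lambda>x. A x + A' x) B t = tens_fun A B t + tens_fun A' B t"
  and tens_fun_add_right: "tens_fun A (\<lambda>x. B x + B' x) t = tens_fun A B t + tens_fun A B' t"
  and tens_fun_smul_left: "tens_fun (\<lambda>x. c * A x) B t = c * tens_fun A B t"
  and tens_fun_smul_right: "tens_fun A (\<lambda>x. c * B x) t = c * tens_fun A B t"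
  by (simp_all add: tens_fun_def lin_ext_def case_prod_beta algebra_simps sum.distrib
      sum_distrib_left)

section \<open>Congruence modulo a two-sided ideal\<close>

text \<open>Formulated for monoid algebras in general, so that it covers both the free algebra and
  its tensor square. Closure under negation and scalars comes from multiplication by
  constants.\<close>

locale two_sided_ideal =
  fixes J :: "('w::monoid_add \<Rightarrow>\<^sub>0 'k::comm_ring_1) set"
  assumes zero_mem: "0 \<in> J"
    and add_mem: "x \<in> J \<Longrightarrow> y \<in> J \<Longrightarrow> x + y \<in> J"
    and mult_left_mem: "x \<in> J \<Longrightarrow> r * x \<in> J"
    and mult_right_mem: "x \<in> J \<Longrightarrow> x * r \<in> J"
begin

lemma uminus_mem: "x \<in> J \<Longrightarrow> - x \<in> J"
  using mult_left_mem[of x "-1"] by simp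

lemma diff_mem: "x \<in> J \<Longrightarrow> y \<in> J \<Longrightarrow> x - y \<in> J"
  using add_mem[of x "- y"] by (simp add: uminus_mem)

definition cong_mod (infix \<open>\<approx>\<close> 50)
  where "x \<approx> y \<longleftrightarrow> x - y \<in> J"

lemma cong_refl [simp, intro]: "x \<approx> x"
  by (simp add: cong_mod_def zero_mem)

lemma cong_sym: "x \<approx> y \<Longrightarrow> y \<approx> x"
  using uminus_mem[of "x - y"] by (simp add: cong_mod_def)

lemma cong_trans [trans]: "x \<approx> y \<Longrightarrow> y \<approx> z \<Longrightarrow> x \<approx> z"
  using add_mem[of "x - y" "y - z"] by (simp add: cong_mod_def)

lemma cong_add: "x \<approx> x' \<Longrightarrow> y \<approx> y' \<Longrightarrow> x + y \<approx> x' + y'"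
  using add_mem[of "x - x'" "y - y'"] by (simp add: cong_mod_def algebra_simps)

lemma cong_diff: "x \<approx> x' \<Longrightarrow> y \<approx> y' \<Longrightarrow> x - y \<approx> x' - y'"
  using diff_mem[of "x - x'" "y - y'"] by (simp add: cong_mod_def algebra_simps)

lemma cong_mult: "x \<approx> x' \<Longrightarrow> y \<approx> y' \<Longrightarrow> x * y \<approx> x' * y'"
  using add_mem[OF mult_right_mem[of "x - x'" y] mult_left_mem[of "y - y'" x']]
  by (simp add: cong_mod_def algebra_simps)

lemma cong_mult_left: "y \<approx> y' \<Longrightarrow> x * y \<approx> x * y'"
  and cong_mult_right: "x \<approx> x' \<Longrightarrow> x * y \<approx> x' * y"
  by (simp_all add: cong_mult)

lemma cong_smul: "x \<approx> y \<Longrightarrow> smul c x \<approx> smul c y"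
  unfolding smul_def by (rule cong_mult_left)

lemma cong_sum: "(\<And>i. i \<in> A \<Longrightarrow> f i \<approx> g i) \<Longrightarrow> sum f A \<approx> sum g A"
  by (induction A rule: infinite_finite_induct) (simp_all add: cong_add)

lemma cong_power: "x \<approx> y \<Longrightarrow> x ^ n \<approx> y ^ n"
  by (induction n) (simp_all add: cong_mult)

lemma cong_0_iff: "x \<approx> 0 \<longleftrightarrow> x \<in> J"
  by (simp add: cong_mod_def)

lemma cong_commute_power:
  assumes "Y * X \<approx> smul p (X * Y)"
  shows "Y * X ^ n \<approx> smul (p ^ n) (X ^ n * Y)" "Y ^ n * X \<approx> smul (p ^ n) (X * Y ^ n)"
proof -
  show "Y * X ^ n \<approx> smul (p ^ n) (X ^ n * Y)"
  proof (induction n)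
    case (Suc n)
    have "Y * X ^ Suc n = (Y * X) * X ^ n"
      by (simp add: mult.assoc)
    also have "\<dots> \<approx> smul p (X * Y) * X ^ n"
      by (rule cong_mult_right[OF assms])
    also have "\<dots> = smul p (X * (Y * X ^ n))"
      by (simp add: mult.assoc)
    also have "\<dots> \<approx> smul p (X * smul (p ^ n) (X ^ n * Y))"
      by (intro cong_smul cong_mult_left Suc)
    also have "\<dots> = smul (p ^ Suc n) (X ^ Suc n * Y)"
      by (simp add: mult.assoc)
    finally show ?case .
  qed simp
  show "Y ^ n * X \<approx> smul (p ^ n) (X * Y ^ n)"
  proof (induction n)
    case (Suc n)
    have "Y ^ Suc n * X = Y * (Y ^ n * X)"
      by (simp add: mult.assoc)
    also have "\<dots> \<approx> Y * smul (p ^ n) (X * Y ^ n)"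
      by (rule cong_mult_left[OF Suc])
    also have "\<dots> = smul (p ^ n) ((Y * X) * Y ^ n)"
      by (simp add: mult.assoc)
    also have "\<dots> \<approx> smul (p ^ n) (smul p (X * Y) * Y ^ n)"
      by (intro cong_smul cong_mult_right assms)
    also have "\<dots> = smul (p ^ Suc n) (X * Y ^ Suc n)"
      by (simp add: mult.assoc mult.commute)
    finally show ?case .
  qed simp
qed

end

section \<open>The binomial theorem at a root of unity\<close>

text \<open>Pascal's recursion for the Gaussian binomials; unlike the quotient formula it also makes
  sense when \<open>p\<close> is a root of unity.\<close>

fun gauss_binomial :: "'k::comm_ring_1 \<Rightarrow> nat \<Rightarrow> nat \<Rightarrow> 'k" where
  "gauss_binomial p n 0 = 1"
| "gauss_binomial p 0 (Suc k) = 0"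
| "gauss_binomial p (Suc n) (Suc k) = gauss_binomial p n k + p ^ Suc k * gauss_binomial p n (Suc k)"

lemma gauss_binomial_above: "n < k \<Longrightarrow> gauss_binomial p n k = 0"
  by (induction p n k rule: gauss_binomial.induct) auto

lemma gauss_binomial_diag: "gauss_binomial p n n = 1"
  by (induction n) (simp_all add: gauss_binomial_above)

text \<open>The absorption identity for q-integers, with both sides multiplied by
  \<open>p - 1\<close> so that no fractions occur.\<close>

lemma gauss_binomial_absorb:
  "(p ^ Suc k - 1) * gauss_binomial p (Suc n) (Suc k) = (p ^ Suc n - 1) * gauss_binomial p n k"
proof (induction n arbitrary: k)
  case 0
  show ?case
    by (cases k) simp_all
next
  case (Suc n)
  let ?G = "gauss_binomial p"
  have "(p ^ Suc k - 1) * ?G (Suc (Suc n)) (Suc k) =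
      (p ^ Suc k - 1) * ?G (Suc n) k + p ^ Suc k * ((p ^ Suc k - 1) * ?G (Suc n) (Suc k))"
    by (simp add: algebra_simps)
  also have "\<dots> = (p ^ Suc k - 1) * ?G (Suc n) k + p ^ Suc k * ((p ^ Suc n - 1) * ?G n k)"
    by (simp only: Suc)
  also have "\<dots> = (p ^ Suc (Suc n) - 1) * ?G (Suc n) k"
  proof (cases k)
    case (Suc l)
    have "p ^ k * ((p ^ Suc n - 1) * ?G n k) = (p ^ Suc n - 1) * (?G (Suc n) k - ?G n l)"
      using Suc by (simp add: algebra_simps)
    also have "\<dots> = (p ^ Suc n - 1) * ?G (Suc n) k - (p ^ k - 1) * ?G (Suc n) k"
      using Suc.IH[of l] unfolding Suc by (simp only: right_diff_distrib)
    finally have "p ^ k * ((p ^ Suc n - 1) * ?G n k) = (p ^ Suc n - p ^ k) * ?G (Suc n) k"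
      by (simp add: algebra_simps)
    \<comment> \<open>The goal contains \<open>p ^ Suc k\<close>, one factor \<open>p\<close> more
      than the recursion for \<open>?G (Suc n) k\<close> provides.\<close>
    then have "p * (p ^ k * ((p ^ Suc n - 1) * ?G n k)) = p * ((p ^ Suc n - p ^ k) * ?G (Suc n) k)"
      by (simp only:)
    then show ?thesis
      by (simp only: power_Suc mult.assoc) (simp add: algebra_simps)
  qed (simp add: algebra_simps)
  finally show ?case .
qed

text \<open>In \<open>gauss_binomial_absorb\<close> the factor \<open>p ^ N - 1\<close> on the right
  vanishes while \<open>p ^ k - 1\<close> on the left can be cancelled.\<close>

lemma gauss_binomial_root_of_unity:
  fixes p :: "'k::idom"
  assumes "p ^ N = 1" "0 < k" "k < N" "p ^ k \<noteq> 1"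
  shows "gauss_binomial p N k = 0"
proof -
  obtain n l where "N = Suc n" "k = Suc l"
    using assms(2,3) by (metis Suc_lessE gr0_implies_Suc)
  then show ?thesis
    using gauss_binomial_absorb[of p l n] assms by auto
qed

context two_sided_ideal
begin

lemma q_binomial:
  assumes comm: "Y * X \<approx> smul p (X * Y)"
  shows "(X + Y) ^ n \<approx> (\<Sum>k\<le>n. smul (gauss_binomial p n k) (X ^ k * Y ^ (n - k)))"
proof (induction n)
  case (Suc n)
  let ?G = "gauss_binomial p"
  have "(X + Y) ^ Suc n \<approx> (X + Y) * (\<Sum>k\<le>n. smul (?G n k) (X ^ k * Y ^ (n - k)))"
    by (simp add: cong_mult_left[OF Suc])
  also have "\<dots> = (\<Sum>k\<le>n. smul (?G n k) (X ^ Suc k * Y ^ (n - k))) +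
      (\<Sum>k\<le>n. smul (?G n k) ((Y * X ^ k) * Y ^ (n - k)))"
    by (simp add: distrib_right sum_distrib_left mult.assoc smul_add sum.distrib)
  also have "\<dots> \<approx> (\<Sum>k\<le>n. smul (?G n k) (X ^ Suc k * Y ^ (n - k))) +
      (\<Sum>k\<le>n. smul (?G n k) (smul (p ^ k) (X ^ k * Y) * Y ^ (n - k)))"
    by (intro cong_add cong_refl cong_sum cong_smul cong_mult_right cong_commute_power comm)
  also have "(\<Sum>k\<le>n. smul (?G n k) (smul (p ^ k) (X ^ k * Y) * Y ^ (n - k))) =
      (\<Sum>k\<le>n. smul (p ^ k * ?G n k) (X ^ k * Y ^ (Suc n - k)))"
    by (rule sum.cong) (simp_all add: mult.assoc mult.commute Suc_diff_le)
  \<comment> \<open>The added term is zero, because Gaussian binomials vanish above the diagonal; it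
    makes room for the index shift.\<close>
  also have "\<dots> = (\<Sum>k\<le>Suc n. smul (p ^ k * ?G n k) (X ^ k * Y ^ (Suc n - k)))"
    by (simp add: gauss_binomial_above)
  also have "\<dots> = Y ^ Suc n +
      (\<Sum>k\<le>n. smul (p ^ Suc k * ?G n (Suc k)) (X ^ Suc k * Y ^ (Suc n - Suc k)))"
    by (simp add: sum.atMost_Suc_shift del: sum.atMost_Suc)
  also have "(\<Sum>k\<le>n. smul (?G n k) (X ^ Suc k * Y ^ (n - k))) + (Y ^ Suc n +
      (\<Sum>k\<le>n. smul (p ^ Suc k * ?G n (Suc k)) (X ^ Suc k * Y ^ (Suc n - Suc k)))) =
      Y ^ Suc n + (\<Sum>k\<le>n. smul (?G (Suc n) (Suc k)) (X ^ Suc k * Y ^ (Suc n - Suc k)))"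
    by (simp add: add_smul sum.distrib algebra_simps)
  also have "\<dots> = (\<Sum>k\<le>Suc n. smul (?G (Suc n) k) (X ^ k * Y ^ (Suc n - k)))"
    by (simp add: sum.atMost_Suc_shift del: sum.atMost_Suc gauss_binomial.simps(3))
  finally show ?case .
qed simp

end

text \<open>Only the two outer terms survive. It is applied four times: in the tensor square to show
  that the coproduct respects \<open>E ^ N\<close> and \<open>F ^ N\<close>, and in the algebra
  itself to compute the \<open>N\<close>-th powers of the generators of the coideal
  subalgebra.\<close>

lemma (in two_sided_ideal) binomial_at_root_of_unity:
  assumes "Y * X \<approx> smul p (X * Y)"
    and "\<And>m. 0 < m \<Longrightarrow> m < N \<Longrightarrow> gauss_binomial p N m = 0" "N > 0"
  shows "(X + Y) ^ N \<approx> X ^ N + Y ^ N"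
proof -
  have "(\<Sum>k\<le>N. smul (gauss_binomial p N k) (X ^ k * Y ^ (N - k))) =
      (\<Sum>k\<in>{0, N}. smul (gauss_binomial p N k) (X ^ k * Y ^ (N - k)))"
    by (rule sum.mono_neutral_right) (use assms(2) in auto)
  also have "\<dots> = X ^ N + Y ^ N"
    using assms(3) by (simp add: gauss_binomial_diag add.commute)
  finally show ?thesis
    using q_binomial[OF assms(1), of N] by simp
qed

section \<open>Presented algebras\<close>

lemma free_ring_simps:
  "carrier free_ring = UNIV" "x \<otimes>\<^bsub>free_ring\<^esub> y = x * y" "\<one>\<^bsub>free_ring\<^esub> = 1"
  "\<zero>\<^bsub>free_ring\<^esub> = 0" "x \<oplus>\<^bsub>free_ring\<^esub> y = x + y"
  by (simp_all add: free_ring_def)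

lemma ideal_free_ring_iff: "ideal J free_ring \<longleftrightarrow> two_sided_ideal J"
  for J :: "('g, 'k::comm_ring_1) free_alg set"
proof
  assume "ideal J free_ring"
  then interpret ideal J "free_ring :: ('g, 'k) free_alg ring" .
  show "two_sided_ideal J"
    using additive_subgroup.zero_closed[OF is_additive_subgroup]
      additive_subgroup.a_closed[OF is_additive_subgroup] I_l_closed I_r_closed
    by unfold_locales (simp_all add: free_ring_simps)
next
  assume "two_sided_ideal J"
  then interpret two_sided_ideal J .
  show "ideal J free_ring"
  proof (rule idealI[OF ring_free_ring])
    show "subgroup J (add_monoid free_ring)"
    proof
      fix x assume "x \<in> J"
      moreover have "inv\<^bsub>add_monoid free_ring\<^esub> x = - x"
        by (rule group.inv_equality[OF abelian_group.a_group[OF ring.is_abelian_group[OF ring_free_ring]]])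
          (simp_all add: free_ring_simps)
      ultimately show "inv\<^bsub>add_monoid free_ring\<^esub> x \<in> J"
        by (simp add: uminus_mem)
    qed (simp_all add: free_ring_simps zero_mem add_mem)
  qed (simp_all add: free_ring_simps mult_left_mem mult_right_mem)
qed

lemma ideal_pideal: "ideal (pideal P) free_ring"
  unfolding pideal_def by (rule ring.genideal_ideal[OF ring_free_ring]) (simp add: free_ring_simps)

lemma two_sided_pideal: "two_sided_ideal (pideal P)"
  using ideal_pideal ideal_free_ring_iff by blast

lemma rels_subset_pideal: "rels P \<subseteq> pideal P"
  unfolding pideal_def by (rule ring.genideal_self[OF ring_free_ring]) (simp add: free_ring_simps)

text \<open>Below, \<open>J\<close> is a kernel or the preimage of an ideal, so that
  well-definedness on the quotient reduces to a check of the relations.\<close>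

lemma pideal_subset: "two_sided_ideal J \<Longrightarrow> rels P \<subseteq> J \<Longrightarrow> pideal P \<subseteq> J"
  unfolding pideal_def by (rule ring.genideal_minimal[OF ring_free_ring]) (simp_all add: ideal_free_ring_iff)

lemma pcls_eq: "pcls P p = (\<lambda>i. i + p) ` pideal P"
  by (auto simp: pcls_def a_r_coset_def' free_ring_simps)

lemma mem_pcls_iff: "r \<in> pcls P p \<longleftrightarrow> r - p \<in> pideal P"
  unfolding pcls_eq by (auto intro: image_eqI[of _ _ "r - p"])

lemma pcls_self: "p \<in> pcls P p"
  by (simp add: mem_pcls_iff two_sided_ideal.zero_mem[OF two_sided_pideal])

lemma pcls_eq_iff: "pcls P p = pcls P r \<longleftrightarrow> p - r \<in> pideal P"
proof -
  interpret two_sided_ideal "pideal P"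
    by (rule two_sided_pideal)
  show ?thesis
  proof
    assume "pcls P p = pcls P r"
    then show "p - r \<in> pideal P"
      using pcls_self[of p P] by (simp add: mem_pcls_iff)
  next
    assume *: "p - r \<in> pideal P"
    have "t - p \<in> pideal P \<longleftrightarrow> t - r \<in> pideal P" for t
      using add_mem[OF _ *, of "t - p"] diff_mem[OF _ *, of "t - r"] by auto
    then show "pcls P p = pcls P r"
      by (auto simp: mem_pcls_iff)
  qed
qed

lemma carrier_palg: "carrier (palg P) = range (pcls P)"
  by (auto simp: palg_def ring.defs module.defs FactRing_def A_RCOSETS_def' free_ring_simps pcls_def)

lemma zero_palg: "\<zero>\<^bsub>palg P\<^esub> = pcls P 0"
  by (simp add: palg_def ring.defs module.defs FactRing_def pcls_eq)

lemma one_palg: "\<one>\<^bsub>palg P\<^esub> = pcls P 1"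
  by (simp add: palg_def ring.defs module.defs FactRing_def free_ring_simps pcls_def)

lemma mult_palg: "pcls P p \<otimes>\<^bsub>palg P\<^esub> pcls P r = pcls P (p * r)"
  using ideal.rcoset_mult_add[OF ideal_pideal[of P], of p r]
  by (simp add: palg_def ring.defs module.defs FactRing_def free_ring_simps pcls_def)

lemma add_palg: "pcls P p \<oplus>\<^bsub>palg P\<^esub> pcls P r = pcls P (p + r)"
proof -
  interpret ideal "pideal P" free_ring
    by (rule ideal_pideal)
  show ?thesis
    using a_rcos_sum[of p r]
    by (simp add: palg_def ring.defs module.defs FactRing_def free_ring_simps pcls_def)
qed

lemma smult_palg: "c \<odot>\<^bsub>palg P\<^esub> pcls P p = pcls P (smul c p)"
  using ideal.rcoset_mult_add[OF ideal_pideal[of P], of "scalar c" p]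
  by (simp add: palg_def ring.defs module.defs FactRing_def free_ring_simps pcls_def smul_def)

lemmas palg_simps = carrier_palg zero_palg one_palg mult_palg add_palg smult_palg

lemma ring_palg: "ring (palg P)"
proof (rule ringI)
  show "abelian_group (palg P)"
  proof (rule abelian_groupI)
    fix x assume "x \<in> carrier (palg P)"
    then obtain p where "x = pcls P p"
      by (auto simp: palg_simps)
    then have "pcls P (- p) \<oplus>\<^bsub>palg P\<^esub> x = \<zero>\<^bsub>palg P\<^esub>"
      by (simp add: palg_simps)
    then show "\<exists>y\<in>carrier (palg P). y \<oplus>\<^bsub>palg P\<^esub> x = \<zero>\<^bsub>palg P\<^esub>"
      by (auto simp: carrier_palg)
  qed (auto simp: palg_simps algebra_simps)
  show "monoid (palg P)"
    by (rule monoidI) (auto simp: palg_simps algebra_simps)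
qed (auto simp: palg_simps algebra_simps)

lemma pow_palg: "pcls P p [^]\<^bsub>palg P\<^esub> (n::nat) = pcls P (p ^ n)"
  by (induction n) (simp_all add: monoid.nat_pow_0[OF ring.is_monoid[OF ring_palg]]
      monoid.nat_pow_Suc[OF ring.is_monoid[OF ring_palg]] one_palg mult_palg power_commutes)

lemma finsum_palg:
  assumes "finite A"
  shows "(\<Oplus>\<^bsub>palg P\<^esub>i\<in>A. pcls P (f i)) = pcls P (sum f A)"
proof -
  interpret ring "palg P"
    by (rule ring_palg)
  show ?thesis
    using assms by (induction A) (simp_all add: palg_simps)
qed

lemma poly_eval_palg:
  "poly_eval (palg P) r (pcls P p) = pcls P (\<Sum>i\<le>Polynomial.degree r. smul (Polynomial.coeff r i) (p ^ i))"
  by (simp add: poly_eval_def pow_palg smult_palg finsum_palg)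

text \<open>Evaluates the functions on cosets that are defined through \<open>the_elem\<close>, once
  they are known to ignore the ideal.\<close>

lemma the_elem_image_pcls:
  assumes "\<And>i. i \<in> pideal P \<Longrightarrow> h (i + p) = h p"
  shows "the_elem (h ` pcls P p) = h p"
proof -
  have "h ` pcls P p = {h p}"
    using assms pcls_self[of p P] by (auto simp: pcls_eq)
  then show ?thesis
    by simp
qed

text \<open>This contains \<open>I \<otimes> F + F \<otimes> I\<close>. A comultiplication that maps \<open>I\<close> into it can be evaluated on the
  quotient by any pair of functionals.\<close>

definition tens_ideal :: "('g, 'k::comm_ring_1) free_alg set \<Rightarrow> ('g, 'k) free_alg2 set"
  where "tens_ideal I = {t. \<forall>A B. linear_fun A \<and> linear_fun B \<and> (\<forall>x\<in>I. A x = 0 \<and> B x = 0) \<longrightarrow>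
    tens_fun A B t = 0}"

text \<open>Multiplication by a pair of words replaces \<open>A\<close> and \<open>B\<close> by
  their composites with multiplication by these words. The composites are again linear and vanish on
  \<open>I\<close>, because \<open>I\<close> is two-sided.\<close>

lemma two_sided_tens_ideal:
  assumes "two_sided_ideal I"
  shows "two_sided_ideal (tens_ideal I)"
proof -
  interpret two_sided_ideal I
    by (rule assms)
  note [simp] = linear_fun_simps[OF linear_fun_tens_fun]
  have add: "x + y \<in> tens_ideal I" if "x \<in> tens_ideal I" "y \<in> tens_ideal I" for x y
    using that by (simp add: tens_ideal_def)
  have smul: "smul c x \<in> tens_ideal I" if "x \<in> tens_ideal I" for c x
    using that by (simp add: tens_ideal_def)
  show ?thesis
  proof
    fix x r
    assume x: "x \<in> tens_ideal I"
    show "r * x \<in> tens_ideal I"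
    proof (induction r rule: monoid_alg_induct)
      case (monom w)
      obtain u v where w: "w = (u, v)"
        by fastforce
      have "tens_fun A B (monom_of w * x) = 0"
        if AB: "linear_fun A" "linear_fun B" "\<forall>x\<in>I. A x = 0 \<and> B x = 0" for A B
      proof -
        have "linear_fun (\<lambda>x. A (monom_of u * x))" "linear_fun (\<lambda>x. B (monom_of v * x))"
          using AB by (simp_all add: linear_fun_mult_left)
        moreover have "\<forall>x\<in>I. A (monom_of u * x) = 0 \<and> B (monom_of v * x) = 0"
          using AB(3) by (simp add: mult_left_mem)
        ultimately show ?thesis
          using x by (simp add: w tens_fun_mult_monom tens_ideal_def)
      qed
      then show ?case
        by (simp add: tens_ideal_def)
    qed (simp_all add: add smul distrib_right)
    show "x * r \<in> tens_ideal I"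
    proof (induction r rule: monoid_alg_induct)
      case (monom w)
      obtain u v where w: "w = (u, v)"
        by fastforce
      have "tens_fun A B (x * monom_of w) = 0"
        if AB: "linear_fun A" "linear_fun B" "\<forall>x\<in>I. A x = 0 \<and> B x = 0" for A B
      proof -
        have "linear_fun (\<lambda>x. A (x * monom_of u))" "linear_fun (\<lambda>x. B (x * monom_of v))"
          using AB by (simp_all add: linear_fun_mult_right)
        moreover have "\<forall>x\<in>I. A (x * monom_of u) = 0 \<and> B (x * monom_of v) = 0"
          using AB(3) by (simp add: mult_right_mem)
        ultimately show ?thesis
          using x by (simp add: w tens_fun_mult_monom tens_ideal_def)
      qed
      then show ?case
        by (simp add: tens_ideal_def)
    qed (simp_all add: add smul distrib_left)
  qed (auto simp: tens_ideal_def add)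
qed

lemma tens_ideal_left: "x \<in> I \<Longrightarrow> x \<otimes>\<^sub>t y \<in> tens_ideal I"
  and tens_ideal_right: "x \<in> I \<Longrightarrow> y \<otimes>\<^sub>t x \<in> tens_ideal I"
  by (auto simp: tens_ideal_def tens_fun_tens)

section \<open>The small quantum group\<close>

locale odd_root_of_unity =
  fixes q :: "'k::field" and N :: nat
  assumes N_gt_1: "N > 1" and odd_N: "odd N"
    and q_pow_N: "q ^ N = 1" and q_primitive: "\<And>m. 0 < m \<Longrightarrow> m < N \<Longrightarrow> q ^ m \<noteq> 1"
begin

lemma q_nonzero: "q \<noteq> 0"
  using q_pow_N N_gt_1 by (auto simp: power_0_left)

lemma q2_pow_N: "(q ^ 2) ^ N = 1"
  by (simp add: power_mult[symmetric] mult.commute[of 2]) (simp add: power_mult q_pow_N)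

text \<open>Oddness of \<open>N\<close> enters here: \<open>2 * m\<close> differs from
  \<open>N\<close>, so \<open>2 * m\<close> or \<open>2 * m - N\<close> lies strictly between
  \<open>0\<close> and \<open>N\<close>, which contradicts the primitivity of
  \<open>q\<close>.\<close>

lemma q2_primitive:
  assumes "0 < m" "m < N"
  shows "(q ^ 2) ^ m \<noteq> 1"
proof
  assume *: "(q ^ 2) ^ m = 1"
  have "2 * m \<noteq> N"
    using odd_N by auto
  then consider "2 * m < N" | "2 * m > N"
    by linarith
  then show False
  proof cases
    case 1
    then show False
      using * q_primitive[of "2 * m"] assms by (simp add: power_mult)
  next
    case 2
    have "q ^ (2 * m - N) * q ^ N = q ^ (2 * m)"
      using 2 by (simp add: power_add[symmetric])
    then have "q ^ (2 * m - N) = 1"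
      using * by (simp add: q_pow_N power_mult)
    then show False
      using q_primitive[of "2 * m - N"] 2 assms by simp
  qed
qed

lemma q2_neq_1: "q ^ 2 \<noteq> 1"
  using q2_primitive[of 1] N_gt_1 by simp

lemma q_diff_nonzero: "q - inverse q \<noteq> 0"
proof
  assume "q - inverse q = 0"
  then have "q * q = 1"
    using q_nonzero by (simp add: field_simps)
  then show False
    using q2_neq_1 by (simp add: power2_eq_square)
qed

lemma inverse_q_pow: "q ^ (N - 1) = inverse q" "inverse q ^ (N - 1) = q"
proof -
  have "q * q ^ (N - 1) = 1"
    using q_pow_N N_gt_1 by (cases N) simp_all
  then show "q ^ (N - 1) = inverse q"
    by (simp add: inverse_unique)
  then show "inverse q ^ (N - 1) = q"
    by (metis power_inverse inverse_inverse_eq)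
qed

lemma gauss_binomial_q2: "0 < m \<Longrightarrow> m < N \<Longrightarrow> gauss_binomial (q ^ 2) N m = 0"
  by (rule gauss_binomial_root_of_unity) (simp_all add: q2_pow_N q2_primitive)

text \<open>These q-integers are the coefficients with which \<open>E\<close> acts on powers of
  \<open>b\<close>; their non-vanishing keeps leading terms alive.\<close>

lemma q2_geometric_nonzero:
  assumes "0 < n" "n < N"
  shows "(\<Sum>l<n. (q ^ 2) ^ l) \<noteq> 0"
  using q2_primitive[OF assms] power_diff_1_eq[of "q ^ 2" n] by auto

abbreviation "PU \<equiv> U_pres q N"
abbreviation "PO \<equiv> O_pres q N"
abbreviation "E \<equiv> gen Gen_E :: (U_gen, 'k) free_alg"
abbreviation "F \<equiv> gen Gen_F :: (U_gen, 'k) free_alg"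
abbreviation "K \<equiv> gen Gen_K :: (U_gen, 'k) free_alg"

sublocale U: two_sided_ideal "pideal PU"
  by (rule two_sided_pideal)

sublocale O: two_sided_ideal "pideal PO"
  by (rule two_sided_pideal)

sublocale UU: two_sided_ideal "tens_ideal (pideal PU)"
  by (rule two_sided_tens_ideal[OF two_sided_pideal])

notation U.cong_mod (infix \<open>\<approx>\<^sub>U\<close> 50)
notation O.cong_mod (infix \<open>\<approx>\<^sub>O\<close> 50)
notation UU.cong_mod (infix \<open>\<approx>\<^sub>U\<^sub>U\<close> 50)

lemma rels_U: "rels PU = {K ^ N - 1, K * E - smul (q ^ 2) (E * K),
    K * F - smul (inverse (q ^ 2)) (F * K), E ^ N, F ^ N,
    E * F - F * E - smul (1 / (q - inverse q)) (K - K ^ (N - 1))}"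
  by (simp add: U_pres_def Let_def scalar_conv_smul del: power_inverse inverse_eq_divide)

lemma U_relations:
  "K ^ N \<approx>\<^sub>U 1" "K * E \<approx>\<^sub>U smul (q ^ 2) (E * K)" "K * F \<approx>\<^sub>U smul (inverse (q ^ 2)) (F * K)"
  "E ^ N \<approx>\<^sub>U 0" "F ^ N \<approx>\<^sub>U 0"
  "E * F - F * E \<approx>\<^sub>U smul (1 / (q - inverse q)) (K - K ^ (N - 1))"
  using rels_subset_pideal[of PU] unfolding rels_U U.cong_mod_def by simp_all

section \<open>Comultiplication and counit of the small quantum group descend to the
  quotient\<close>

abbreviation "\<Delta>U \<equiv> free_comult PU"

lemma comult_U_gen:
  "\<Delta>U E = E \<otimes>\<^sub>t K + 1 \<otimes>\<^sub>t E" "\<Delta>U F = F \<otimes>\<^sub>t 1 + K ^ (N - 1) \<otimes>\<^sub>t F" "\<Delta>U K = K \<otimes>\<^sub>t K"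
  by (simp_all add: free_comult_def scalar_map_scalar.free_ext_simps U_pres_def Let_def)

end

lemma free_comult_simps:
  "free_comult P (x + y) = free_comult P x + free_comult P y"
  "free_comult P (x - y) = free_comult P x - free_comult P y"
  "free_comult P (- x) = - free_comult P x"
  "free_comult P (smul c x) = smul c (free_comult P x)"
  "free_comult P (x * y) = free_comult P x * free_comult P y"
  "free_comult P (x ^ n) = free_comult P x ^ n"
  "free_comult P 1 = 1" "free_comult P 0 = 0"
  by (simp_all add: free_comult_def scalar_map_scalar.free_ext_simps smul_def[symmetric])

context odd_root_of_unity
begin

lemma tens_cong: "x \<approx>\<^sub>U x' \<Longrightarrow> y \<approx>\<^sub>U y' \<Longrightarrow> x \<otimes>\<^sub>t y \<approx>\<^sub>U\<^sub>U x' \<otimes>\<^sub>t y'"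
proof -
  assume *: "x \<approx>\<^sub>U x'" "y \<approx>\<^sub>U y'"
  have "x \<otimes>\<^sub>t y - x' \<otimes>\<^sub>t y' = (x - x') \<otimes>\<^sub>t y + x' \<otimes>\<^sub>t (y - y')"
    by (simp add: tens_diff_left tens_diff_right)
  then show ?thesis
    using * tens_ideal_left[of "x - x'"] tens_ideal_right[of "y - y'"]
    by (simp add: U.cong_mod_def UU.cong_mod_def UU.add_mem)
qed

lemma tens_0 [simp]: "0 \<otimes>\<^sub>t y = 0" "x \<otimes>\<^sub>t 0 = 0"
  using tens_smul_left[of 0 0 y] tens_smul_right[of x 0 0] by simp_all

lemma K_pow_comm:
  "K ^ n * E \<approx>\<^sub>U smul ((q ^ 2) ^ n) (E * K ^ n)"
  "K ^ n * F \<approx>\<^sub>U smul (inverse (q ^ 2) ^ n) (F * K ^ n)"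
  using U.cong_commute_power(2) U_relations by blast+

lemma inverse_q2_pow: "(q ^ 2) ^ (N - 1) = inverse (q ^ 2)" "inverse (q ^ 2) ^ (N - 1) = q ^ 2"
proof -
  show "(q ^ 2) ^ (N - 1) = inverse (q ^ 2)"
    by (metis inverse_q_pow(1) power_inverse power_commuting_commutes power_mult mult.commute)
  then show "inverse (q ^ 2) ^ (N - 1) = q ^ 2"
    by (metis power_inverse inverse_inverse_eq)
qed

text \<open>The two summands of \<open>\<Delta>U E\<close> commute up to the factor
  \<open>q ^ 2\<close>, so the binomial theorem leaves only their \<open>N\<close>-th powers, each
  of which has \<open>E ^ N\<close> in one leg.\<close>

lemma comult_U_relation_E: "\<Delta>U (E ^ N) \<in> tens_ideal (pideal PU)"
proof -
  have "(1 \<otimes>\<^sub>t E) * (E \<otimes>\<^sub>t K) = E \<otimes>\<^sub>t (E * K)"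
    by (simp add: tens_mult)
  also have "\<dots> = smul (inverse (q ^ 2)) (E \<otimes>\<^sub>t smul (q ^ 2) (E * K))"
    using q_nonzero by (simp add: tens_smul_right)
  also have "\<dots> \<approx>\<^sub>U\<^sub>U smul (inverse (q ^ 2)) (E \<otimes>\<^sub>t (K * E))"
    by (intro UU.cong_smul tens_cong U.cong_refl U.cong_sym[OF U_relations(2)])
  finally have *: "smul (q ^ 2) ((1 \<otimes>\<^sub>t E) * (E \<otimes>\<^sub>t K)) \<approx>\<^sub>U\<^sub>U E \<otimes>\<^sub>t (K * E)"
    using UU.cong_smul[of _ _ "q ^ 2"] q_nonzero by fastforce
  have "(E \<otimes>\<^sub>t K) * (1 \<otimes>\<^sub>t E) \<approx>\<^sub>U\<^sub>U smul (q ^ 2) ((1 \<otimes>\<^sub>t E) * (E \<otimes>\<^sub>t K))"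
    using UU.cong_sym[OF *] by (simp add: tens_mult)
  then have "(1 \<otimes>\<^sub>t E + E \<otimes>\<^sub>t K) ^ N \<approx>\<^sub>U\<^sub>U (1 \<otimes>\<^sub>t E) ^ N + (E \<otimes>\<^sub>t K) ^ N"
    by (rule UU.binomial_at_root_of_unity) (use gauss_binomial_q2 N_gt_1 in auto)
  also have "\<dots> = 1 \<otimes>\<^sub>t E ^ N + E ^ N \<otimes>\<^sub>t K ^ N"
    by (simp add: tens_power)
  also have "\<dots> \<approx>\<^sub>U\<^sub>U 1 \<otimes>\<^sub>t 0 + 0 \<otimes>\<^sub>t K ^ N"
    by (intro UU.cong_add tens_cong U.cong_refl U_relations)
  finally show ?thesis
    by (simp add: free_comult_simps comult_U_gen UU.cong_0_iff add.commute)
qed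

text \<open>As for \<open>E\<close>. The factor \<open>q ^ 2\<close> now arises as the power
  \<open>N - 1\<close> of its own inverse, since \<open>K ^ (N - 1)\<close> has to pass
  \<open>F\<close>.\<close>

lemma comult_U_relation_F: "\<Delta>U (F ^ N) \<in> tens_ideal (pideal PU)"
proof -
  have "(K ^ (N - 1) \<otimes>\<^sub>t F) * (F \<otimes>\<^sub>t 1) = (K ^ (N - 1) * F) \<otimes>\<^sub>t F"
    by (simp add: tens_mult)
  also have "\<dots> \<approx>\<^sub>U\<^sub>U smul (inverse (q ^ 2) ^ (N - 1)) (F * K ^ (N - 1)) \<otimes>\<^sub>t F"
    by (intro tens_cong U.cong_refl K_pow_comm)
  also have "\<dots> = smul (q ^ 2) ((F \<otimes>\<^sub>t 1) * (K ^ (N - 1) \<otimes>\<^sub>t F))"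
    by (simp only: inverse_q2_pow tens_mult tens_smul_left) simp
  finally have "(F \<otimes>\<^sub>t 1 + K ^ (N - 1) \<otimes>\<^sub>t F) ^ N \<approx>\<^sub>U\<^sub>U (F \<otimes>\<^sub>t 1) ^ N + (K ^ (N - 1) \<otimes>\<^sub>t F) ^ N"
    by (rule UU.binomial_at_root_of_unity) (use gauss_binomial_q2 N_gt_1 in auto)
  also have "\<dots> = F ^ N \<otimes>\<^sub>t 1 + (K ^ (N - 1)) ^ N \<otimes>\<^sub>t F ^ N"
    by (simp add: tens_power)
  also have "\<dots> \<approx>\<^sub>U\<^sub>U 0 \<otimes>\<^sub>t 1 + (K ^ (N - 1)) ^ N \<otimes>\<^sub>t 0"
    by (intro UU.cong_add tens_cong U.cong_refl U_relations)
  finally show ?thesis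
    by (simp add: free_comult_simps comult_U_gen UU.cong_0_iff)
qed

text \<open>The mixed terms of the two products agree: the factor \<open>inverse (q ^ 2)\<close>
  from moving \<open>?K'\<close> past \<open>E\<close> in the left leg turns \<open>F * K\<close>
  into \<open>K * F\<close> in the right leg.\<close>

lemma comult_U_relation_EF:
  "\<Delta>U (E * F - F * E - smul (1 / (q - inverse q)) (K - K ^ (N - 1))) \<in> tens_ideal (pideal PU)"
proof -
  let ?K' = "K ^ (N - 1)" and ?c = "1 / (q - inverse q)"
  have KE: "?K' * E \<approx>\<^sub>U smul (inverse (q ^ 2)) (E * ?K')"
    using K_pow_comm(1)[of "N - 1"] by (simp only: inverse_q2_pow)
  have "(?K' * E) \<otimes>\<^sub>t (F * K) \<approx>\<^sub>U\<^sub>U smul (inverse (q ^ 2)) (E * ?K') \<otimes>\<^sub>t (F * K)"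
    by (intro tens_cong KE U.cong_refl)
  also have "\<dots> = (E * ?K') \<otimes>\<^sub>t smul (inverse (q ^ 2)) (F * K)"
    by (simp only: tens_smul_left tens_smul_right)
  also have "\<dots> \<approx>\<^sub>U\<^sub>U (E * ?K') \<otimes>\<^sub>t (K * F)"
    by (intro tens_cong U.cong_refl U.cong_sym[OF U_relations(3)])
  finally have mixed: "(?K' * E) \<otimes>\<^sub>t (F * K) \<approx>\<^sub>U\<^sub>U (E * ?K') \<otimes>\<^sub>t (K * F)" .
  have "\<Delta>U (E * F - F * E) = (E * F - F * E) \<otimes>\<^sub>t K + ?K' \<otimes>\<^sub>t (E * F - F * E) +
      ((E * ?K') \<otimes>\<^sub>t (K * F) - (?K' * E) \<otimes>\<^sub>t (F * K))"
    by (simp add: free_comult_simps comult_U_gen distrib_left distrib_right tens_mult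
        tens_diff_left tens_diff_right)
  also have "\<dots> \<approx>\<^sub>U\<^sub>U smul ?c (K - ?K') \<otimes>\<^sub>t K + ?K' \<otimes>\<^sub>t smul ?c (K - ?K') +
      ((E * ?K') \<otimes>\<^sub>t (K * F) - (E * ?K') \<otimes>\<^sub>t (K * F))"
    by (intro UU.cong_add UU.cong_diff tens_cong U_relations U.cong_refl UU.cong_refl mixed)
  \<comment> \<open>The sum telescopes, since \<open>?K' \<otimes>\<^sub>t K\<close> occurs with
    both signs.\<close>
  also have "\<dots> = \<Delta>U (smul ?c (K - ?K'))"
    by (simp add: free_comult_simps comult_U_gen tens_power tens_diff_left tens_diff_right
        tens_smul_left tens_smul_right smul_diff)
  finally show ?thesis
    by (simp only: free_comult_simps UU.cong_mod_def)
qed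

lemma comult_U_descends:
  assumes "x \<in> pideal PU"
  shows "\<Delta>U x \<in> tens_ideal (pideal PU)"
proof -
  let ?J = "{x. \<Delta>U x \<in> tens_ideal (pideal PU)}"
  have "two_sided_ideal ?J"
    by standard (simp_all add: free_comult_simps UU.zero_mem UU.add_mem UU.mult_left_mem
        UU.mult_right_mem)
  moreover have "rels PU \<subseteq> ?J"
  proof -
    have "\<Delta>U (K ^ N) \<approx>\<^sub>U\<^sub>U 1 \<otimes>\<^sub>t 1"
      unfolding free_comult_simps comult_U_gen tens_power by (intro tens_cong U_relations)
    then have "\<Delta>U (K ^ N - 1) \<in> tens_ideal (pideal PU)"
      by (simp add: free_comult_simps UU.cong_mod_def tens_one)
    moreover have "\<Delta>U (K * E - smul (q ^ 2) (E * K)) \<in> tens_ideal (pideal PU)"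
    proof -
      have "\<Delta>U (K * E) = (K * E) \<otimes>\<^sub>t (K * K) + K \<otimes>\<^sub>t (K * E)"
        by (simp add: free_comult_simps comult_U_gen distrib_left tens_mult)
      also have "\<dots> \<approx>\<^sub>U\<^sub>U smul (q ^ 2) (E * K) \<otimes>\<^sub>t (K * K) + K \<otimes>\<^sub>t smul (q ^ 2) (E * K)"
        by (intro UU.cong_add tens_cong U_relations U.cong_refl)
      also have "\<dots> = \<Delta>U (smul (q ^ 2) (E * K))"
        by (simp add: free_comult_simps comult_U_gen distrib_right tens_mult tens_smul_left
            tens_smul_right smul_add)
      finally show ?thesis
        by (simp only: free_comult_simps UU.cong_mod_def)
    qed
    moreover have "\<Delta>U (K * F - smul (inverse (q ^ 2)) (F * K)) \<in> tens_ideal (pideal PU)"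
    proof -
      have "\<Delta>U (K * F) = (K * F) \<otimes>\<^sub>t K + (K * K ^ (N - 1)) \<otimes>\<^sub>t (K * F)"
        by (simp add: free_comult_simps comult_U_gen distrib_left tens_mult)
      also have "\<dots> \<approx>\<^sub>U\<^sub>U smul (inverse (q ^ 2)) (F * K) \<otimes>\<^sub>t K +
          (K * K ^ (N - 1)) \<otimes>\<^sub>t smul (inverse (q ^ 2)) (F * K)"
        by (intro UU.cong_add tens_cong U_relations U.cong_refl)
      also have "\<dots> = \<Delta>U (smul (inverse (q ^ 2)) (F * K))"
        by (simp add: free_comult_simps comult_U_gen distrib_right tens_mult tens_smul_left
            tens_smul_right smul_add power_commutes)
      finally show ?thesis
        by (simp only: free_comult_simps UU.cong_mod_def)
    qed
    ultimately show ?thesis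
      unfolding rels_U using comult_U_relation_E comult_U_relation_F comult_U_relation_EF by simp
  qed
  ultimately show ?thesis
    using pideal_subset[of ?J PU] assms by blast
qed

abbreviation "\<epsilon>U \<equiv> free_ext (\<lambda>c :: 'k. c) (counit_gen PU)"

lemma counit_U_gen: "\<epsilon>U E = 0" "\<epsilon>U F = 0" "\<epsilon>U K = 1"
  by (simp_all add: scalar_map_id.free_ext_simps U_pres_def Let_def)

lemma counit_U_descends:
  assumes "x \<in> pideal PU"
  shows "\<epsilon>U x = 0"
proof -
  have "two_sided_ideal {x. \<epsilon>U x = 0}"
    by standard (simp_all add: scalar_map_id.free_ext_simps)
  moreover have "rels PU \<subseteq> {x. \<epsilon>U x = 0}"
    unfolding rels_U using N_gt_1
    by (simp add: scalar_map_id.free_ext_add scalar_map_id.free_ext_diff scalar_map_id.free_ext_smul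
        scalar_map_id.free_ext_mult scalar_map_id.free_ext_power scalar_map_id.free_ext_1 counit_U_gen)
  ultimately show ?thesis
    using pideal_subset[of "{x. \<epsilon>U x = 0}" PU] assms by blast
qed

lemma counit_U: "counit PU (pcls PU h) = \<epsilon>U h"
  unfolding counit_def
  by (rule the_elem_image_pcls) (simp add: scalar_map_id.free_ext_add counit_U_descends)

end

section \<open>The two-dimensional representation\<close>

definition rho_free :: "'k::field \<Rightarrow> (U_gen, 'k) free_alg \<Rightarrow> 'k ^ 2 ^ 2"
  where "rho_free q p = (\<Sum>u\<in>Poly_Mapping.keys p. mat (Poly_Mapping.lookup p u) **
    foldr (\<lambda>g M. rho_gen q g ** M) (letters u) (mat 1))"

lemma mat_mult_entry: "(mat c ** M) $ i $ j = c * (M :: 'k::field ^ 2 ^ 2) $ i $ j"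
  by (auto simp: matrix_matrix_mult_def mat_def if_distrib[of "\<lambda>x. x * _"] sum.delta cong: if_cong)

lemma rho_free_entry:
  "rho_free q p $ i $ j = lin_ext (\<lambda>u. foldr (\<lambda>g M. rho_gen q g ** M) (letters u) (mat 1) $ i $ j) p"
  by (simp add: rho_free_def lin_ext_def mat_mult_entry)

lemma linear_fun_rho_free: "linear_fun (\<lambda>p. rho_free q p $ i $ j)"
  unfolding rho_free_entry by (rule linear_fun_lin_ext)

lemma rho_free_monom:
  "rho_free q (monom_of u) = foldr (\<lambda>g M. rho_gen q g ** M) (letters u) (mat 1)"
  by (simp add: vec_eq_iff rho_free_entry lin_ext_monom)

lemma rho_free_gen: "rho_free q (gen g) = rho_gen q g"
  by (simp add: gen_def rho_free_monom)

lemma rho_free_1: "rho_free q 1 = mat 1"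
  by (simp add: monom_of_Word_Nil[symmetric] rho_free_monom)

lemma rho_free_mult: "rho_free q (x * y) = rho_free q x ** rho_free q y"
proof -
  have "rho_free q (x * y) $ i $ j = (rho_free q x ** rho_free q y) $ i $ j" for i j
  proof (induction x rule: monoid_alg_induct)
    case (monom u)
    show ?case
    proof (induction y rule: monoid_alg_induct)
      case (monom v)
      have "foldr (\<lambda>g M. rho_gen q g ** M) (xs @ ys) (mat 1) =
          foldr (\<lambda>g M. rho_gen q g ** M) xs (mat 1) **
          foldr (\<lambda>g M. rho_gen q g ** M) ys (mat 1)" for xs ys
        by (induction xs) (simp_all add: matrix_mul_assoc[symmetric] del: foldr_append)
      then show ?case
        by (simp add: monom_of_plus[symmetric] plus_word_def rho_free_monom del: foldr_append)
    qed (simp_all add: distrib_left linear_fun_simps[OF linear_fun_rho_free]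
        matrix_matrix_mult_def sum_2 algebra_simps)
  qed (simp_all add: distrib_right linear_fun_simps[OF linear_fun_rho_free]
      matrix_matrix_mult_def sum_2 algebra_simps)
  then show ?thesis
    by (simp add: vec_eq_iff)
qed

context odd_root_of_unity
begin

lemma rho_free_mult_entry:
  "rho_free q (x * y) $ i $ j = rho_free q x $ i $ 1 * rho_free q y $ 1 $ j +
    rho_free q x $ i $ 2 * rho_free q y $ 2 $ j"
  by (simp add: rho_free_mult matrix_matrix_mult_def sum_2)

lemma rho_free_K_pow:
  "rho_free q (K ^ n) $ 1 $ 1 = q ^ n" "rho_free q (K ^ n) $ 1 $ 2 = 0"
  "rho_free q (K ^ n) $ 2 $ 1 = 0" "rho_free q (K ^ n) $ 2 $ 2 = inverse q ^ n"
  by (induction n) (simp_all add: rho_free_mult_entry rho_free_gen rho_free_1 mat_def)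

lemma rho_free_descends:
  assumes "x \<in> pideal PU"
  shows "rho_free q x = 0"
proof -
  let ?J = "{x. rho_free q x = 0}"
  have "two_sided_ideal ?J"
    by standard (simp_all add: vec_eq_iff linear_fun_simps[OF linear_fun_rho_free]
        rho_free_mult_entry)
  moreover have "rels PU \<subseteq> ?J"
  proof -
    \<comment> \<open>The matrices of \<open>E\<close> and \<open>F\<close> have square zero, and
      \<open>N\<close> is at least two.\<close>
    have *: "rho_free q (gen g ^ N) = 0" if "rho_free q (gen g * gen g) = 0" for g
    proof -
      obtain m where "N = Suc (Suc m)"
        using less_imp_Suc_add[OF N_gt_1] by auto
      then have "gen g ^ N = (gen g * gen g) * (gen g ^ m :: (U_gen, 'k) free_alg)"
        by (simp add: mult.assoc)
      then show ?thesis
        using that by (simp add: vec_eq_iff rho_free_mult_entry[of "gen g * gen g"])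
    qed
    have "q * q ^ (N - Suc 0) = 1"
      using q_nonzero inverse_q_pow by simp
    moreover have "rho_free q (E ^ N) = 0" "rho_free q (F ^ N) = 0"
      by (rule *, simp add: vec_eq_iff forall_2 rho_free_mult_entry rho_free_gen)+
    ultimately show ?thesis
      unfolding rels_U using q_nonzero q_diff_nonzero
      by (simp add: vec_eq_iff forall_2 linear_fun_simps[OF linear_fun_rho_free]
          rho_free_mult_entry rho_free_gen rho_free_K_pow rho_free_1 mat_def q_pow_N
          inverse_q_pow power2_eq_square power_inverse field_simps del: power_inverse)
  qed
  ultimately show ?thesis
    using pideal_subset[of ?J PU] assms by blast
qed

lemma rho_pcls: "rho q (pcls PU h) = rho_free q h"
  unfolding rho_def rho_free_def[symmetric]
  by (rule the_elem_image_pcls)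
    (simp add: vec_eq_iff linear_fun_simps[OF linear_fun_rho_free] rho_free_descends)

end

section \<open>The dual pairing\<close>

lemma tens_fun_expand:
  "tens_fun A B t = (\<Sum>w\<in>Poly_Mapping.keys t. Poly_Mapping.lookup t w *
    (A (monom_of (fst w)) * B (monom_of (snd w))))"
  by (simp add: tens_fun_def lin_ext_def case_prod_beta)

text \<open>Splits off the left factor of a product, so that a formula already known for the
  functionals can be applied to the right factor.\<close>

lemma tens_fun_mult_expand:
  "tens_fun A B (s * t) = (\<Sum>w\<in>Poly_Mapping.keys s. Poly_Mapping.lookup s w *
    tens_fun (\<lambda>x. A (monom_of (fst w) * x)) (\<lambda>x. B (monom_of (snd w) * x)) t)"
proof -
  have "tens_fun A B (s * t) = lin_ext (\<lambda>w. tens_fun A B (monom_of w * t)) s"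
    by (rule linear_fun_conv_lin_ext[OF linear_fun_mult_right[OF linear_fun_tens_fun]])
  also have "\<dots> = lin_ext (\<lambda>w. tens_fun (\<lambda>x. A (monom_of (fst w) * x))
      (\<lambda>x. B (monom_of (snd w) * x)) t) s"
    by (rule arg_cong[where f = "\<lambda>\<alpha>. lin_ext \<alpha> s"])
      (auto simp: tens_fun_mult_monom[symmetric])
  finally show ?thesis
    by (simp add: lin_ext_def)
qed

lemma tens_fun_tens_mult:
  assumes "linear_fun A" "linear_fun B"
  shows "tens_fun A B ((x \<otimes>\<^sub>t y) * t) = tens_fun (\<lambda>z. A (x * z)) (\<lambda>z. B (y * z)) t"
    and "tens_fun A B (t * (x \<otimes>\<^sub>t y)) = tens_fun (\<lambda>z. A (z * x)) (\<lambda>z. B (z * y)) t"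
proof -
  note * = linear_fun_tens_fun linear_fun_mult_left[OF linear_fun_tens_fun]
    linear_fun_mult_right[OF linear_fun_tens_fun] assms
    linear_fun_mult_left[OF assms(1)] linear_fun_mult_left[OF assms(2)]
    linear_fun_mult_right[OF assms(1)] linear_fun_mult_right[OF assms(2)]
  show "tens_fun A B ((x \<otimes>\<^sub>t y) * t) = tens_fun (\<lambda>z. A (x * z)) (\<lambda>z. B (y * z)) t"
    by (rule linear_fun_eqI[OF *(2,1)])
      (auto simp: tens_monom[symmetric] tens_mult tens_fun_tens *)
  show "tens_fun A B (t * (x \<otimes>\<^sub>t y)) = tens_fun (\<lambda>z. A (z * x)) (\<lambda>z. B (z * y)) t"
    by (rule linear_fun_eqI[OF *(3,1)])
      (auto simp: tens_monom[symmetric] tens_mult tens_fun_tens *)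
qed

text \<open>The assumption \<open>desc\<close> makes the defining sum constant on cosets;
  \<open>comult_eval\<close> can then be computed on any representative.\<close>

lemma comult_eval_pcls:
  assumes "linear_fun (\<lambda>x. \<alpha> (pcls P x))" "linear_fun (\<lambda>x. \<beta> (pcls P x))"
    and desc: "\<And>x. x \<in> pideal P \<Longrightarrow> free_comult P x \<in> tens_ideal (pideal P)"
  shows "comult_eval P \<alpha> \<beta> (pcls P x) =
    tens_fun (\<lambda>x. \<alpha> (pcls P x)) (\<lambda>x. \<beta> (pcls P x)) (free_comult P x)"
proof -
  have eq: "(\<Sum>(u, v)\<in>Poly_Mapping.keys t. Poly_Mapping.lookup t (u, v) *
      \<alpha> (pcls P (monom_of u)) * \<beta> (pcls P (monom_of v))) =
      tens_fun (\<lambda>x. \<alpha> (pcls P x)) (\<lambda>x. \<beta> (pcls P x)) t" for t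
    by (simp add: tens_fun_expand case_prod_beta mult.assoc)
  have vanish: "\<alpha> (pcls P i) = 0" "\<beta> (pcls P i) = 0" if "i \<in> pideal P" for i
  proof -
    have "pcls P i = pcls P 0"
      using that by (simp add: pcls_eq_iff)
    then show "\<alpha> (pcls P i) = 0" "\<beta> (pcls P i) = 0"
      using linear_fun_0[OF assms(1)] linear_fun_0[OF assms(2)] by simp_all
  qed
  have "tens_fun (\<lambda>x. \<alpha> (pcls P x)) (\<lambda>x. \<beta> (pcls P x)) (free_comult P i) = 0"
    if "i \<in> pideal P" for i
    using desc[OF that] assms(1,2) vanish by (simp add: tens_ideal_def)
  then show ?thesis
    unfolding comult_eval_def eq
    by (intro the_elem_image_pcls) (simp add: free_comult_simps linear_fun_simps[OF linear_fun_tens_fun])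
qed

lemma sum_swap_4:
  "(\<Sum>w\<in>A. \<Sum>w'\<in>B. \<Sum>m\<in>C. \<Sum>n\<in>D. G w w' m n) =
    (\<Sum>m\<in>C. \<Sum>n\<in>D. \<Sum>w\<in>A. \<Sum>w'\<in>B. G w w' m n)"
proof -
  have *: "(\<Sum>w\<in>A. \<Sum>w'\<in>B. \<Sum>m\<in>C. H w w' m) = (\<Sum>m\<in>C. \<Sum>w\<in>A. \<Sum>w'\<in>B. H w w' m)" for C H
    by (subst sum.swap[of _ C B]) (rule sum.swap)
  show ?thesis
    by (simp only: *)
qed

locale dual_pairing = odd_root_of_unity q N for q :: "'k::field" and N +
  fixes \<phi> :: "(O_gen, 'k) free_alg set \<Rightarrow> (U_gen, 'k) free_alg set \<Rightarrow> 'k"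
  assumes phi: "is_phi q N \<phi>"
begin

text \<open>The pairing on representatives, so that calculations take place in free algebras and not
  with cosets.\<close>

definition pr :: "(O_gen, 'k) free_alg \<Rightarrow> (U_gen, 'k) free_alg \<Rightarrow> 'k"
  where "pr p h = \<phi> (pcls PO p) (pcls PU h)"

abbreviation "Oa \<equiv> gen Gen_a :: (O_gen, 'k) free_alg"
abbreviation "Ob \<equiv> gen Gen_b :: (O_gen, 'k) free_alg"
abbreviation "Oc \<equiv> gen Gen_c :: (O_gen, 'k) free_alg"
abbreviation "Od \<equiv> gen Gen_d :: (O_gen, 'k) free_alg"

lemma hopf_iso: "hopf_iso_dual PO PU \<phi>"
  using phi by (simp add: is_phi_def)

lemma phi_linear_dual: "\<phi> (pcls PO p) \<in> linear_dual (U_alg q N)"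
  using hopf_iso by (auto simp: hopf_iso_dual_def carrier_palg bij_betw_def)

lemma linear_pr_right: "linear_fun (pr p)"
  using phi_linear_dual[of p]
  by (intro linear_funI) (simp_all add: pr_def linear_dual_def carrier_palg add_palg[symmetric] smult_palg[symmetric])

lemma linear_pr_left: "linear_fun (\<lambda>p. pr p h)"
  using hopf_iso
  by (intro linear_funI) (simp_all add: pr_def hopf_iso_dual_def carrier_palg add_palg[symmetric] smult_palg[symmetric])

lemmas pr_simps = linear_fun_simps[OF linear_pr_left] linear_fun_simps[OF linear_pr_right]

lemma pr_mult: "pr (x * y) h = tens_fun (pr x) (pr y) (\<Delta>U h)"
proof -
  have "pr (x * y) h = comult_eval PU (\<phi> (pcls PO x)) (\<phi> (pcls PO y)) (pcls PU h)"
    using hopf_iso by (simp add: pr_def hopf_iso_dual_def carrier_palg mult_palg[symmetric])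
  also have "\<dots> = tens_fun (pr x) (pr y) (\<Delta>U h)"
    unfolding pr_def using linear_pr_right comult_U_descends
    by (intro comult_eval_pcls) (simp_all add: pr_def[abs_def])
  finally show ?thesis .
qed

lemma pr_1_left: "pr 1 h = \<epsilon>U h"
proof -
  have "pr 1 h = counit PU (pcls PU h)"
    using hopf_iso by (simp add: pr_def hopf_iso_dual_def carrier_palg one_palg)
  then show ?thesis
    by (simp add: counit_U)
qed

lemma counit_O: "counit PO (pcls PO p) = pr p 1"
  using hopf_iso by (simp add: pr_def hopf_iso_dual_def carrier_palg one_palg)

text \<open>This is injectivity of \<open>\<phi>\<close>. It lets congruences in the function
  algebra be proved by pairing both sides with an arbitrary \<open>h\<close>.\<close>

lemma cong_O_iff: "x \<approx>\<^sub>O y \<longleftrightarrow> (\<forall>h. pr x h = pr y h)"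
proof
  assume "x \<approx>\<^sub>O y"
  then have "pcls PO x = pcls PO y"
    by (simp add: pcls_eq_iff O.cong_mod_def)
  then show "\<forall>h. pr x h = pr y h"
    by (simp add: pr_def)
next
  assume *: "\<forall>h. pr x h = pr y h"
  have "\<phi> (pcls PO x) = \<phi> (pcls PO y)"
  proof (rule extensionalityI[of _ "carrier (U_alg q N)"])
    show "\<phi> (pcls PO x) X = \<phi> (pcls PO y) X" if "X \<in> carrier (U_alg q N)" for X
      using that * by (auto simp: carrier_palg pr_def)
  qed (use phi_linear_dual in \<open>auto simp: linear_dual_def\<close>)
  moreover have "inj_on \<phi> (range (pcls PO))"
    using hopf_iso by (simp add: hopf_iso_dual_def bij_betw_def carrier_palg)
  ultimately show "x \<approx>\<^sub>O y"
    by (auto simp: O.cong_mod_def pcls_eq_iff[symmetric] dest: inj_onD)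
qed

lemma pr_cong: "x \<approx>\<^sub>O y \<Longrightarrow> h \<approx>\<^sub>U h' \<Longrightarrow> pr x h = pr y h'"
  by (simp add: pr_def O.cong_mod_def U.cong_mod_def pcls_eq_iff[symmetric])

lemma pr_gen:
  "pr Oa h = rho_free q h $ 1 $ 1" "pr Ob h = rho_free q h $ 1 $ 2"
  "pr Oc h = rho_free q h $ 2 $ 1" "pr Od h = rho_free q h $ 2 $ 2"
proof -
  have "(vector [vector [pr Oa h, pr Ob h], vector [pr Oc h, pr Od h]] :: 'k ^ 2 ^ 2) = rho_free q h"
    using phi by (simp add: is_phi_def pr_def carrier_palg rho_pcls)
  from this[symmetric] show "pr Oa h = rho_free q h $ 1 $ 1" "pr Ob h = rho_free q h $ 1 $ 2"
    "pr Oc h = rho_free q h $ 2 $ 1" "pr Od h = rho_free q h $ 2 $ 2"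
    by simp_all
qed

abbreviation "\<Delta>O \<equiv> free_comult PO"

lemma comult_O_gen:
  "\<Delta>O Oa = Oa \<otimes>\<^sub>t Oa + Ob \<otimes>\<^sub>t Oc" "\<Delta>O Ob = Oa \<otimes>\<^sub>t Ob + Ob \<otimes>\<^sub>t Od"
  "\<Delta>O Oc = Oc \<otimes>\<^sub>t Oa + Od \<otimes>\<^sub>t Oc" "\<Delta>O Od = Oc \<otimes>\<^sub>t Ob + Od \<otimes>\<^sub>t Od"
  by (simp_all add: free_comult_def scalar_map_scalar.free_ext_simps O_pres_def Let_def)

text \<open>Since \<open>\<phi>\<close> is injective, this also shows that the comultiplication of \<open>O\<close> descends.\<close>

lemma pr_mult_right: "pr x (h * h') = tens_fun (\<lambda>y. pr y h) (\<lambda>y. pr y h') (\<Delta>O x)"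
proof (induction x arbitrary: h h' rule: free_alg_induct)
  case one
  have "tens_fun (\<lambda>y. pr y h) (\<lambda>y. pr y h') (1 \<otimes>\<^sub>t 1) = pr 1 h * pr 1 h'"
    by (rule tens_fun_tens[OF linear_pr_left linear_pr_left])
  then show ?case
    by (simp add: free_comult_simps tens_one pr_1_left scalar_map_id.free_ext_simps)
next
  case (gen_mult g y)
  have gen: "pr (gen g) (h * h') = tens_fun (\<lambda>y. pr y h) (\<lambda>y. pr y h') (\<Delta>O (gen g))" for h h'
    by (cases g) (simp_all add: comult_O_gen tens_fun_tens linear_pr_left
        linear_fun_simps[OF linear_fun_tens_fun] pr_gen rho_free_mult_entry)
  let ?k = Poly_Mapping.keys and ?l = Poly_Mapping.lookup
  let ?m1 = "\<lambda>w. monom_of (fst w)" and ?m2 = "\<lambda>w. monom_of (snd w)"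
  \<comment> \<open>Both sides expand into a fourfold sum of these terms, over the components of the
    two coproducts in \<open>U\<close> and the two in \<open>O\<close>; only the order of summation
    differs.\<close>
  let ?G = "\<lambda>w w' m n. ?l (\<Delta>U h) w * ?l (\<Delta>U h') w' * ?l (\<Delta>O (gen g)) m * ?l (\<Delta>O y) n *
    (pr (?m1 m) (?m1 w) * pr (?m2 m) (?m1 w') * pr (?m1 n) (?m2 w) * pr (?m2 n) (?m2 w'))"
  have "pr (gen g * y) (h * h') = tens_fun (pr (gen g)) (pr y) (\<Delta>U h * \<Delta>U h')"
    by (simp add: pr_mult free_comult_simps)
  also have "\<dots> = (\<Sum>w\<in>?k (\<Delta>U h). \<Sum>w'\<in>?k (\<Delta>U h'). \<Sum>m\<in>?k (\<Delta>O (gen g)). \<Sum>n\<in>?k (\<Delta>O y). ?G w w' m n)"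
    by (simp add: tens_fun_mult_expand tens_fun_expand[of "\<lambda>x. pr _ (_ * x)"] gen gen_mult)
      (simp add: tens_fun_expand sum_distrib_left sum_distrib_right mult_ac)
  also have "\<dots> = (\<Sum>m\<in>?k (\<Delta>O (gen g)). \<Sum>n\<in>?k (\<Delta>O y). \<Sum>w\<in>?k (\<Delta>U h). \<Sum>w'\<in>?k (\<Delta>U h'). ?G w w' m n)"
    by (rule sum_swap_4)
  also have "\<dots> = tens_fun (\<lambda>x. pr x h) (\<lambda>x. pr x h') (\<Delta>O (gen g) * \<Delta>O y)"
    by (simp add: tens_fun_mult_expand tens_fun_expand[of "\<lambda>x. pr (_ * x) _"] pr_mult)
      (simp add: tens_fun_expand sum_distrib_left sum_distrib_right mult_ac)
  finally show ?case
    by (simp add: free_comult_simps)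
qed (simp_all add: free_comult_simps pr_simps linear_fun_simps[OF linear_fun_tens_fun])

section \<open>The right action\<close>

text \<open>The body of \<open>comult_contract\<close> on a representative, which is how
  \<open>ract_pcls\<close> recognises it.\<close>

definition act (infixl \<open>\<triangleleft>\<close> 75)
  where "p \<triangleleft> h = (\<Sum>(u, v)\<in>Poly_Mapping.keys (\<Delta>O p).
    scalar (Poly_Mapping.lookup (\<Delta>O p) (u, v) * pr (monom_of u) h) * monom_of v)"

text \<open>The action is the transpose of left multiplication. Together with
  \<open>cong_O_iff\<close> this yields the rules of calculation for the action without touching its
  definition.\<close>

lemma pr_act: "pr (p \<triangleleft> h) h' = pr p (h * h')"
  unfolding act_def pr_mult_right tens_fun_expand smul_def[symmetric]
  by (simp add: pr_simps case_prod_beta mult.assoc)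

text \<open>By \<open>pr_act\<close> the pairings of the result depend only on the class of the
  representative, hence so does the result.\<close>

lemma ract_pcls: "ract q N \<phi> (pcls PO p) (pcls PU h) = pcls PO (p \<triangleleft> h)"
proof -
  have "pcls PO ((i + p) \<triangleleft> h) = pcls PO (p \<triangleleft> h)" if "i \<in> pideal PO" for i
  proof -
    have "i + p \<approx>\<^sub>O p"
      using that by (simp add: O.cong_mod_def)
    then have "(i + p) \<triangleleft> h \<approx>\<^sub>O p \<triangleleft> h"
      by (simp add: cong_O_iff pr_act)
    then show ?thesis
      by (simp add: pcls_eq_iff O.cong_mod_def)
  qed
  then show ?thesis
    unfolding ract_def comult_contract_def pr_def[symmetric] act_def[symmetric]
    by (rule the_elem_image_pcls)
qed

lemma act_cong: "p \<approx>\<^sub>O p' \<Longrightarrow> h \<approx>\<^sub>U h' \<Longrightarrow> p \<triangleleft> h \<approx>\<^sub>O p' \<triangleleft> h'"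
  by (simp add: cong_O_iff pr_act) (metis U.cong_refl U.cong_mult_right pr_cong cong_O_iff O.cong_refl)

lemma act_cong_left: "p \<approx>\<^sub>O p' \<Longrightarrow> p \<triangleleft> h \<approx>\<^sub>O p' \<triangleleft> h"
  by (simp add: act_cong)

lemma act_add_left: "(p + p') \<triangleleft> h \<approx>\<^sub>O p \<triangleleft> h + p' \<triangleleft> h"
  and act_add_right: "p \<triangleleft> (h + h') \<approx>\<^sub>O p \<triangleleft> h + p \<triangleleft> h'"
  and act_diff_right: "p \<triangleleft> (h - h') \<approx>\<^sub>O p \<triangleleft> h - p \<triangleleft> h'"
  and act_smul_left: "smul c p \<triangleleft> h \<approx>\<^sub>O smul c (p \<triangleleft> h)"
  and act_smul_right: "p \<triangleleft> smul c h \<approx>\<^sub>O smul c (p \<triangleleft> h)"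
  and act_mult: "p \<triangleleft> (h * h') \<approx>\<^sub>O (p \<triangleleft> h) \<triangleleft> h'"
  and act_1: "p \<triangleleft> 1 \<approx>\<^sub>O p"
  by (simp_all add: cong_O_iff pr_act pr_simps distrib_right left_diff_distrib mult.assoc)

lemma one_act: "1 \<triangleleft> h \<approx>\<^sub>O smul (\<epsilon>U h) 1"
  by (simp add: cong_O_iff pr_act pr_simps pr_1_left scalar_map_id.free_ext_simps)

lemma mult_act_grouplike:
  assumes "\<Delta>U h = h \<otimes>\<^sub>t h"
  shows "(x * y) \<triangleleft> h \<approx>\<^sub>O (x \<triangleleft> h) * (y \<triangleleft> h)"
  by (simp add: cong_O_iff pr_act pr_mult free_comult_simps assms tens_fun_tens_mult
      linear_pr_right pr_act[abs_def])

text \<open>The module algebra rule for a skew primitive element.\<close>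

lemma mult_act_skew:
  assumes "\<Delta>U h = h \<otimes>\<^sub>t k + g \<otimes>\<^sub>t h"
  shows "(x * y) \<triangleleft> h \<approx>\<^sub>O (x \<triangleleft> h) * (y \<triangleleft> k) + (x \<triangleleft> g) * (y \<triangleleft> h)"
  by (simp add: cong_O_iff pr_act pr_mult free_comult_simps assms tens_fun_tens_mult
      linear_pr_right pr_act[abs_def] distrib_right linear_fun_simps[OF linear_fun_tens_fun] pr_simps)

lemma mult_act_K: "(x * y) \<triangleleft> K \<approx>\<^sub>O (x \<triangleleft> K) * (y \<triangleleft> K)"
  by (rule mult_act_grouplike) (simp add: comult_U_gen)

lemma mult_act_E: "(x * y) \<triangleleft> E \<approx>\<^sub>O (x \<triangleleft> E) * (y \<triangleleft> K) + x * (y \<triangleleft> E)"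
proof -
  have "(x * y) \<triangleleft> E \<approx>\<^sub>O (x \<triangleleft> E) * (y \<triangleleft> K) + (x \<triangleleft> 1) * (y \<triangleleft> E)"
    by (rule mult_act_skew) (simp add: comult_U_gen)
  also have "\<dots> \<approx>\<^sub>O (x \<triangleleft> E) * (y \<triangleleft> K) + x * (y \<triangleleft> E)"
    by (intro O.cong_add O.cong_mult act_1 O.cong_refl)
  finally show ?thesis .
qed

text \<open>The factor \<open>K\<close> in front of \<open>F\<close> turns the grouplike
  \<open>K ^ (N - 1)\<close> in the coproduct of \<open>F\<close> into \<open>K ^ N\<close>, which
  is \<open>1\<close> in the quotient. The rule then has the same shape as the one for
  \<open>E\<close>, and both generators of the coideal subalgebra can be treated alike.\<close>

lemma mult_act_KF: "(x * y) \<triangleleft> (K * F) \<approx>\<^sub>O (x \<triangleleft> (K * F)) * (y \<triangleleft> K) + x * (y \<triangleleft> (K * F))"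
proof -
  have KN: "K * K ^ (N - 1) = K ^ N"
    using N_gt_1 by (simp add: power_eq_if)
  have "(x * y) \<triangleleft> (K * F) \<approx>\<^sub>O (x \<triangleleft> (K * F)) * (y \<triangleleft> K) + (x \<triangleleft> K ^ N) * (y \<triangleleft> (K * F))"
    by (rule mult_act_skew)
      (simp add: free_comult_simps comult_U_gen distrib_left tens_mult KN[unfolded One_nat_def])
  also have "\<dots> \<approx>\<^sub>O (x \<triangleleft> (K * F)) * (y \<triangleleft> K) + x * (y \<triangleleft> (K * F))"
    by (intro O.cong_add O.cong_mult O.cong_refl O.cong_trans[OF act_cong act_1] U_relations)
  finally show ?thesis .
qed

lemma gen_act:
  "Oa \<triangleleft> h \<approx>\<^sub>O smul (rho_free q h $ 1 $ 1) Oa + smul (rho_free q h $ 1 $ 2) Oc"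
  "Ob \<triangleleft> h \<approx>\<^sub>O smul (rho_free q h $ 1 $ 1) Ob + smul (rho_free q h $ 1 $ 2) Od"
  "Oc \<triangleleft> h \<approx>\<^sub>O smul (rho_free q h $ 2 $ 1) Oa + smul (rho_free q h $ 2 $ 2) Oc"
  "Od \<triangleleft> h \<approx>\<^sub>O smul (rho_free q h $ 2 $ 1) Ob + smul (rho_free q h $ 2 $ 2) Od"
  by (simp_all add: cong_O_iff pr_act pr_simps pr_gen rho_free_mult_entry)

lemma gen_act_EFK:
  "Ob \<triangleleft> E \<approx>\<^sub>O Od" "Oc \<triangleleft> E \<approx>\<^sub>O 0" "Od \<triangleleft> E \<approx>\<^sub>O 0"
  "Ob \<triangleleft> K \<approx>\<^sub>O smul q Ob" "Oc \<triangleleft> K \<approx>\<^sub>O smul (inverse q) Oc" "Od \<triangleleft> K \<approx>\<^sub>O smul (inverse q) Od"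
  "Ob \<triangleleft> (K * F) \<approx>\<^sub>O 0" "Oc \<triangleleft> (K * F) \<approx>\<^sub>O smul (inverse q) Oa" "Od \<triangleleft> (K * F) \<approx>\<^sub>O smul (inverse q) Ob"
  using gen_act[of E] gen_act[of K] gen_act[of "K * F"]
  by (simp_all add: rho_free_gen rho_free_mult_entry)

section \<open>Evaluation at powers of K, and weights under the left action of K\<close>

lemma pr_mult_K_pow: "pr (x * y) (K ^ n) = pr x (K ^ n) * pr y (K ^ n)"
  by (simp add: pr_mult free_comult_simps comult_U_gen tens_power tens_fun_tens linear_pr_right)

lemma pr_pow_K_pow: "pr (x ^ m) (K ^ n) = pr x (K ^ n) ^ m"
  by (induction m) (simp_all add: pr_mult_K_pow pr_1_left scalar_map_id.free_ext_power counit_U_gen)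

text \<open>Multiplying the second argument by \<open>K\<close> from the right is the left action of
  a grouplike element, so weights multiply.\<close>

lemma weight_mult:
  assumes "\<And>h. pr x (h * K) = s * pr x h" "\<And>h. pr y (h * K) = t * pr y h"
  shows "pr (x * y) (h * K) = s * t * pr (x * y) h"
  by (simp add: pr_mult free_comult_simps comult_U_gen tens_fun_tens_mult linear_pr_right assms
      tens_fun_smul_left tens_fun_smul_right)

lemma weight_gen:
  "pr Ob (h * K) = inverse q * pr Ob h" "pr Oc (h * K) = q * pr Oc h" "pr Od (h * K) = inverse q * pr Od h"
  by (simp_all add: pr_gen rho_free_mult_entry rho_free_gen)

end

section \<open>The action on monomials\<close>

context odd_root_of_unity
begin

text \<open>The counterpart of \<open>q2_geometric_nonzero\<close> for the action of
  \<open>K * F\<close> on powers of \<open>c\<close>.\<close>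

lemma inverse_q2_geometric_nonzero:
  assumes "0 < n" "n < N"
  shows "(\<Sum>l<n. inverse (q ^ 2) ^ l) \<noteq> 0"
proof -
  have "inverse (q ^ 2) ^ n \<noteq> 1"
    using q2_primitive[OF assms] by (metis inverse_eq_1_iff power_inverse)
  then show ?thesis
    using power_diff_1_eq[of "inverse (q ^ 2)" n] by (auto simp del: power_inverse)
qed

lemma rels_O: "rels PO = {gen Gen_b * gen Gen_a - smul q (gen Gen_a * gen Gen_b),
    gen Gen_c * gen Gen_a - smul q (gen Gen_a * gen Gen_c),
    gen Gen_b * gen Gen_c - gen Gen_c * gen Gen_b,
    gen Gen_d * gen Gen_b - smul q (gen Gen_b * gen Gen_d),
    gen Gen_d * gen Gen_c - smul q (gen Gen_c * gen Gen_d),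
    gen Gen_a * gen Gen_d - smul (inverse q) (gen Gen_b * gen Gen_c) - 1,
    gen Gen_d * gen Gen_a - smul q (gen Gen_b * gen Gen_c) - 1,
    gen Gen_a ^ N - 1, gen Gen_d ^ N - 1, gen Gen_b ^ N, gen Gen_c ^ N}"
  by (simp add: O_pres_def Let_def scalar_conv_smul)

end

context dual_pairing
begin

lemma O_relations:
  "Oc * Oa \<approx>\<^sub>O smul q (Oa * Oc)" "Ob * Oc \<approx>\<^sub>O Oc * Ob"
  "Od * Ob \<approx>\<^sub>O smul q (Ob * Od)" "Od * Oc \<approx>\<^sub>O smul q (Oc * Od)"
  "Oa * Od \<approx>\<^sub>O 1 + smul (inverse q) (Ob * Oc)" "Od ^ N \<approx>\<^sub>O 1"
  using rels_subset_pideal[of PO] unfolding rels_O O.cong_mod_def by (simp_all add: algebra_simps)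

lemma Oa_Oc: "Oa * Oc \<approx>\<^sub>O smul (inverse q) (Oc * Oa)"
  using O.cong_sym[OF O.cong_smul[OF O_relations(1), of "inverse q"]] q_nonzero by simp

lemma cb_pow: "Oc ^ n * Ob \<approx>\<^sub>O Ob * Oc ^ n"
  using O.cong_commute_power(2)[of Oc Ob 1 n] O.cong_sym[OF O_relations(2)] by simp

lemma db_pow: "Od * Ob ^ n \<approx>\<^sub>O smul (q ^ n) (Ob ^ n * Od)"
  and dc_pow: "Od * Oc ^ n \<approx>\<^sub>O smul (q ^ n) (Oc ^ n * Od)"
  and ac_pow: "Oa * Oc ^ n \<approx>\<^sub>O smul (inverse q ^ n) (Oc ^ n * Oa)"
  by (rule O.cong_commute_power O_relations Oa_Oc)+

lemma power_act_K:
  assumes "x \<triangleleft> K \<approx>\<^sub>O smul s x"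
  shows "x ^ n \<triangleleft> K \<approx>\<^sub>O smul (s ^ n) (x ^ n)"
proof (induction n)
  case 0
  show ?case
    using one_act[of K] by (simp add: counit_U_gen)
next
  case (Suc n)
  have "x ^ Suc n \<triangleleft> K \<approx>\<^sub>O (x \<triangleleft> K) * (x ^ n \<triangleleft> K)"
    by (simp add: mult_act_K)
  also have "\<dots> \<approx>\<^sub>O smul s x * smul (s ^ n) (x ^ n)"
    by (intro O.cong_mult assms Suc)
  finally show ?case
    by (simp add: mult.commute)
qed

lemma power_act_skew_0:
  assumes skew: "\<And>x y. (x * y) \<triangleleft> h \<approx>\<^sub>O (x \<triangleleft> h) * (y \<triangleleft> K) + x * (y \<triangleleft> h)"
    and "\<epsilon>U h = 0" "x \<triangleleft> h \<approx>\<^sub>O 0"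
  shows "x ^ n \<triangleleft> h \<approx>\<^sub>O 0"
proof (induction n)
  case 0
  show ?case
    using one_act[of h] assms(2) by simp
next
  case (Suc n)
  have "x ^ Suc n \<triangleleft> h \<approx>\<^sub>O (x \<triangleleft> h) * (x ^ n \<triangleleft> K) + x * (x ^ n \<triangleleft> h)"
    by (simp add: skew)
  also have "\<dots> \<approx>\<^sub>O 0 * (x ^ n \<triangleleft> K) + x * 0"
    by (intro O.cong_add O.cong_mult O.cong_refl assms Suc)
  finally show ?case
    by simp
qed

lemma gens_power_act_K:
  "Ob ^ n \<triangleleft> K \<approx>\<^sub>O smul (q ^ n) (Ob ^ n)"
  "Oc ^ n \<triangleleft> K \<approx>\<^sub>O smul (inverse q ^ n) (Oc ^ n)"
  "Od ^ n \<triangleleft> K \<approx>\<^sub>O smul (inverse q ^ n) (Od ^ n)"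
  by (rule power_act_K gen_act_EFK)+

text \<open>The leading-term arguments follow \<open>i\<close> and \<open>j\<close> only. The
  exponent \<open>k\<close> may change freely: \<open>Od ^ N\<close> is congruent to
  \<open>1\<close>, and \<open>Od\<close> pairs to \<open>1\<close> with \<open>1\<close>.\<close>

definition mon :: "nat \<Rightarrow> nat \<Rightarrow> nat \<Rightarrow> (O_gen, 'k) free_alg"
  where "mon i j k = Ob ^ i * (Oc ^ j * Od ^ k)"

lemma mon_add_N: "mon i j (k + N) \<approx>\<^sub>O mon i j k"
proof -
  have "Od ^ k * Od ^ N \<approx>\<^sub>O Od ^ k * 1"
    by (intro O.cong_mult O.cong_refl O_relations)
  then show ?thesis
    unfolding mon_def by (intro O.cong_mult O.cong_refl) (simp add: power_add)
qed

lemma cd_act_K: "(Oc ^ j * Od ^ k) \<triangleleft> K \<approx>\<^sub>O smul (inverse q ^ (j + k)) (Oc ^ j * Od ^ k)"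
proof -
  have "(Oc ^ j * Od ^ k) \<triangleleft> K \<approx>\<^sub>O smul (inverse q ^ j) (Oc ^ j) * smul (inverse q ^ k) (Od ^ k)"
    by (rule O.cong_trans[OF mult_act_K]) (intro O.cong_mult gens_power_act_K)
  then show ?thesis
    by (simp add: power_add mult.commute)
qed

lemma mon_act_K: "\<exists>s. mon i j k \<triangleleft> K \<approx>\<^sub>O smul s (mon i j k)"
proof -
  have "mon i j k \<triangleleft> K \<approx>\<^sub>O (Ob ^ i \<triangleleft> K) * ((Oc ^ j * Od ^ k) \<triangleleft> K)"
    unfolding mon_def by (rule mult_act_K)
  also have "\<dots> \<approx>\<^sub>O smul (q ^ i) (Ob ^ i) * smul (inverse q ^ (j + k)) (Oc ^ j * Od ^ k)"
    by (intro O.cong_mult gens_power_act_K cd_act_K)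
  finally show ?thesis
    by (auto simp: mon_def)
qed

text \<open>The new summand receives \<open>q ^ n\<close> twice, from \<open>K\<close> acting on
  \<open>Ob ^ n\<close> and from moving \<open>Od\<close> past it. This builds up a q-integer in
  \<open>q ^ 2\<close>.\<close>

lemma b_power_act_E: "Ob ^ n \<triangleleft> E \<approx>\<^sub>O smul (\<Sum>l<n. (q ^ 2) ^ l) (Ob ^ (n - 1) * Od)"
proof (induction n)
  case 0
  show ?case
    using one_act[of E] by (simp add: counit_U_gen)
next
  case (Suc n)
  let ?s = "\<Sum>l<n. (q ^ 2) ^ l"
  have "Ob ^ Suc n \<triangleleft> E \<approx>\<^sub>O (Ob \<triangleleft> E) * (Ob ^ n \<triangleleft> K) + Ob * (Ob ^ n \<triangleleft> E)"
    by (simp add: mult_act_E)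
  also have "\<dots> \<approx>\<^sub>O Od * smul (q ^ n) (Ob ^ n) + Ob * smul ?s (Ob ^ (n - 1) * Od)"
    by (intro O.cong_add O.cong_mult O.cong_refl gen_act_EFK gens_power_act_K Suc)
  \<comment> \<open>For \<open>n = 0\<close> the truncated exponent does no harm, because
    \<open>?s\<close> is then \<open>0\<close>.\<close>
  also have "Ob * smul ?s (Ob ^ (n - 1) * Od) = smul ?s (Ob ^ n * Od)"
    by (cases n) (simp_all add: mult.assoc)
  also have "Od * smul (q ^ n) (Ob ^ n) + smul ?s (Ob ^ n * Od) =
      smul (q ^ n) (Od * Ob ^ n) + smul ?s (Ob ^ n * Od)"
    by simp
  also have "\<dots> \<approx>\<^sub>O smul (q ^ n) (smul (q ^ n) (Ob ^ n * Od)) + smul ?s (Ob ^ n * Od)"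
    by (intro O.cong_add O.cong_smul O.cong_refl db_pow)
  also have "\<dots> = smul (\<Sum>l<Suc n. (q ^ 2) ^ l) (Ob ^ (Suc n - 1) * Od)"
    by (simp add: add_smul power2_eq_square power_mult_distrib)
  finally show ?case .
qed

lemma cd_act_E: "(Oc ^ j * Od ^ k) \<triangleleft> E \<approx>\<^sub>O 0"
proof -
  have "Oc ^ j \<triangleleft> E \<approx>\<^sub>O 0" "Od ^ k \<triangleleft> E \<approx>\<^sub>O 0"
    by (rule power_act_skew_0[OF mult_act_E] gen_act_EFK | simp add: counit_U_gen)+
  then have "(Oc ^ j \<triangleleft> E) * (Od ^ k \<triangleleft> K) + Oc ^ j * (Od ^ k \<triangleleft> E) \<approx>\<^sub>O
      0 * (Od ^ k \<triangleleft> K) + Oc ^ j * 0"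
    by (intro O.cong_add O.cong_mult O.cong_refl)
  then show ?thesis
    using O.cong_trans[OF mult_act_E] by simp
qed

text \<open>The coefficient is a q-integer times powers of \<open>q\<close> and
  \<open>inverse q\<close>. That it vanishes at \<open>i = 0\<close> makes the truncated
  \<open>i - 1\<close> correct.\<close>

lemma mon_act_E:
  "\<exists>s. mon i j k \<triangleleft> E \<approx>\<^sub>O smul s (mon (i - 1) j (Suc k)) \<and> (0 < i \<and> i < N \<longrightarrow> s \<noteq> 0) \<and> (i = 0 \<longrightarrow> s = 0)"
proof -
  let ?s = "\<Sum>l<i. (q ^ 2) ^ l" and ?t = "inverse q ^ (j + k)"
  have "mon i j k \<triangleleft> E \<approx>\<^sub>O
      (Ob ^ i \<triangleleft> E) * ((Oc ^ j * Od ^ k) \<triangleleft> K) + Ob ^ i * ((Oc ^ j * Od ^ k) \<triangleleft> E)"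
    unfolding mon_def by (rule mult_act_E)
  also have "\<dots> \<approx>\<^sub>O smul ?s (Ob ^ (i - 1) * Od) * smul ?t (Oc ^ j * Od ^ k) + Ob ^ i * 0"
    by (intro O.cong_add O.cong_mult O.cong_refl b_power_act_E cd_act_K cd_act_E)
  also have "\<dots> = smul (?s * ?t) (Ob ^ (i - 1) * ((Od * Oc ^ j) * Od ^ k))"
    by (simp add: mult.assoc mult.commute)
  also have "\<dots> \<approx>\<^sub>O smul (?s * ?t) (Ob ^ (i - 1) * (smul (q ^ j) (Oc ^ j * Od) * Od ^ k))"
    by (intro O.cong_smul O.cong_mult O.cong_refl dc_pow)
  also have "\<dots> = smul (?s * ?t * q ^ j) (mon (i - 1) j (Suc k))"
    by (simp add: mon_def mult.assoc)
  finally show ?thesis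
    using q2_geometric_nonzero[of i] q_nonzero by (intro exI[of _ "?s * ?t * q ^ j"]) auto
qed

lemma c_power_act_KF:
  "Oc ^ n \<triangleleft> (K * F) \<approx>\<^sub>O smul (inverse q * (\<Sum>l<n. inverse (q ^ 2) ^ l)) (Oc ^ (n - 1) * Oa)"
proof (induction n)
  case 0
  show ?case
    using one_act[of "K * F"] by (simp add: counit_U_gen scalar_map_id.free_ext_mult)
next
  case (Suc n)
  let ?s = "inverse q * (\<Sum>l<n. inverse (q ^ 2) ^ l)" and ?r = "inverse q"
  have "Oc ^ Suc n \<triangleleft> (K * F) \<approx>\<^sub>O (Oc \<triangleleft> (K * F)) * (Oc ^ n \<triangleleft> K) + Oc * (Oc ^ n \<triangleleft> (K * F))"
    by (simp add: mult_act_KF)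
  also have "\<dots> \<approx>\<^sub>O smul ?r Oa * smul (?r ^ n) (Oc ^ n) + Oc * smul ?s (Oc ^ (n - 1) * Oa)"
    by (intro O.cong_add O.cong_mult O.cong_refl gen_act_EFK gens_power_act_K Suc)
  also have "Oc * smul ?s (Oc ^ (n - 1) * Oa) = smul ?s (Oc ^ n * Oa)"
    by (cases n) (simp_all add: mult.assoc)
  also have "smul ?r Oa * smul (?r ^ n) (Oc ^ n) + smul ?s (Oc ^ n * Oa) =
      smul (?r * ?r ^ n) (Oa * Oc ^ n) + smul ?s (Oc ^ n * Oa)"
    by (simp add: mult.commute)
  also have "\<dots> \<approx>\<^sub>O smul (?r * ?r ^ n) (smul (?r ^ n) (Oc ^ n * Oa)) + smul ?s (Oc ^ n * Oa)"
    by (intro O.cong_add O.cong_smul O.cong_refl ac_pow)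
  also have "\<dots> = smul (?r * (\<Sum>l<Suc n. inverse (q ^ 2) ^ l)) (Oc ^ (Suc n - 1) * Oa)"
    by (simp add: add_smul[symmetric] power2_eq_square power_mult_distrib distrib_left mult.assoc
        add.commute del: power_inverse)
  finally show ?case .
qed

text \<open>The coefficient is left open, since this term raises the exponent of \<open>b\<close>
  without lowering that of \<open>c\<close>; it will end up in the tail.\<close>

lemma d_power_act_KF: "\<exists>s. Od ^ Suc n \<triangleleft> (K * F) \<approx>\<^sub>O smul s (Ob * Od ^ n)"
proof (induction n)
  case 0
  show ?case
    using gen_act_EFK(9) by auto
next
  case (Suc n)
  then obtain s where s: "Od ^ Suc n \<triangleleft> (K * F) \<approx>\<^sub>O smul s (Ob * Od ^ n)"
    by blast
  let ?r = "inverse q"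
  have "Od ^ Suc (Suc n) \<triangleleft> (K * F) \<approx>\<^sub>O
      (Od \<triangleleft> (K * F)) * (Od ^ Suc n \<triangleleft> K) + Od * (Od ^ Suc n \<triangleleft> (K * F))"
    using mult_act_KF[of Od "Od ^ Suc n"] by simp
  also have "\<dots> \<approx>\<^sub>O smul ?r Ob * smul (?r ^ Suc n) (Od ^ Suc n) + Od * smul s (Ob * Od ^ n)"
    by (intro O.cong_add O.cong_mult O.cong_refl gen_act_EFK gens_power_act_K s)
  also have "\<dots> = smul (?r * ?r ^ Suc n) (Ob * Od ^ Suc n) + smul s ((Od * Ob) * Od ^ n)"
    by (simp add: mult.assoc mult.commute)
  also have "\<dots> \<approx>\<^sub>O smul (?r * ?r ^ Suc n) (Ob * Od ^ Suc n) + smul s (smul q (Ob * Od) * Od ^ n)"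
    by (intro O.cong_add O.cong_smul O.cong_mult O.cong_refl O_relations)
  also have "\<dots> = smul (?r * ?r ^ Suc n + s * q) (Ob * Od ^ Suc n)"
    by (simp add: add_smul mult.assoc)
  finally show ?case
    by blast
qed

text \<open>Acting on a power of \<open>Oc\<close> creates a factor \<open>Oa\<close>, which one
  factor \<open>Od\<close> removes by the relation for \<open>Oa * Od\<close>; hence the exponent
  \<open>Suc k\<close>. The correction \<open>Ob * Oc\<close> in that relation restores the power of
  \<open>Oc\<close> and raises that of \<open>Ob\<close>.\<close>

lemma mon_act_KF:
  "\<exists>s t. mon i j (Suc k) \<triangleleft> (K * F) \<approx>\<^sub>O smul s (mon i (j - 1) k) + smul t (mon (Suc i) j k) \<and>
    (0 < j \<and> j < N \<longrightarrow> s \<noteq> 0) \<and> (j = 0 \<longrightarrow> s = 0)"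
proof -
  let ?g = "inverse q * (\<Sum>l<j. inverse (q ^ 2) ^ l)" and ?t = "inverse q ^ Suc k" and ?r = "inverse q"
  obtain r where r: "Od ^ Suc k \<triangleleft> (K * F) \<approx>\<^sub>O smul r (Ob * Od ^ k)"
    using d_power_act_KF by blast
  have b: "Ob ^ i \<triangleleft> (K * F) \<approx>\<^sub>O 0"
    by (rule power_act_skew_0[OF mult_act_KF _ gen_act_EFK(7)])
      (simp add: counit_U_gen scalar_map_id.free_ext_mult)
  have "(Oc ^ j * Od ^ Suc k) \<triangleleft> (K * F) \<approx>\<^sub>O
      (Oc ^ j \<triangleleft> (K * F)) * (Od ^ Suc k \<triangleleft> K) + Oc ^ j * (Od ^ Suc k \<triangleleft> (K * F))"
    by (rule mult_act_KF)
  also have "\<dots> \<approx>\<^sub>O smul ?g (Oc ^ (j - 1) * Oa) * smul ?t (Od ^ Suc k) + Oc ^ j * smul r (Ob * Od ^ k)"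
    by (intro O.cong_add O.cong_mult O.cong_refl c_power_act_KF gens_power_act_K r)
  also have "\<dots> = smul (?g * ?t) (Oc ^ (j - 1) * ((Oa * Od) * Od ^ k)) + smul r ((Oc ^ j * Ob) * Od ^ k)"
    by (simp add: mult.assoc mult.commute)
  also have "\<dots> \<approx>\<^sub>O smul (?g * ?t) (Oc ^ (j - 1) * ((1 + smul ?r (Ob * Oc)) * Od ^ k)) +
      smul r ((Ob * Oc ^ j) * Od ^ k)"
    by (intro O.cong_add O.cong_smul O.cong_mult O.cong_refl O_relations cb_pow)
  also have "\<dots> = smul (?g * ?t) (Oc ^ (j - 1) * Od ^ k) +
      smul (?g * ?t * ?r) ((Oc ^ (j - 1) * Ob) * (Oc * Od ^ k)) + smul r ((Ob * Oc ^ j) * Od ^ k)"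
    by (simp add: distrib_left distrib_right smul_add mult.assoc)
  also have "\<dots> \<approx>\<^sub>O smul (?g * ?t) (Oc ^ (j - 1) * Od ^ k) +
      smul (?g * ?t * ?r) ((Ob * Oc ^ (j - 1)) * (Oc * Od ^ k)) + smul r ((Ob * Oc ^ j) * Od ^ k)"
    by (intro O.cong_add O.cong_smul O.cong_mult O.cong_refl cb_pow)
  also have "\<dots> = smul (?g * ?t) (Oc ^ (j - 1) * Od ^ k) +
      smul (?g * ?t * ?r + r) (Ob * (Oc ^ j * Od ^ k))"
  proof (cases j)
    case (Suc l)
    then show ?thesis
      by (simp add: add_smul mult.assoc power_Suc2 del: power_Suc)
  qed (simp add: add_smul)
  finally have cd: "(Oc ^ j * Od ^ Suc k) \<triangleleft> (K * F) \<approx>\<^sub>O smul (?g * ?t) (Oc ^ (j - 1) * Od ^ k) +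
      smul (?g * ?t * ?r + r) (Ob * (Oc ^ j * Od ^ k))" .
  have "mon i j (Suc k) \<triangleleft> (K * F) \<approx>\<^sub>O
      (Ob ^ i \<triangleleft> (K * F)) * ((Oc ^ j * Od ^ Suc k) \<triangleleft> K) + Ob ^ i * ((Oc ^ j * Od ^ Suc k) \<triangleleft> (K * F))"
    unfolding mon_def by (rule mult_act_KF)
  also have "\<dots> \<approx>\<^sub>O 0 * ((Oc ^ j * Od ^ Suc k) \<triangleleft> K) + Ob ^ i * (smul (?g * ?t) (Oc ^ (j - 1) * Od ^ k) +
      smul (?g * ?t * ?r + r) (Ob * (Oc ^ j * Od ^ k)))"
    by (intro O.cong_add O.cong_mult O.cong_refl b cd)
  also have "\<dots> = smul (?g * ?t) (mon i (j - 1) k) + smul (?g * ?t * ?r + r) (mon (Suc i) j k)"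
    by (simp add: mon_def distrib_left mult.assoc power_Suc2 del: power_Suc)
  finally show ?thesis
    using inverse_q2_geometric_nonzero[of j] q_nonzero
    by (intro exI[of _ "?g * ?t"] exI[of _ "?g * ?t * ?r + r"]) (auto simp del: power_inverse)
qed

lemma pr_mon_1: "pr (mon i j k) 1 = (if i = 0 \<and> j = 0 then 1 else 0)"
proof -
  have "pr (x * y) 1 = pr x 1 * pr y 1" "pr (x ^ n) 1 = pr x 1 ^ n" for x y n
    using pr_mult_K_pow[of _ _ 0] pr_pow_K_pow[of _ _ 0] by simp_all
  then show ?thesis
    by (simp add: mon_def pr_gen rho_free_1 mat_def power_0_left)
qed

end

section \<open>The coideal subalgebra\<close>

locale coideal_pairing = dual_pairing q N \<phi> for q :: "'k::field" and N \<phi> +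
  fixes lam mu :: 'k
  assumes lam_mu: "(1 - q ^ 2) * lam * mu = 1"
begin

definition e where "e = E + smul lam K"
definition f where "f = smul (q - inverse q) (K * F) + smul mu K"

lemma lam_nonzero: "lam \<noteq> 0" and mu_nonzero: "mu \<noteq> 0"
  using lam_mu by auto

lemma KF_K: "K * F * K \<approx>\<^sub>U smul (q ^ 2) (K * (K * F))"
proof -
  have "smul (q ^ 2) (K * (K * F)) \<approx>\<^sub>U smul (q ^ 2) (K * smul (inverse (q ^ 2)) (F * K))"
    by (intro U.cong_smul U.cong_mult U.cong_refl U_relations)
  then show ?thesis
    using U.cong_sym q_nonzero by (simp add: mult.assoc)
qed

text \<open>The commutator of \<open>E\<close> and \<open>F\<close> contributes
  \<open>1 - K * K\<close>, while the products of the two \<open>K\<close> summands contribute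
  \<open>(1 - q ^ 2) * lam * mu\<close> times \<open>K * K\<close>. The condition on
  \<open>lam\<close> and \<open>mu\<close> is exactly what makes \<open>K * K\<close>
  cancel.\<close>

lemma f_e: "f * e \<approx>\<^sub>U smul (q ^ 2) (e * f) + 1"
proof -
  let ?T = "K * F" and ?c = "q - inverse q" and ?p = "q ^ 2"
  have "smul ?p (E * ?T) = smul ?p (E * K) * F"
    by (simp add: mult.assoc)
  also have "\<dots> \<approx>\<^sub>U K * E * F"
    by (intro U.cong_mult_right U.cong_sym[OF U_relations(2)])
  finally have 1: "?T * E - smul ?p (E * ?T) \<approx>\<^sub>U K * F * E - K * E * F"
    by (intro U.cong_diff U.cong_refl)
  also have "K * F * E - K * E * F = - (K * (E * F - F * E))"
    by (simp add: right_diff_distrib mult.assoc)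
  also have "\<dots> = smul (- 1) (K * (E * F - F * E))"
    by (simp add: uminus_smul)
  also have "\<dots> \<approx>\<^sub>U smul (- 1) (K * smul (1 / ?c) (K - K ^ (N - 1)))"
    by (intro U.cong_smul U.cong_mult U.cong_refl U_relations)
  also have "\<dots> = smul (1 / ?c) (K ^ N) - smul (1 / ?c) (K * K)"
  proof -
    have "K * K ^ (N - 1) = K ^ N"
      using N_gt_1 by (simp add: power_eq_if)
    then show ?thesis
      by (simp add: right_diff_distrib smul_diff uminus_smul)
  qed
  also have "\<dots> \<approx>\<^sub>U smul (1 / ?c) 1 - smul (1 / ?c) (K * K)"
    by (intro U.cong_diff U.cong_smul U.cong_refl U_relations)
  finally have TE: "?T * E - smul ?p (E * ?T) \<approx>\<^sub>U smul (1 / ?c) 1 - smul (1 / ?c) (K * K)" .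
  have TK: "?T * K - smul ?p (K * ?T) \<approx>\<^sub>U 0" and KE: "K * E - smul ?p (E * K) \<approx>\<^sub>U 0"
    using KF_K U_relations(2) by (simp_all add: U.cong_mod_def)
  have KK: "smul (mu * lam) (K * K) - smul (?p * lam * mu) (K * K) = K * K"
  proof -
    have "mu * lam - ?p * lam * mu = 1"
      using lam_mu by (simp add: algebra_simps)
    then show ?thesis
      by (metis diff_smul smul_1)
  qed
  \<comment> \<open>Expanding both products and grouping by pairs of summands gives four
    q-commutators, two of which vanish in the quotient.\<close>
  have "f * e - smul ?p (e * f) = smul ?c (?T * E - smul ?p (E * ?T)) +
      smul (?c * lam) (?T * K - smul ?p (K * ?T)) + smul mu (K * E - smul ?p (E * K)) +
      (smul (mu * lam) (K * K) - smul (?p * lam * mu) (K * K))"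
    by (simp only: e_def f_def distrib_left distrib_right smul_add smul_diff smul_mult_left
        smul_mult_right smul_smul mult.assoc[of K F]) (simp add: algebra_simps)
  also have "\<dots> \<approx>\<^sub>U smul ?c (smul (1 / ?c) 1 - smul (1 / ?c) (K * K)) + smul (?c * lam) 0 + smul mu 0 + K * K"
    unfolding KK by (intro U.cong_add U.cong_smul U.cong_refl TE TK KE)
  also have "\<dots> = 1"
    using q_diff_nonzero by (simp add: smul_diff)
  finally have "f * e - smul ?p (e * f) + smul ?p (e * f) \<approx>\<^sub>U 1 + smul ?p (e * f)"
    by (intro U.cong_add U.cong_refl)
  then show ?thesis
    by (simp add: add.commute)
qed

lemma KF_pow_N: "(K * F) ^ N \<approx>\<^sub>U 0"
proof -
  \<comment> \<open>Collecting the powers of \<open>K\<close> on the right costs only a scalar, so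
    that \<open>F ^ N\<close> appears.\<close>
  have "\<exists>c. (K * F) ^ n \<approx>\<^sub>U smul c (F ^ n * K ^ n)" for n
  proof (induction n)
    case 0
    then show ?case
      by (intro exI[of _ 1]) simp
  next
    case (Suc n)
    then obtain c where c: "(K * F) ^ n \<approx>\<^sub>U smul c (F ^ n * K ^ n)"
      by blast
    have "(K * F) ^ Suc n \<approx>\<^sub>U K * F * smul c (F ^ n * K ^ n)"
      unfolding power_Suc by (rule U.cong_mult_left[OF c])
    also have "\<dots> = smul c (K * F ^ Suc n * K ^ n)"
      by (simp add: mult.assoc)
    also have "\<dots> \<approx>\<^sub>U smul c (smul (inverse (q ^ 2) ^ Suc n) (F ^ Suc n * K) * K ^ n)"
      by (intro U.cong_smul U.cong_mult_right U.cong_commute_power U_relations)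
    also have "\<dots> = smul (c * inverse (q ^ 2) ^ Suc n) (F ^ Suc n * K ^ Suc n)"
      by (simp add: mult.assoc del: power_inverse)
    finally show ?case
      by blast
  qed
  then obtain c where "(K * F) ^ N \<approx>\<^sub>U smul c (F ^ N * K ^ N)"
    by blast
  also have "\<dots> \<approx>\<^sub>U smul c (0 * K ^ N)"
    by (intro U.cong_smul U.cong_mult_right U_relations)
  finally show ?thesis
    by simp
qed

lemma e_pow_N: "e ^ N \<approx>\<^sub>U smul (lam ^ N) 1"
proof -
  have "smul lam K * E \<approx>\<^sub>U smul (q ^ 2) (E * smul lam K)"
    using U.cong_smul[OF U_relations(2), of lam] by (simp add: mult.commute)
  then have "e ^ N \<approx>\<^sub>U E ^ N + smul lam K ^ N"
    unfolding e_def by (rule U.binomial_at_root_of_unity) (use gauss_binomial_q2 N_gt_1 in auto)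
  also have "\<dots> = E ^ N + smul (lam ^ N) (K ^ N)"
    by (simp add: smul_power)
  also have "\<dots> \<approx>\<^sub>U 0 + smul (lam ^ N) 1"
    by (intro U.cong_add U.cong_smul U_relations)
  finally show ?thesis
    by simp
qed

lemma f_pow_N: "f ^ N \<approx>\<^sub>U smul (mu ^ N) 1"
proof -
  let ?c = "q - inverse q"
  have "smul ?c (K * F) * smul mu K = smul (?c * mu) (K * F * K)"
    by (simp add: mult.commute)
  also have "\<dots> \<approx>\<^sub>U smul (?c * mu) (smul (q ^ 2) (K * (K * F)))"
    by (intro U.cong_smul KF_K)
  also have "\<dots> = smul (q ^ 2) (smul mu K * smul ?c (K * F))"
    by (simp add: mult_ac)
  \<comment> \<open>The summand with \<open>K\<close> comes first, because moving
    \<open>K * F\<close> past \<open>K\<close> from left to right is what yields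
    \<open>q ^ 2\<close> and not its inverse.\<close>
  finally have "(smul mu K + smul ?c (K * F)) ^ N \<approx>\<^sub>U smul mu K ^ N + smul ?c (K * F) ^ N"
    by (rule U.binomial_at_root_of_unity) (use gauss_binomial_q2 N_gt_1 in auto)
  then have "f ^ N \<approx>\<^sub>U smul (mu ^ N) (K ^ N) + smul (?c ^ N) ((K * F) ^ N)"
    by (simp only: f_def add.commute smul_power)
  also have "\<dots> \<approx>\<^sub>U smul (mu ^ N) 1 + smul (?c ^ N) 0"
    by (intro U.cong_add U.cong_smul U_relations KF_pow_N)
  finally show ?thesis
    by simp
qed

text \<open>Each passage of \<open>e\<close> through an \<open>f\<close> leaves a correction
  \<open>1\<close>, and these add up to a q-integer. At \<open>j = 0\<close> that coefficient is
  zero, so the truncated \<open>j - 1\<close> is harmless.\<close>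

lemma f_pow_e: "f ^ j * e \<approx>\<^sub>U smul ((q ^ 2) ^ j) (e * f ^ j) + smul (\<Sum>l<j. (q ^ 2) ^ l) (f ^ (j - 1))"
proof (induction j)
  case (Suc j)
  let ?p = "q ^ 2" and ?s = "\<Sum>l<j. (q ^ 2) ^ l"
  have "f ^ Suc j * e = f * (f ^ j * e)"
    by (simp add: mult.assoc)
  also have "\<dots> \<approx>\<^sub>U f * (smul (?p ^ j) (e * f ^ j) + smul ?s (f ^ (j - 1)))"
    by (rule U.cong_mult_left[OF Suc])
  also have "\<dots> = smul (?p ^ j) (f * e * f ^ j) + smul ?s (f ^ j)"
    by (cases j) (simp_all add: distrib_left mult.assoc)
  also have "\<dots> \<approx>\<^sub>U smul (?p ^ j) ((smul ?p (e * f) + 1) * f ^ j) + smul ?s (f ^ j)"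
    by (intro U.cong_add U.cong_smul U.cong_mult_right U.cong_refl f_e)
  also have "\<dots> = smul (?p ^ Suc j) (e * f ^ Suc j) + smul (\<Sum>l<Suc j. ?p ^ l) (f ^ (Suc j - 1))"
    by (simp add: distrib_right smul_add add_smul mult.assoc mult.commute[of "?p ^ j" ?p] add_ac
        del: power_mult_distrib)
  finally show ?case .
qed simp

section \<open>Ordered monomials span the coideal subalgebra\<close>

lemma reduce_pow:
  assumes "x ^ N \<approx>\<^sub>U smul c 1"
  shows "x ^ n \<approx>\<^sub>U smul (c ^ (n div N)) (x ^ (n mod N))"
proof -
  have "x ^ n = (x ^ N) ^ (n div N) * x ^ (n mod N)"
    by (simp add: power_mult[symmetric] power_add[symmetric])
  also have "\<dots> \<approx>\<^sub>U smul c 1 ^ (n div N) * x ^ (n mod N)"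
    by (intro U.cong_mult_right U.cong_power assms)
  finally show ?thesis
    by (simp add: smul_power)
qed

text \<open>The rule \<open>congr\<close> makes this a union of cosets, so that the relations can be
  applied inside it.\<close>

inductive_set B_span :: "(U_gen, 'k) free_alg set" where
  basis: "i < N \<Longrightarrow> j < N \<Longrightarrow> e ^ i * f ^ j \<in> B_span"
| add: "x \<in> B_span \<Longrightarrow> y \<in> B_span \<Longrightarrow> x + y \<in> B_span"
| smul: "x \<in> B_span \<Longrightarrow> smul c x \<in> B_span"
| congr: "x \<in> B_span \<Longrightarrow> x \<approx>\<^sub>U y \<Longrightarrow> y \<in> B_span"

lemma B_span_monomial: "e ^ i * f ^ j \<in> B_span"
proof -
  have "e ^ i * f ^ j \<approx>\<^sub>U smul ((lam ^ N) ^ (i div N)) (e ^ (i mod N)) * smul ((mu ^ N) ^ (j div N)) (f ^ (j mod N))"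
    by (intro U.cong_mult reduce_pow e_pow_N f_pow_N)
  then have "smul ((lam ^ N) ^ (i div N) * (mu ^ N) ^ (j div N)) (e ^ (i mod N) * f ^ (j mod N)) \<approx>\<^sub>U e ^ i * f ^ j"
    by (simp add: U.cong_sym mult.commute)
  then show ?thesis
    by (rule B_span.congr[rotated]) (use N_gt_1 in \<open>simp add: B_span.smul B_span.basis\<close>)
qed

text \<open>\<open>f_pow_e\<close> brings the new \<open>e\<close> to the left of the power of
  \<open>f\<close>, and \<open>B_span_monomial\<close> reduces exponents that have become too
  large.\<close>

lemma B_span_mult_e: "x \<in> B_span \<Longrightarrow> x * e \<in> B_span"
proof (induction rule: B_span.induct)
  case (basis i j)
  let ?p = "q ^ 2" and ?s = "\<Sum>l<j. (q ^ 2) ^ l"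
  have "e ^ i * (f ^ j * e) \<approx>\<^sub>U e ^ i * (smul (?p ^ j) (e * f ^ j) + smul ?s (f ^ (j - 1)))"
    by (rule U.cong_mult_left[OF f_pow_e])
  also have "\<dots> = smul (?p ^ j) (e ^ Suc i * f ^ j) + smul ?s (e ^ i * f ^ (j - 1))"
    by (simp add: distrib_left mult.assoc[symmetric] power_commutes)
  finally have "smul (?p ^ j) (e ^ Suc i * f ^ j) + smul ?s (e ^ i * f ^ (j - 1)) \<approx>\<^sub>U e ^ i * f ^ j * e"
    by (simp add: U.cong_sym mult.assoc)
  then show ?case
    by (rule B_span.congr[rotated]) (intro B_span.add B_span.smul B_span_monomial)
next
  case (congr x y)
  then show ?case
    using B_span.congr U.cong_mult_right by blast
qed (simp_all add: distrib_right B_span.add B_span.smul)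

lemma B_span_mult_f: "x \<in> B_span \<Longrightarrow> x * f \<in> B_span"
proof (induction rule: B_span.induct)
  case (basis i j)
  show ?case
    using B_span_monomial[of i "Suc j"] by (simp add: mult.assoc power_commutes)
next
  case (congr x y)
  then show ?case
    using B_span.congr U.cong_mult_right by blast
qed (simp_all add: distrib_right B_span.add B_span.smul)

lemma B_span_coeffs:
  "x \<in> B_span \<Longrightarrow> \<exists>c. x \<approx>\<^sub>U (\<Sum>i<N. \<Sum>j<N. smul (c i j) (e ^ i * f ^ j))"
proof (induction rule: B_span.induct)
  case (basis i j)
  have "(\<Sum>i'<N. \<Sum>j'<N. smul (if i' = i \<and> j' = j then 1 else 0) (e ^ i' * f ^ j')) =
      (\<Sum>i'<N. \<Sum>j'<N. if i' = i \<and> j' = j then e ^ i * f ^ j else 0)"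
    by (intro sum.cong refl) simp
  also have "\<dots> = (\<Sum>i'<N. if i' = i then \<Sum>j'<N. if j' = j then e ^ i * f ^ j else 0 else 0)"
    by (intro sum.cong refl) simp
  also have "\<dots> = e ^ i * f ^ j"
    using basis by (simp add: sum.delta)
  finally show ?case
    by (intro exI[of _ "\<lambda>i' j'. if i' = i \<and> j' = j then 1 else 0"]) (simp only: U.cong_refl)
next
  case (add x y)
  then obtain c d where "x \<approx>\<^sub>U (\<Sum>i<N. \<Sum>j<N. smul (c i j) (e ^ i * f ^ j))"
    "y \<approx>\<^sub>U (\<Sum>i<N. \<Sum>j<N. smul (d i j) (e ^ i * f ^ j))"
    by blast
  from U.cong_add[OF this] show ?case
    by (intro exI[of _ "\<lambda>i j. c i j + d i j"]) (simp add: add_smul sum.distrib)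
next
  case (smul x s)
  then obtain c where "x \<approx>\<^sub>U (\<Sum>i<N. \<Sum>j<N. smul (c i j) (e ^ i * f ^ j))"
    by blast
  from U.cong_smul[OF this, of s] show ?case
    by (intro exI[of _ "\<lambda>i j. s * c i j"]) (simp add: smul_sum)
next
  case (congr x y)
  then show ?case
    using U.cong_trans U.cong_sym by blast
qed

section \<open>A Frobenius form on the coideal subalgebra\<close>

text \<open>Leading terms are taken with respect to the lexicographic order of \<open>(j, i)\<close>, because \<open>f\<close> may
  raise \<open>i\<close> when it does not lower \<open>j\<close>.\<close>

inductive_set tail :: "nat \<Rightarrow> nat \<Rightarrow> (O_gen, 'k) free_alg set" for j0 i0 where
  basis: "j > j0 \<or> (j = j0 \<and> i > i0) \<Longrightarrow> mon i j k \<in> tail j0 i0"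
| add: "x \<in> tail j0 i0 \<Longrightarrow> y \<in> tail j0 i0 \<Longrightarrow> x + y \<in> tail j0 i0"
| smul: "x \<in> tail j0 i0 \<Longrightarrow> smul c x \<in> tail j0 i0"
| congr: "x \<in> tail j0 i0 \<Longrightarrow> x \<approx>\<^sub>O y \<Longrightarrow> y \<in> tail j0 i0"

lemma tail_mono:
  assumes "j1 < j0 \<or> (j1 = j0 \<and> i1 \<le> i0)"
  shows "x \<in> tail j0 i0 \<Longrightarrow> x \<in> tail j1 i1"
proof (induction rule: tail.induct)
  case (basis j i k)
  then show ?case
    using assms by (intro tail.basis) auto
qed (auto intro: tail.intros)

lemma tail_act_linear:
  assumes "x \<in> tail j0 i0"
    and "\<And>i j k. j > j0 \<or> (j = j0 \<and> i > i0) \<Longrightarrow> mon i j k \<triangleleft> h \<in> tail j1 i1"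
  shows "x \<triangleleft> h \<in> tail j1 i1"
  using assms(1)
proof (induction rule: tail.induct)
  case (basis j i k)
  then show ?case
    by (rule assms(2))
next
  case (add x y)
  then show ?case
    by (meson O.cong_sym act_add_left tail.add tail.congr)
next
  case (smul x c)
  then show ?case
    by (meson O.cong_sym act_smul_left tail.smul tail.congr)
next
  case (congr x y)
  then show ?case
    by (meson act_cong_left tail.congr)
qed

lemma mon_act_e:
  "\<exists>s t. mon i j k \<triangleleft> e \<approx>\<^sub>O smul s (mon (i - 1) j (Suc k)) + smul t (mon i j k) \<and>
    (0 < i \<and> i < N \<longrightarrow> s \<noteq> 0) \<and> (i = 0 \<longrightarrow> s = 0)"
proof -
  obtain s where st: "mon i j k \<triangleleft> E \<approx>\<^sub>O smul s (mon (i - 1) j (Suc k))"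
    "0 < i \<and> i < N \<longrightarrow> s \<noteq> 0" "i = 0 \<longrightarrow> s = 0"
    using mon_act_E[of i j k] by blast
  obtain t where t: "mon i j k \<triangleleft> K \<approx>\<^sub>O smul t (mon i j k)"
    using mon_act_K[of i j k] by blast
  have "mon i j k \<triangleleft> e \<approx>\<^sub>O mon i j k \<triangleleft> E + mon i j k \<triangleleft> smul lam K"
    unfolding e_def by (rule act_add_right)
  also have "\<dots> \<approx>\<^sub>O mon i j k \<triangleleft> E + smul lam (mon i j k \<triangleleft> K)"
    by (intro O.cong_add O.cong_refl act_smul_right)
  also have "\<dots> \<approx>\<^sub>O smul s (mon (i - 1) j (Suc k)) + smul lam (smul t (mon i j k))"
    by (intro O.cong_add O.cong_smul st t)
  finally have *: "mon i j k \<triangleleft> e \<approx>\<^sub>O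
      smul s (mon (i - 1) j (Suc k)) + smul lam (smul t (mon i j k))" .
  show ?thesis
    by (rule exI[of _ s], rule exI[of _ "lam * t"]) (use * st(2,3) in simp)
qed

lemma mon_act_f:
  "\<exists>s t r k'. mon i j k \<triangleleft> f \<approx>\<^sub>O smul s (mon i (j - 1) k') + smul t (mon (Suc i) j k') +
      smul r (mon i j k) \<and> (0 < j \<and> j < N \<longrightarrow> s \<noteq> 0) \<and> (j = 0 \<longrightarrow> s = 0)"
proof -
  \<comment> \<open>\<open>mon_act_KF\<close> needs a positive exponent of \<open>Od\<close>; adding
    \<open>N\<close> provides one without changing the class.\<close>
  define k' where "k' = k + N - 1"
  have k': "k + N = Suc k'"
    using N_gt_1 by (simp add: k'_def)
  obtain s t where st: "mon i j (Suc k') \<triangleleft> (K * F) \<approx>\<^sub>O smul s (mon i (j - 1) k') + smul t (mon (Suc i) j k')"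
    "0 < j \<and> j < N \<longrightarrow> s \<noteq> 0" "j = 0 \<longrightarrow> s = 0"
    using mon_act_KF[of i j k'] by blast
  obtain r where r: "mon i j k \<triangleleft> K \<approx>\<^sub>O smul r (mon i j k)"
    using mon_act_K[of i j k] by blast
  have "mon i j k \<triangleleft> f \<approx>\<^sub>O mon i j k \<triangleleft> smul (q - inverse q) (K * F) + mon i j k \<triangleleft> smul mu K"
    unfolding f_def by (rule act_add_right)
  also have "\<dots> \<approx>\<^sub>O smul (q - inverse q) (mon i j k \<triangleleft> (K * F)) + smul mu (mon i j k \<triangleleft> K)"
    by (intro O.cong_add act_smul_right)
  also have "\<dots> \<approx>\<^sub>O smul (q - inverse q) (mon i j (Suc k') \<triangleleft> (K * F)) + smul mu (smul r (mon i j k))"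
    by (intro O.cong_add O.cong_smul act_cong_left r O.cong_sym[OF mon_add_N[of i j k, unfolded k']])
  also have "\<dots> \<approx>\<^sub>O smul (q - inverse q) (smul s (mon i (j - 1) k') + smul t (mon (Suc i) j k')) +
      smul mu (smul r (mon i j k))"
    by (intro O.cong_add O.cong_smul st O.cong_refl)
  also have "\<dots> = smul ((q - inverse q) * s) (mon i (j - 1) k') +
      smul ((q - inverse q) * t) (mon (Suc i) j k') + smul (mu * r) (mon i j k)"
    by (simp add: smul_add)
  finally have *: "mon i j k \<triangleleft> f \<approx>\<^sub>O smul ((q - inverse q) * s) (mon i (j - 1) k') +
      smul ((q - inverse q) * t) (mon (Suc i) j k') + smul (mu * r) (mon i j k)" .
  show ?thesis
    by (rule exI[of _ "(q - inverse q) * s"], rule exI[of _ "(q - inverse q) * t"],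
        rule exI[of _ "mu * r"], rule exI[of _ k'])
      (use * st(2,3) q_diff_nonzero in simp)
qed

lemma tail_act_e: "x \<in> tail j (Suc i) \<Longrightarrow> x \<triangleleft> e \<in> tail j i"
proof (erule tail_act_linear)
  fix i' j' k :: nat
  assume *: "j' > j \<or> (j' = j \<and> i' > Suc i)"
  obtain s t where st: "mon i' j' k \<triangleleft> e \<approx>\<^sub>O smul s (mon (i' - 1) j' (Suc k)) + smul t (mon i' j' k)"
    using mon_act_e[of i' j' k] by blast
  have "smul s (mon (i' - 1) j' (Suc k)) + smul t (mon i' j' k) \<in> tail j i"
    using * by (intro tail.add tail.smul tail.basis) auto
  then show "mon i' j' k \<triangleleft> e \<in> tail j i"
    by (rule tail.congr[OF _ O.cong_sym[OF st]])
qed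

text \<open>Lowering an exponent \<open>j' = Suc j\<close> gives \<open>j\<close>, and such a
  monomial stays in the tail because its exponent of \<open>b\<close> is positive. Terms that raise
  the exponent of \<open>b\<close> keep \<open>j'\<close>, which exceeds \<open>j\<close>.\<close>

lemma tail_act_f: "x \<in> tail (Suc j) 0 \<Longrightarrow> x \<triangleleft> f \<in> tail j 0"
proof (erule tail_act_linear)
  fix i' j' k :: nat
  assume *: "j' > Suc j \<or> (j' = Suc j \<and> i' > 0)"
  obtain s t r k' where st: "mon i' j' k \<triangleleft> f \<approx>\<^sub>O smul s (mon i' (j' - 1) k') +
      smul t (mon (Suc i') j' k') + smul r (mon i' j' k)"
    using mon_act_f[of i' j' k] by blast
  have "smul s (mon i' (j' - 1) k') + smul t (mon (Suc i') j' k') + smul r (mon i' j' k) \<in> tail j 0"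
    using * by (intro tail.add tail.smul tail.basis) auto
  then show "mon i' j' k \<triangleleft> f \<in> tail j 0"
    by (rule tail.congr[OF _ O.cong_sym[OF st]])
qed

lemma tail_pr_1: "x \<in> tail j i \<Longrightarrow> pr x 1 = 0"
proof (induction rule: tail.induct)
  case (congr x y)
  then show ?case
    by (simp add: pr_cong[OF congr(2) U.cong_refl, symmetric])
qed (auto simp: pr_mon_1 pr_simps)

definition lead :: "nat \<Rightarrow> nat \<Rightarrow> (O_gen, 'k) free_alg \<Rightarrow> bool"
  where "lead j i x \<longleftrightarrow> (\<exists>c k t. c \<noteq> 0 \<and> t \<in> tail j i \<and> x \<approx>\<^sub>O smul c (mon i j k) + t)"

lemma lead_cong: "x \<approx>\<^sub>O y \<Longrightarrow> lead j i y \<Longrightarrow> lead j i x"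
  unfolding lead_def by (blast intro: O.cong_trans)

lemma lead_tail:
  assumes "lead j i x" "j1 < j \<or> (j1 = j \<and> i1 < i)"
  shows "x \<in> tail j1 i1"
proof -
  obtain c k t where *: "t \<in> tail j i" "x \<approx>\<^sub>O smul c (mon i j k) + t"
    using assms(1) by (auto simp: lead_def)
  have "t \<in> tail j1 i1"
    using tail_mono[OF _ *(1), of j1 i1] assms(2) by auto
  then have "smul c (mon i j k) + t \<in> tail j1 i1"
    using assms(2) by (intro tail.add tail.smul tail.basis) auto
  then show ?thesis
    using *(2) tail.congr O.cong_sym by blast
qed

text \<open>The summand on which \<open>e\<close> acts through \<open>K\<close> keeps the exponent
  \<open>Suc i\<close> and passes into the tail; the lowered one leads, with a coefficient that is
  non-zero by \<open>mon_act_e\<close>.\<close>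

lemma lead_act_e:
  assumes "lead j (Suc i) x" "Suc i < N"
  shows "lead j i (x \<triangleleft> e)"
proof -
  obtain c k t where *: "c \<noteq> 0" "t \<in> tail j (Suc i)" "x \<approx>\<^sub>O smul c (mon (Suc i) j k) + t"
    using assms(1) by (auto simp: lead_def)
  obtain s r where s: "s \<noteq> 0"
    "mon (Suc i) j k \<triangleleft> e \<approx>\<^sub>O smul s (mon i j (Suc k)) + smul r (mon (Suc i) j k)"
    using mon_act_e[of "Suc i" j k] assms(2) by auto
  have "x \<triangleleft> e \<approx>\<^sub>O (smul c (mon (Suc i) j k) + t) \<triangleleft> e"
    by (rule act_cong_left[OF *(3)])
  also have "\<dots> \<approx>\<^sub>O smul c (mon (Suc i) j k) \<triangleleft> e + t \<triangleleft> e"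
    by (rule act_add_left)
  also have "\<dots> \<approx>\<^sub>O smul c (mon (Suc i) j k \<triangleleft> e) + t \<triangleleft> e"
    by (intro O.cong_add act_smul_left O.cong_refl)
  also have "\<dots> \<approx>\<^sub>O smul c (smul s (mon i j (Suc k)) + smul r (mon (Suc i) j k)) + t \<triangleleft> e"
    by (intro O.cong_add O.cong_smul s O.cong_refl)
  also have "\<dots> = smul (c * s) (mon i j (Suc k)) + (smul (c * r) (mon (Suc i) j k) + t \<triangleleft> e)"
    by (simp add: smul_add add.assoc)
  finally have "x \<triangleleft> e \<approx>\<^sub>O smul (c * s) (mon i j (Suc k)) + (smul (c * r) (mon (Suc i) j k) + t \<triangleleft> e)" .
  moreover have "smul (c * r) (mon (Suc i) j k) + t \<triangleleft> e \<in> tail j i"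
    by (intro tail.add tail.smul tail.basis tail_act_e *) auto
  ultimately show ?thesis
    using * s unfolding lead_def by (meson no_zero_divisors)
qed

lemma lead_act_f:
  assumes "lead (Suc j) 0 x" "Suc j < N"
  shows "lead j 0 (x \<triangleleft> f)"
proof -
  obtain c k t where *: "c \<noteq> 0" "t \<in> tail (Suc j) 0" "x \<approx>\<^sub>O smul c (mon 0 (Suc j) k) + t"
    using assms(1) by (auto simp: lead_def)
  obtain s r r' k' where s: "s \<noteq> 0" "mon 0 (Suc j) k \<triangleleft> f \<approx>\<^sub>O
      smul s (mon 0 j k') + smul r (mon (Suc 0) (Suc j) k') + smul r' (mon 0 (Suc j) k)"
    using mon_act_f[of 0 "Suc j" k] assms(2) by auto
  let ?u = "smul r (mon (Suc 0) (Suc j) k') + smul r' (mon 0 (Suc j) k)"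
  have "x \<triangleleft> f \<approx>\<^sub>O (smul c (mon 0 (Suc j) k) + t) \<triangleleft> f"
    by (rule act_cong_left[OF *(3)])
  also have "\<dots> \<approx>\<^sub>O smul c (mon 0 (Suc j) k) \<triangleleft> f + t \<triangleleft> f"
    by (rule act_add_left)
  also have "\<dots> \<approx>\<^sub>O smul c (mon 0 (Suc j) k \<triangleleft> f) + t \<triangleleft> f"
    by (intro O.cong_add act_smul_left O.cong_refl)
  also have "\<dots> \<approx>\<^sub>O smul c (smul s (mon 0 j k') + smul r (mon (Suc 0) (Suc j) k') + smul r' (mon 0 (Suc j) k)) + t \<triangleleft> f"
    by (intro O.cong_add O.cong_smul s O.cong_refl)
  also have "\<dots> = smul (c * s) (mon 0 j k') + (smul c ?u + t \<triangleleft> f)"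
    by (simp add: smul_add add.assoc)
  finally have "x \<triangleleft> f \<approx>\<^sub>O smul (c * s) (mon 0 j k') + (smul c ?u + t \<triangleleft> f)" .
  moreover have "smul c ?u + t \<triangleleft> f \<in> tail j 0"
    by (intro tail.add tail.smul tail.basis tail_act_f *) auto
  ultimately show ?thesis
    using * s unfolding lead_def by (meson no_zero_divisors)
qed

lemma lead_pr_1: "lead 0 0 x \<Longrightarrow> pr x 1 \<noteq> 0"
  by (auto simp: lead_def pr_cong[OF _ U.cong_refl] pr_simps pr_mon_1 tail_pr_1)

section \<open>The Frobenius form given by an element with top leading term\<close>

context
  fixes v
  assumes v: "lead (N - 1) (N - 1) v"
begin

lemma lead_v_e_pow: "n < N \<Longrightarrow> lead (N - 1) (N - 1 - n) (v \<triangleleft> e ^ n)"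
proof (induction n)
  case 0
  show ?case
    using lead_cong[OF act_1 v] by simp
next
  case (Suc n)
  have "N - 1 - n = Suc (N - 1 - Suc n)"
    using Suc by linarith
  then have "lead (N - 1) (N - 1 - Suc n) (v \<triangleleft> e ^ n \<triangleleft> e)"
    using Suc by (intro lead_act_e) auto
  moreover have "v \<triangleleft> e ^ Suc n \<approx>\<^sub>O v \<triangleleft> e ^ n \<triangleleft> e"
    using act_mult[of v "e ^ n" e] by (simp add: power_commutes)
  ultimately show ?case
    by (rule lead_cong[rotated])
qed

lemma tail_act_f_pow: "x \<in> tail J 0 \<Longrightarrow> m \<le> J \<Longrightarrow> x \<triangleleft> f ^ m \<in> tail (J - m) 0"
proof (induction m)
  case 0
  then show ?case
    using tail.congr[OF _ O.cong_sym[OF act_1]] by simp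
next
  case (Suc m)
  have "J - m = Suc (J - Suc m)"
    using Suc by linarith
  then have "x \<triangleleft> f ^ m \<triangleleft> f \<in> tail (J - Suc m) 0"
    using Suc by (intro tail_act_f) auto
  moreover have "x \<triangleleft> f ^ m \<triangleleft> f \<approx>\<^sub>O x \<triangleleft> f ^ Suc m"
    using act_mult[of x "f ^ m" f] by (simp add: power_commutes O.cong_sym)
  ultimately show ?case
    by (rule tail.congr)
qed

lemma lead_act_f_pow: "lead J 0 x \<Longrightarrow> J < N \<Longrightarrow> m \<le> J \<Longrightarrow> lead (J - m) 0 (x \<triangleleft> f ^ m)"
proof (induction m)
  case 0
  then show ?case
    using lead_cong[OF act_1] by simp
next
  case (Suc m)
  have "J - m = Suc (J - Suc m)"
    using Suc by linarith
  then have "lead (J - Suc m) 0 (x \<triangleleft> f ^ m \<triangleleft> f)"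
    using Suc by (intro lead_act_f) auto
  moreover have "x \<triangleleft> f ^ Suc m \<approx>\<^sub>O x \<triangleleft> f ^ m \<triangleleft> f"
    using act_mult[of x "f ^ m" f] by (simp add: power_commutes)
  ultimately show ?case
    by (rule lead_cong[rotated])
qed

text \<open>If \<open>n < N - 1\<close>, the exponent of \<open>b\<close> is still positive and the
  element has entered the tail, which powers of \<open>f\<close> cannot bring down to
  \<open>1\<close>. If only \<open>m < N - 1\<close>, the leading exponent of \<open>c\<close> is
  still positive. Otherwise a non-zero multiple of a power of \<open>d\<close> leads.\<close>

lemma pr_v_reduced:
  assumes "n < N" "m < N"
  shows "pr v (e ^ n * f ^ m) \<noteq> 0 \<longleftrightarrow> n = N - 1 \<and> m = N - 1"
proof -
  have *: "pr v (e ^ n * f ^ m) = pr (v \<triangleleft> e ^ n \<triangleleft> f ^ m) 1"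
    by (simp add: pr_act)
  have lead: "lead (N - 1) (N - 1 - n) (v \<triangleleft> e ^ n)"
    by (rule lead_v_e_pow[OF assms(1)])
  consider "n < N - 1" | "n = N - 1" "m < N - 1" | "n = N - 1" "m = N - 1"
    using assms by linarith
  then show ?thesis
  proof cases
    case 1
    then have "v \<triangleleft> e ^ n \<in> tail (N - 1) 0"
      by (intro lead_tail[OF lead]) auto
    then have "v \<triangleleft> e ^ n \<triangleleft> f ^ m \<in> tail (N - 1 - m) 0"
      using assms by (intro tail_act_f_pow) auto
    then have "pr v (e ^ n * f ^ m) = 0"
      unfolding * by (rule tail_pr_1)
    then show ?thesis
      using 1 by simp
  next
    case 2
    then have "lead (N - 1 - m) 0 (v \<triangleleft> e ^ n \<triangleleft> f ^ m)"
      using lead N_gt_1 by (intro lead_act_f_pow) auto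
    then have "v \<triangleleft> e ^ n \<triangleleft> f ^ m \<in> tail 0 0"
      using 2 by (intro lead_tail) auto
    then have "pr v (e ^ n * f ^ m) = 0"
      unfolding * by (rule tail_pr_1)
    then show ?thesis
      using 2 by simp
  next
    case 3
    then have "lead (N - 1 - m) 0 (v \<triangleleft> e ^ n \<triangleleft> f ^ m)"
      using lead N_gt_1 by (intro lead_act_f_pow) auto
    then have "pr v (e ^ n * f ^ m) \<noteq> 0"
      using 3 unfolding * by (intro lead_pr_1) simp
    then show ?thesis
      using 3 by simp
  qed
qed

text \<open>The exponent of \<open>e\<close> is arbitrary, because sums of two exponents occur
  below; it is reduced by \<open>e_pow_N\<close>.\<close>

lemma pr_v:
  assumes "m < N"
  shows "pr v (e ^ n * f ^ m) \<noteq> 0 \<longleftrightarrow> n mod N = N - 1 \<and> m = N - 1"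
proof -
  have "e ^ n * f ^ m \<approx>\<^sub>U smul ((lam ^ N) ^ (n div N)) (e ^ (n mod N)) * f ^ m"
    by (intro U.cong_mult_right reduce_pow e_pow_N)
  then have "pr v (e ^ n * f ^ m) = (lam ^ N) ^ (n div N) * pr v (e ^ (n mod N) * f ^ m)"
    using pr_cong[OF O.cong_refl] by (simp add: pr_simps)
  then show ?thesis
    using pr_v_reduced[of "n mod N" m] assms N_gt_1 lam_nonzero by simp
qed

text \<open>Moving \<open>e\<close> past a power of \<open>f\<close> leaves a correction with a
  smaller exponent of \<open>f\<close>. Its total exponent of \<open>f\<close> is then below
  \<open>N - 1\<close>, where the form vanishes.\<close>

lemma pr_v_commute:
  assumes "j + s < N"
  shows "pr v (e ^ i * f ^ j * (e ^ t * f ^ s)) = (q ^ 2) ^ (j * t) * pr v (e ^ (i + t) * f ^ (j + s))"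
  using assms
proof (induction t arbitrary: i j)
  case 0
  show ?case
    by (simp add: power_add mult.assoc)
next
  case (Suc t)
  let ?p = "q ^ 2" and ?c = "\<Sum>l<j. (q ^ 2) ^ l"
  have "e ^ i * f ^ j * (e ^ Suc t * f ^ s) = e ^ i * (f ^ j * e) * (e ^ t * f ^ s)"
    by (simp add: mult.assoc)
  also have "\<dots> \<approx>\<^sub>U e ^ i * (smul (?p ^ j) (e * f ^ j) + smul ?c (f ^ (j - 1))) * (e ^ t * f ^ s)"
    by (intro U.cong_mult U.cong_refl f_pow_e)
  also have "\<dots> = smul (?p ^ j) (e ^ Suc i * f ^ j * (e ^ t * f ^ s)) +
      smul ?c (e ^ i * f ^ (j - 1) * (e ^ t * f ^ s))"
    by (simp add: distrib_left distrib_right mult.assoc power_Suc2 del: power_Suc)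
  finally have "pr v (e ^ i * f ^ j * (e ^ Suc t * f ^ s)) =
      ?p ^ j * pr v (e ^ Suc i * f ^ j * (e ^ t * f ^ s)) +
      ?c * pr v (e ^ i * f ^ (j - 1) * (e ^ t * f ^ s))"
    using pr_cong[OF O.cong_refl] by (simp add: pr_simps)
  moreover have "?c * pr v (e ^ i * f ^ (j - 1) * (e ^ t * f ^ s)) = 0"
  proof (cases j)
    case (Suc l)
    then have "l + s < N" "l + s \<noteq> N - 1"
      using Suc.prems by auto
    then have "pr v (e ^ (i + t) * f ^ (l + s)) = 0"
      using pr_v by blast
    then show ?thesis
      using Suc.IH[of l i] \<open>l + s < N\<close> Suc by simp
  qed simp
  moreover have "pr v (e ^ Suc i * f ^ j * (e ^ t * f ^ s)) =
      ?p ^ (j * t) * pr v (e ^ (Suc i + t) * f ^ (j + s))"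
    by (rule Suc.IH[OF Suc.prems])
  ultimately show ?case
    by (simp only: mult_Suc_right power_add[of ?p] mult.assoc add_Suc_right add_Suc add_0_right)
qed

text \<open>Coefficients are eliminated by downward induction on the exponent of \<open>f\<close>.
  Once they vanish above \<open>M\<close>, multiplying by the monomial complementary to
  \<open>e ^ i0 * f ^ M\<close> and applying the form isolates \<open>c i0 M\<close>.\<close>

lemma frobenius_nondegenerate:
  assumes "x \<in> B_span" and "\<And>t s. pr v (x * (e ^ t * f ^ s)) = 0"
  shows "x \<approx>\<^sub>U 0"
proof -
  obtain c where c: "x \<approx>\<^sub>U (\<Sum>i<N. \<Sum>j<N. smul (c i j) (e ^ i * f ^ j))"
    using B_span_coeffs[OF assms(1)] by blast
  have "\<forall>i<N. \<forall>j<N. M \<le> j \<longrightarrow> c i j = 0" if "M \<le> N" for M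
    using that
  proof (induction M rule: inc_induct)
    case (step M)
    have "c i0 M = 0" if i0: "i0 < N" for i0
    proof -
      \<comment> \<open>\<open>t\<close> and \<open>s\<close> complete the exponents
        \<open>i0\<close> and \<open>M\<close> to \<open>N - 1\<close>, the only place where the
        form is non-zero.\<close>
      define t where "t = N - 1 - i0"
      define s where "s = N - 1 - M"
      have "x * (e ^ t * f ^ s) \<approx>\<^sub>U (\<Sum>i<N. \<Sum>j<N. smul (c i j) (e ^ i * f ^ j)) * (e ^ t * f ^ s)"
        by (rule U.cong_mult_right[OF c])
      also have "\<dots> = (\<Sum>i<N. \<Sum>j<N. smul (c i j) (e ^ i * f ^ j * (e ^ t * f ^ s)))"
        by (simp add: sum_distrib_right)
      finally have "pr v (x * (e ^ t * f ^ s)) =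
          (\<Sum>i<N. \<Sum>j<N. c i j * pr v (e ^ i * f ^ j * (e ^ t * f ^ s)))"
        using pr_cong[OF O.cong_refl] by (simp add: pr_simps)
      also have "\<dots> = (\<Sum>i<N. \<Sum>j<N. if i = i0 \<and> j = M
          then c i0 M * pr v (e ^ i0 * f ^ M * (e ^ t * f ^ s)) else 0)"
      proof (intro sum.cong refl)
        fix i j
        assume "i \<in> {..<N}" "j \<in> {..<N}"
        then have ij: "i < N" "j < N"
          by auto
        show "c i j * pr v (e ^ i * f ^ j * (e ^ t * f ^ s)) = (if i = i0 \<and> j = M
          then c i0 M * pr v (e ^ i0 * f ^ M * (e ^ t * f ^ s)) else 0)"
        proof (cases "j \<le> M")
          case True
          then have js: "j + s < N"
            using step.hyps by (simp add: s_def)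
          have "(i + t) mod N = N - 1 \<longleftrightarrow> i = i0"
          proof (cases "i \<le> i0")
            case True
            then show ?thesis
              using i0 by (auto simp: t_def)
          next
            case False
            then obtain l where l: "i = Suc (i0 + l)"
              using less_imp_Suc_add[of i0 i] by auto
            \<comment> \<open>For \<open>i > i0\<close> the exponent wraps around modulo
              \<open>N\<close>, and the remainder \<open>i - i0 - 1\<close> falls short of
              \<open>N - 1\<close>.\<close>
            have "i + t = N + l" and "l < N - 1"
              using i0 ij by (auto simp: t_def l)
            then have "(i + t) mod N = l"
              by simp
            with \<open>l < N - 1\<close>
            have "(i + t) mod N \<noteq> N - 1"
              by linarith
            moreover have "i \<noteq> i0"
              using l by simp
            ultimately show ?thesis
              by blast
          qed
          moreover have "j + s = N - 1 \<longleftrightarrow> j = M"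
            using step.hyps True by (auto simp: s_def)
          ultimately have "pr v (e ^ i * f ^ j * (e ^ t * f ^ s)) \<noteq> 0 \<Longrightarrow> i = i0 \<and> j = M"
            unfolding pr_v_commute[OF js] using pr_v[OF js, of "i + t"] by auto
          then consider "i = i0" "j = M"
            | "\<not> (i = i0 \<and> j = M)" "pr v (e ^ i * f ^ j * (e ^ t * f ^ s)) = 0"
            by blast
          then show ?thesis
          proof cases
            case 1
            then show ?thesis
              by (simp only: simp_thms if_True)
          next
            case 2
            then show ?thesis
              by (simp only: if_False mult_zero_right)
          qed
        next
          case False
          then show ?thesis
            using step.IH ij by simp
        qed
      qed
      also have "\<dots> = (\<Sum>i<N. if i = i0 then \<Sum>j<N. if j = M
          then c i0 M * pr v (e ^ i0 * f ^ M * (e ^ t * f ^ s)) else 0 else 0)"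
        by (intro sum.cong refl) simp
      also have "\<dots> = c i0 M * pr v (e ^ i0 * f ^ M * (e ^ t * f ^ s))"
        using i0 step.hyps by (simp add: sum.delta)
      finally have "c i0 M * pr v (e ^ i0 * f ^ M * (e ^ t * f ^ s)) = 0"
        by (simp add: assms(2))
      moreover have "pr v (e ^ i0 * f ^ M * (e ^ t * f ^ s)) \<noteq> 0"
      proof -
        have "M + s < N" "i0 + t = N - 1" "M + s = N - 1"
          using step.hyps i0 by (auto simp: s_def t_def)
        then show ?thesis
          using pr_v[of "M + s" "i0 + t"] pr_v_commute[of M s i0 t] q_nonzero by simp
      qed
      ultimately show ?thesis
        by simp
    qed
    then show ?case
      using step.IH by (metis Suc_leI le_neq_implies_less)
  qed auto
  from this[of 0] have "(\<Sum>i<N. \<Sum>j<N. smul (c i j) (e ^ i * f ^ j)) = 0"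
    by (simp add: sum.neutral)
  then show ?thesis
    using c by simp
qed

end

end

section \<open>Subalgebras of presented algebras\<close>

lemma uminus_palg: "\<ominus>\<^bsub>palg P\<^esub> pcls P p = pcls P (- p)"
proof -
  interpret ring "palg P"
    by (rule ring_palg)
  show ?thesis
    by (rule minus_equality) (auto simp: palg_simps)
qed

lemma is_subalgebra_pclsI:
  assumes "1 \<in> Q" and "\<And>x y. x \<in> Q \<Longrightarrow> y \<in> Q \<Longrightarrow> x + y \<in> Q"
    and "\<And>x y. x \<in> Q \<Longrightarrow> y \<in> Q \<Longrightarrow> x * y \<in> Q" and "\<And>c x. x \<in> Q \<Longrightarrow> smul c x \<in> Q"
  shows "is_subalgebra (pcls P ` Q) (palg P)"
proof -
  have "- x \<in> Q" if "x \<in> Q" for x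
    using assms(4)[OF that, of "-1"] by (simp add: uminus_smul)
  then show ?thesis
    unfolding is_subalgebra_def
    by (intro conjI ring.subringI[OF ring_palg])
      (auto simp: palg_simps uminus_palg intro!: imageI assms)
qed

lemma is_subalgebra_pclsD:
  assumes "is_subalgebra B (palg P)"
  shows "pcls P 1 \<in> B" and "pcls P x \<in> B \<Longrightarrow> pcls P y \<in> B \<Longrightarrow> pcls P (x + y) \<in> B"
    and "pcls P x \<in> B \<Longrightarrow> pcls P y \<in> B \<Longrightarrow> pcls P (x * y) \<in> B"
    and "pcls P x \<in> B \<Longrightarrow> pcls P (smul c x) \<in> B"
proof -
  have *: "subring B (palg P)" "\<And>x. x \<in> B \<Longrightarrow> c \<odot>\<^bsub>palg P\<^esub> x \<in> B"
    using assms by (auto simp: is_subalgebra_def)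
  show "pcls P 1 \<in> B"
    using subringE(3)[OF *(1)] by (simp add: one_palg)
  show "pcls P x \<in> B \<Longrightarrow> pcls P y \<in> B \<Longrightarrow> pcls P (x + y) \<in> B"
    using subringE(7)[OF *(1), of "pcls P x" "pcls P y"] by (simp add: add_palg)
  show "pcls P x \<in> B \<Longrightarrow> pcls P y \<in> B \<Longrightarrow> pcls P (x * y) \<in> B"
    using subringE(6)[OF *(1), of "pcls P x" "pcls P y"] by (simp add: mult_palg)
  show "pcls P x \<in> B \<Longrightarrow> pcls P (smul c x) \<in> B"
    using *(2)[of "pcls P x"] by (simp add: smult_palg)
qed

lemma is_subalgebra_power: "is_subalgebra B (palg P) \<Longrightarrow> pcls P x \<in> B \<Longrightarrow> pcls P (x ^ n) \<in> B"
  by (induction n) (auto intro: is_subalgebra_pclsD)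

lemma is_subalgebra_sum:
  assumes "is_subalgebra B (palg P)" "\<And>i. i \<in> A \<Longrightarrow> pcls P (g i) \<in> B"
  shows "pcls P (sum g A) \<in> B"
proof -
  have "pcls P 0 \<in> B"
    using is_subalgebra_pclsD(4)[OF assms(1) is_subalgebra_pclsD(1)[OF assms(1)], of 0] by simp
  then show ?thesis
    using assms(2) by (induction A rule: infinite_finite_induct) (auto intro: is_subalgebra_pclsD[OF assms(1)])
qed

lemma subalgebra_gen_subset: "is_subalgebra B A \<Longrightarrow> S \<subseteq> B \<Longrightarrow> subalgebra_gen A S \<subseteq> B"
  by (auto simp: subalgebra_gen_def)

lemma subset_subalgebra_gen: "S \<subseteq> subalgebra_gen A S"
  by (auto simp: subalgebra_gen_def)

section \<open>The invariants\<close>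

definition poly_in :: "'k::comm_ring_1 poly \<Rightarrow> ('g, 'k) free_alg \<Rightarrow> ('g, 'k) free_alg"
  where "poly_in r x = (\<Sum>i\<le>Polynomial.degree r. smul (Polynomial.coeff r i) (x ^ i))"

lemma poly_eval_pcls: "poly_eval (palg P) r (pcls P x) = pcls P (poly_in r x)"
  by (simp add: poly_eval_palg poly_in_def)

lemma poly_in_mem_subalgebra: "is_subalgebra B (palg P) \<Longrightarrow> pcls P x \<in> B \<Longrightarrow> pcls P (poly_in r x) \<in> B"
  unfolding poly_in_def
  by (intro is_subalgebra_sum is_subalgebra_pclsD(4) is_subalgebra_power)

text \<open>Lagrange interpolation, with basis polynomials that are normalised only in the final
  sum.\<close>

lemma interpolation:
  fixes xs ys :: "nat \<Rightarrow> 'k::field"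
  assumes "inj_on xs {..<n}"
  shows "\<exists>r. \<forall>i<n. poly r (xs i) = ys i"
proof -
  define L where "L i = (\<Prod>j\<in>{..<n} - {i}. [:- xs j, 1:])" for i
  have L0: "poly (L i) (xs k) = 0" if "k < n" "k \<noteq> i" for i k
    unfolding L_def poly_prod using that by (intro prod_zero) auto
  have L1: "poly (L i) (xs i) \<noteq> 0" if "i < n" for i
    unfolding L_def poly_prod using assms that by (auto simp: inj_on_def)
  have "poly (\<Sum>i<n. Polynomial.smult (ys i / poly (L i) (xs i)) (L i)) (xs k) = ys k" if "k < n" for k
  proof -
    have "poly (\<Sum>i<n. Polynomial.smult (ys i / poly (L i) (xs i)) (L i)) (xs k) =
        (\<Sum>i<n. if i = k then ys k else 0)"
      unfolding poly_sum using that by (intro sum.cong) (auto simp: L0 L1)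
    also have "\<dots> = ys k"
      using that by simp
    finally show ?thesis .
  qed
  then show ?thesis
    by blast
qed

context dual_pairing
begin

text \<open>\<open>K ^ s\<close> is grouplike, so evaluation at it is an algebra map and commutes
  with polynomials.\<close>

lemma pr_poly_in: "pr (poly_in r x) (K ^ s) = poly r (pr x (K ^ s))"
  by (simp add: poly_in_def pr_simps pr_pow_K_pow poly_altdef)

end

context coideal_pairing
begin

section \<open>Invariance is tested on the two generators\<close>

abbreviation "B \<equiv> B_alg q N lam mu"

lemma B_alg_eq: "B = subalgebra_gen (U_alg q N) {pcls PU e, pcls PU f}"
  by (simp add: B_alg_def Ftilde_def mult_palg smult_palg add_palg e_def f_def)

lemma counit_e: "\<epsilon>U e = lam" and counit_f: "\<epsilon>U f = mu"
  by (simp_all add: e_def f_def scalar_map_id.free_ext_add scalar_map_id.free_ext_smul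
      scalar_map_id.free_ext_mult counit_U_gen)

lemma e_mem_B: "pcls PU e \<in> B" and f_mem_B: "pcls PU f \<in> B"
  using subset_subalgebra_gen[of "{pcls PU e, pcls PU f}" "U_alg q N"] by (simp_all add: B_alg_eq)

text \<open>Instead of multiplying two elements of \<open>B_span\<close>, one considers the elements
  that preserve \<open>B_span\<close> by right multiplication. They form a subalgebra containing the
  generators, and each is recovered by applying it to \<open>1\<close>.\<close>

lemma B_subset: "B \<subseteq> pcls PU ` B_span"
proof
  fix X
  assume X: "X \<in> B"
  let ?T = "{t. \<forall>s\<in>B_span. s * t \<in> B_span}"
  have "is_subalgebra (pcls PU ` ?T) (U_alg q N)"
    by (rule is_subalgebra_pclsI)
      (auto simp: distrib_left mult.assoc[symmetric] intro: B_span.intros)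
  moreover have "{pcls PU e, pcls PU f} \<subseteq> pcls PU ` ?T"
    using B_span_mult_e B_span_mult_f by auto
  ultimately have "B \<subseteq> pcls PU ` ?T"
    unfolding B_alg_eq by (rule subalgebra_gen_subset)
  then obtain t where t: "X = pcls PU t" "\<forall>s\<in>B_span. s * t \<in> B_span"
    using X by auto
  moreover have "1 \<in> B_span"
    using B_span_monomial[of 0 0] by simp
  ultimately show "X \<in> pcls PU ` B_span"
    by force
qed

definition invariant :: "(O_gen, 'k) free_alg \<Rightarrow> bool"
  where "invariant u \<longleftrightarrow> u \<triangleleft> e \<approx>\<^sub>O smul lam u \<and> u \<triangleleft> f \<approx>\<^sub>O smul mu u"

text \<open>The elements that act on a fixed \<open>u\<close> through the counit form a subalgebra,
  because the counit is multiplicative. Hence it suffices that the two generators do so.\<close>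

lemma dagger_eq: "dagger q N \<phi> B = pcls PO ` {u. invariant u}"
proof (intro equalityI subsetI)
  fix X
  assume X: "X \<in> dagger q N \<phi> B"
  then obtain u where u: "X = pcls PO u"
    by (auto simp: dagger_def carrier_palg)
  have "ract q N \<phi> X h = counit PU h \<odot>\<^bsub>O_alg q N\<^esub> X" if "h \<in> B" for h
    using X that by (simp add: dagger_def)
  from this[of "pcls PU _"] have "pcls PO (u \<triangleleft> t) = pcls PO (smul (\<epsilon>U t) u)" if "pcls PU t \<in> B" for t
    using that by (simp add: u ract_pcls counit_U smult_palg)
  from this[OF e_mem_B] this[OF f_mem_B] have "invariant u"
    by (simp add: invariant_def pcls_eq_iff O.cong_mod_def counit_e counit_f)
  then show "X \<in> pcls PO ` {u. invariant u}"
    using u by simp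
next
  fix X
  assume "X \<in> pcls PO ` {u. invariant u}"
  then obtain u where u: "X = pcls PO u" "invariant u"
    by auto
  let ?T = "{t. u \<triangleleft> t \<approx>\<^sub>O smul (\<epsilon>U t) u}"
  have "is_subalgebra (pcls PU ` ?T) (U_alg q N)"
  proof (rule is_subalgebra_pclsI)
    show "1 \<in> ?T"
      using act_1 by (simp add: scalar_map_id.free_ext_1)
    fix x y c
    assume x: "x \<in> ?T"
    have "u \<triangleleft> smul c x \<approx>\<^sub>O smul c (u \<triangleleft> x)"
      by (rule act_smul_right)
    also have "\<dots> \<approx>\<^sub>O smul c (smul (\<epsilon>U x) u)"
      using x by (intro O.cong_smul) simp
    finally show "smul c x \<in> ?T"
      by (simp add: scalar_map_id.free_ext_smul)
    assume y: "y \<in> ?T"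
    have "u \<triangleleft> (x + y) \<approx>\<^sub>O u \<triangleleft> x + u \<triangleleft> y"
      by (rule act_add_right)
    also have "\<dots> \<approx>\<^sub>O smul (\<epsilon>U x) u + smul (\<epsilon>U y) u"
      using x y by (intro O.cong_add) simp_all
    finally show "x + y \<in> ?T"
      by (simp add: scalar_map_id.free_ext_add add_smul)
    have "u \<triangleleft> (x * y) \<approx>\<^sub>O u \<triangleleft> x \<triangleleft> y"
      by (rule act_mult)
    also have "\<dots> \<approx>\<^sub>O smul (\<epsilon>U x) u \<triangleleft> y"
      using x by (intro act_cong_left) simp
    also have "\<dots> \<approx>\<^sub>O smul (\<epsilon>U x) (u \<triangleleft> y)"
      by (rule act_smul_left)
    also have "\<dots> \<approx>\<^sub>O smul (\<epsilon>U x) (smul (\<epsilon>U y) u)"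
      using y by (intro O.cong_smul) simp
    finally show "x * y \<in> ?T"
      by (simp add: scalar_map_id.free_ext_mult)
  qed
  moreover have "{pcls PU e, pcls PU f} \<subseteq> pcls PU ` ?T"
    using u(2) by (auto simp: invariant_def counit_e counit_f)
  ultimately have "B \<subseteq> pcls PU ` ?T"
    unfolding B_alg_eq by (rule subalgebra_gen_subset)
  then have "ract q N \<phi> X h = counit PU h \<odot>\<^bsub>O_alg q N\<^esub> X" if h: "h \<in> B" for h
  proof -
    obtain t where "h = pcls PU t" "u \<triangleleft> t \<approx>\<^sub>O smul (\<epsilon>U t) u"
      using h \<open>B \<subseteq> pcls PU ` ?T\<close> by auto
    then show ?thesis
      by (simp add: u ract_pcls counit_U smult_palg pcls_eq_iff O.cong_mod_def)
  qed
  then show "X \<in> dagger q N \<phi> B"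
    by (simp add: dagger_def u carrier_palg)
qed

lemma invariant_cong: "x \<approx>\<^sub>O y \<Longrightarrow> invariant x \<Longrightarrow> invariant y"
  unfolding invariant_def
  by (meson O.cong_smul O.cong_sym O.cong_trans act_cong_left)

lemma invariant_iff_pr:
  "invariant x \<longleftrightarrow> (\<forall>h. pr x (e * h) = lam * pr x h) \<and> (\<forall>h. pr x (f * h) = mu * pr x h)"
  by (simp add: invariant_def cong_O_iff pr_act pr_simps)

lemma invariant_add: "invariant x \<Longrightarrow> invariant y \<Longrightarrow> invariant (x + y)"
  and invariant_diff: "invariant x \<Longrightarrow> invariant y \<Longrightarrow> invariant (x - y)"
  and invariant_smul: "invariant x \<Longrightarrow> invariant (smul c x)"
  by (simp_all add: invariant_iff_pr pr_simps algebra_simps)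

lemma invariant_1: "invariant 1"
  by (simp add: invariant_iff_pr pr_1_left scalar_map_id.free_ext_mult counit_e counit_f)

text \<open>The coproduct of \<open>h + smul c K\<close> can be grouped with that element and
  \<open>K\<close> in one term, and \<open>1\<close> and \<open>h\<close> in the other. Once
  \<open>x\<close> has absorbed the first leg, the scalar \<open>c\<close> moves to the second
  factor and completes \<open>h\<close> to \<open>h + smul c K\<close> there.\<close>

lemma skew_invariant_mult:
  assumes skew: "\<And>x y. (x * y) \<triangleleft> h \<approx>\<^sub>O (x \<triangleleft> h) * (y \<triangleleft> K) + x * (y \<triangleleft> h)"
    and x: "x \<triangleleft> (h + smul c K) \<approx>\<^sub>O smul c x" and y: "y \<triangleleft> (h + smul c K) \<approx>\<^sub>O smul c y"
  shows "(x * y) \<triangleleft> (h + smul c K) \<approx>\<^sub>O smul c (x * y)"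
proof -
  have split: "z \<triangleleft> (h + smul c K) \<approx>\<^sub>O z \<triangleleft> h + smul c (z \<triangleleft> K)" for z
    by (rule O.cong_trans[OF act_add_right]) (intro O.cong_add O.cong_refl act_smul_right)
  have "(x * y) \<triangleleft> (h + smul c K) \<approx>\<^sub>O (x * y) \<triangleleft> h + smul c ((x * y) \<triangleleft> K)"
    by (rule split)
  also have "\<dots> \<approx>\<^sub>O (x \<triangleleft> h) * (y \<triangleleft> K) + x * (y \<triangleleft> h) + smul c ((x \<triangleleft> K) * (y \<triangleleft> K))"
    by (intro O.cong_add O.cong_smul skew mult_act_K)
  also have "\<dots> = (x \<triangleleft> h + smul c (x \<triangleleft> K)) * (y \<triangleleft> K) + x * (y \<triangleleft> h)"
    by (simp add: distrib_right add_ac)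
  also have "\<dots> \<approx>\<^sub>O smul c x * (y \<triangleleft> K) + x * (y \<triangleleft> h)"
    by (intro O.cong_add O.cong_mult O.cong_refl O.cong_trans[OF O.cong_sym[OF split] x])
  also have "\<dots> = x * (y \<triangleleft> h + smul c (y \<triangleleft> K))"
    by (simp add: distrib_left add_ac)
  also have "\<dots> \<approx>\<^sub>O x * smul c y"
    by (intro O.cong_mult O.cong_refl O.cong_trans[OF O.cong_sym[OF split] y])
  finally show ?thesis
    by simp
qed

lemma invariant_mult: "invariant x \<Longrightarrow> invariant y \<Longrightarrow> invariant (x * y)"
proof -
  assume x: "invariant x" and y: "invariant y"
  let ?h = "smul (q - inverse q) (K * F)"
  have "(x * y) \<triangleleft> ?h \<approx>\<^sub>O (x \<triangleleft> ?h) * (y \<triangleleft> K) + x * (y \<triangleleft> ?h)" for x y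
  proof -
    have "(x * y) \<triangleleft> ?h \<approx>\<^sub>O smul (q - inverse q) ((x * y) \<triangleleft> (K * F))"
      by (rule act_smul_right)
    also have "\<dots> \<approx>\<^sub>O smul (q - inverse q) ((x \<triangleleft> (K * F)) * (y \<triangleleft> K) + x * (y \<triangleleft> (K * F)))"
      by (intro O.cong_smul mult_act_KF)
    also have "\<dots> = smul (q - inverse q) (x \<triangleleft> (K * F)) * (y \<triangleleft> K) +
        x * smul (q - inverse q) (y \<triangleleft> (K * F))"
      by (simp add: smul_add)
    also have "\<dots> \<approx>\<^sub>O (x \<triangleleft> ?h) * (y \<triangleleft> K) + x * (y \<triangleleft> ?h)"
      by (intro O.cong_add O.cong_mult O.cong_refl O.cong_sym[OF act_smul_right])
    finally show ?thesis .
  qed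
  then show ?thesis
    using x y mult_act_E unfolding invariant_def e_def f_def
    by (intro conjI skew_invariant_mult) auto
qed

lemma is_subalgebra_dagger: "is_subalgebra (dagger q N \<phi> B) (O_alg q N)"
  unfolding dagger_eq
  by (rule is_subalgebra_pclsI) (simp_all add: invariant_1 invariant_add invariant_mult invariant_smul)

lemma dagger_memI: "invariant x \<Longrightarrow> pcls PO x \<in> dagger q N \<phi> B"
  by (simp add: dagger_eq)

lemma invariantI: "pcls PO x \<in> dagger q N \<phi> B \<Longrightarrow> invariant x"
  by (auto simp: dagger_eq pcls_eq_iff O.cong_mod_def[symmetric] intro: invariant_cong[OF O.cong_sym])

section \<open>Invariants are determined by their values at powers of K\<close>

lemma invariant_eq_0:
  assumes "invariant u" "\<And>s. pr u (K ^ s) = 0"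
  shows "u \<approx>\<^sub>O 0"
proof -
  \<comment> \<open>The prefix \<open>K ^ s\<close> belongs to the claim, so that the induction
    hypothesis absorbs the powers of \<open>K\<close> that replace \<open>E\<close> and
    \<open>F\<close>.\<close>
  have *: "\<forall>s. pr u (K ^ s * x) = 0" for x
  proof (induction x rule: free_alg_induct)
    case (gen_mult g x)
    show ?case
    proof
      fix s
      show "pr u (K ^ s * (gen g * x)) = 0"
      proof (cases g)
        case Gen_K
        then show ?thesis
          using gen_mult[rule_format, of "Suc s"] by (simp add: power_Suc2 mult.assoc del: power_Suc)
      next
        case Gen_E
        let ?y = "K ^ s * x"
        have "K ^ s * E * x \<approx>\<^sub>U smul ((q ^ 2) ^ s) (E * K ^ s) * x"
          by (intro U.cong_mult_right K_pow_comm)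
        then have "pr u (K ^ s * (E * x)) = (q ^ 2) ^ s * pr u (E * ?y)"
          using pr_cong[OF O.cong_refl] by (simp add: mult.assoc pr_simps)
        also have "pr u (E * ?y) = pr u (e * ?y) - lam * pr u (K ^ Suc s * x)"
          by (simp add: e_def distrib_right pr_simps mult.assoc)
        also have "\<dots> = lam * pr u ?y - lam * pr u (K ^ Suc s * x)"
          using assms(1) by (simp add: invariant_iff_pr)
        also have "\<dots> = 0"
          using gen_mult by (simp only: mult_zero_right diff_self)
        finally show ?thesis
          using Gen_E by simp
      next
        case Gen_F
        \<comment> \<open>\<open>Suc n\<close> is \<open>N + s\<close>, so \<open>K ^ Suc n\<close>
          is congruent to \<open>K ^ s\<close> but has a factor \<open>K\<close> to spare; with it
          \<open>F\<close> becomes the \<open>K * F\<close> that occurs in \<open>f\<close>.\<close>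
        define n where "n = N - 1 + s"
        let ?y = "K ^ n * x"
        have "K ^ (Suc n) * F * x \<approx>\<^sub>U smul (inverse (q ^ 2) ^ Suc n) (F * K ^ Suc n) * x"
          by (intro U.cong_mult_right K_pow_comm)
        moreover have "K ^ Suc n = K ^ N * K ^ s"
          using N_gt_1 by (simp add: n_def power_add[symmetric] del: power_Suc)
        moreover have "K ^ N * K ^ s * F * x \<approx>\<^sub>U 1 * K ^ s * F * x"
          by (intro U.cong_mult_right U_relations)
        ultimately have "K ^ s * F * x \<approx>\<^sub>U smul (inverse (q ^ 2) ^ Suc n) (F * K ^ Suc n) * x"
          using U.cong_sym U.cong_trans by (metis mult_1)
        moreover have "F * K \<approx>\<^sub>U smul (q ^ 2) (K * F)"
          using U.cong_sym[OF U.cong_smul[OF U_relations(3), of "q ^ 2"]] q_nonzero by simp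
        then have "F * K * ?y \<approx>\<^sub>U smul (q ^ 2) (K * F) * ?y"
          by (rule U.cong_mult_right)
        then have "pr u (F * (K * ?y)) = q ^ 2 * pr u (K * F * ?y)"
          using pr_cong[OF O.cong_refl] by (simp add: mult.assoc pr_simps)
        ultimately have "pr u (K ^ s * (F * x)) = inverse (q ^ 2) ^ Suc n * (q ^ 2 * pr u (K * F * ?y))"
          using pr_cong[OF O.cong_refl] by (simp add: mult.assoc pr_simps)
        moreover have "(q - inverse q) * pr u (K * F * ?y) = 0"
        proof -
          have "(q - inverse q) * pr u (K * F * ?y) = pr u (f * ?y) - mu * pr u (K ^ Suc n * x)"
            by (simp add: f_def distrib_right pr_simps mult.assoc)
          also have "\<dots> = mu * pr u ?y - mu * pr u (K ^ Suc n * x)"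
            using assms(1) by (simp add: invariant_iff_pr)
          also have "\<dots> = 0"
            using gen_mult by (simp only: mult_zero_right diff_self)
          finally show ?thesis .
        qed
        ultimately show ?thesis
          using q_diff_nonzero Gen_F by simp
      qed
    qed
  qed (simp_all add: assms(2) distrib_left pr_simps)
  have "pr u x = 0" for x
    using *[of x, THEN spec, of 0] by simp
  then show ?thesis
    by (simp add: cong_O_iff pr_simps)
qed

lemma invariant_eqI:
  assumes "invariant x" "invariant y" "\<And>s. s < N \<Longrightarrow> pr x (K ^ s) = pr y (K ^ s)"
  shows "x \<approx>\<^sub>O y"
proof -
  have "pr (x - y) (K ^ s) = 0" for s
  proof -
    have "K ^ s \<approx>\<^sub>U smul (1 ^ (s div N)) (K ^ (s mod N))"
      by (rule reduce_pow) (use U_relations in simp)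
    then have "pr (x - y) (K ^ s) = pr (x - y) (K ^ (s mod N))"
      by (intro pr_cong) simp_all
    then show ?thesis
      using assms(3)[of "s mod N"] N_gt_1 by (simp add: pr_simps)
  qed
  then have "x - y \<approx>\<^sub>O 0"
    using assms by (intro invariant_eq_0 invariant_diff)
  then show ?thesis
    by (simp add: O.cong_mod_def)
qed

section \<open>The generator of the invariants\<close>

text \<open>Products of the integral with monomials in \<open>e\<close> and \<open>f\<close> are
  multiples of the integral. If the form vanished on it, it would vanish on all these products,
  contrary to nondegeneracy.\<close>

lemma pr_integral:
  assumes v: "lead (N - 1) (N - 1) v"
    and \<Lambda>: "right_integral PU B (pcls PU L)" "pcls PU L \<noteq> \<zero>\<^bsub>U_alg q N\<^esub>"
  shows "pr v L \<noteq> 0" and "L * e \<approx>\<^sub>U smul lam L" and "L * f \<approx>\<^sub>U smul mu L"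
proof -
  have *: "L * t \<approx>\<^sub>U smul (\<epsilon>U t) L" if "pcls PU t \<in> B" for t
  proof -
    have "pcls PU L \<otimes>\<^bsub>U_alg q N\<^esub> pcls PU t = counit PU (pcls PU t) \<odot>\<^bsub>U_alg q N\<^esub> pcls PU L"
      using \<Lambda>(1) that unfolding right_integral_def by blast
    then show ?thesis
      by (simp add: mult_palg smult_palg counit_U pcls_eq_iff U.cong_mod_def)
  qed
  show e: "L * e \<approx>\<^sub>U smul lam L" and f: "L * f \<approx>\<^sub>U smul mu L"
    using *[OF e_mem_B] *[OF f_mem_B] by (simp_all add: counit_e counit_f)
  have pow: "L * t ^ n \<approx>\<^sub>U smul (c ^ n) L" if "L * t \<approx>\<^sub>U smul c L" for t c n
  proof (induction n)
    case (Suc n)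
    have "L * t ^ Suc n = L * t * t ^ n"
      by (simp add: mult.assoc)
    also have "\<dots> \<approx>\<^sub>U smul c L * t ^ n"
      by (rule U.cong_mult_right[OF that])
    also have "\<dots> \<approx>\<^sub>U smul c (smul (c ^ n) L)"
      using U.cong_smul[OF Suc] by simp
    finally show ?case
      by simp
  qed simp
  show "pr v L \<noteq> 0"
  proof
    assume "pr v L = 0"
    have "pr v (L * (e ^ t * f ^ s)) = 0" for t s
    proof -
      have "L * e ^ t * f ^ s \<approx>\<^sub>U smul (lam ^ t) L * f ^ s"
        by (intro U.cong_mult_right pow e)
      also have "\<dots> \<approx>\<^sub>U smul (lam ^ t) (smul (mu ^ s) L)"
        using U.cong_smul[OF pow[OF f]] by simp
      finally have "pr v (L * (e ^ t * f ^ s)) = pr v (smul (lam ^ t) (smul (mu ^ s) L))"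
        by (intro pr_cong) (simp_all add: mult.assoc)
      then show ?thesis
        using \<open>pr v L = 0\<close> by (simp add: pr_simps)
    qed
    moreover obtain L' where "L' \<in> B_span" "L' \<approx>\<^sub>U L"
      using \<Lambda>(1) B_subset by (auto simp: right_integral_def pcls_eq_iff U.cong_mod_def dest!: subsetD)
        (metis U.cong_mod_def U.cong_sym)
    then have "L \<in> B_span"
      by (rule B_span.congr)
    ultimately have "L \<approx>\<^sub>U 0"
      by (intro frobenius_nondegenerate[OF v])
    then show False
      using \<Lambda>(2) by (simp add: zero_palg pcls_eq_iff U.cong_mod_def)
  qed
qed

lemma O_skew_power:
  assumes "Y * X \<approx>\<^sub>O smul r (X * Y)" "r \<noteq> 0"
  shows "\<exists>c. c \<noteq> 0 \<and> (X * Y) ^ n \<approx>\<^sub>O smul c (X ^ n * Y ^ n)"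
proof (induction n)
  case 0
  then show ?case
    by (intro exI[of _ 1]) simp
next
  case (Suc n)
  then obtain c where c: "c \<noteq> 0" "(X * Y) ^ n \<approx>\<^sub>O smul c (X ^ n * Y ^ n)"
    by blast
  have "(X * Y) ^ Suc n = X * Y * (X * Y) ^ n"
    by simp
  also have "\<dots> \<approx>\<^sub>O X * Y * smul c (X ^ n * Y ^ n)"
    by (rule O.cong_mult_left[OF c(2)])
  also have "\<dots> = smul c (X * (Y * X ^ n) * Y ^ n)"
    by (simp add: mult.assoc)
  also have "\<dots> \<approx>\<^sub>O smul c (X * smul (r ^ n) (X ^ n * Y) * Y ^ n)"
    by (intro O.cong_smul O.cong_mult_right O.cong_mult_left O.cong_commute_power assms)
  also have "\<dots> = smul (c * r ^ n) (X ^ Suc n * Y ^ Suc n)"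
    by (simp add: mult.assoc)
  finally have "(X * Y) ^ Suc n \<approx>\<^sub>O smul (c * r ^ n) (X ^ Suc n * Y ^ Suc n)" .
  moreover have "c * r ^ n \<noteq> 0"
    using c(1) assms(2) by simp
  ultimately show ?case
    by blast
qed

text \<open>A representative of \<open>x\<^sup>N\<^sup>-\<^sup>1 y\<^sup>N\<^sup>-\<^sup>1 z\<close>, with \<open>d\<^sup>-\<^sup>1 = d\<^sup>N\<^sup>-\<^sup>1\<close>.\<close>

definition v where "v = (Ob * Od ^ (N - 1)) ^ (N - 1) * (Oc * Od) ^ (N - 1) * Od ^ 2"

text \<open>Moving \<open>Od\<close> past \<open>Ob\<close> and \<open>Oc\<close> costs only
  non-zero scalars, so \<open>v\<close> is a non-zero multiple of a single monomial, with tail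
  \<open>0\<close>.\<close>

lemma lead_v: "lead (N - 1) (N - 1) v"
proof -
  let ?n = "N - 1" and ?D = "Od ^ (N - 1)"
  have "?D * Ob \<approx>\<^sub>O smul (q ^ ?n) (Ob * ?D)"
    by (rule O.cong_commute_power(2)[OF O_relations(3)])
  then obtain c where c: "c \<noteq> 0" "(Ob * ?D) ^ ?n \<approx>\<^sub>O smul c (Ob ^ ?n * ?D ^ ?n)"
    using O_skew_power[of ?D Ob "q ^ ?n" ?n] q_nonzero by auto
  obtain c' where c': "c' \<noteq> 0" "(Oc * Od) ^ ?n \<approx>\<^sub>O smul c' (Oc ^ ?n * Od ^ ?n)"
    using O_skew_power[OF O_relations(4), of ?n] q_nonzero by auto
  let ?r = "(q ^ ?n) ^ (?n * ?n)"
  have "v \<approx>\<^sub>O smul c (Ob ^ ?n * ?D ^ ?n) * smul c' (Oc ^ ?n * Od ^ ?n) * Od ^ 2"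
    unfolding v_def by (intro O.cong_mult O.cong_refl c c')
  also have "\<dots> = smul (c * c') (Ob ^ ?n * (Od ^ (?n * ?n) * Oc ^ ?n) * (Od ^ ?n * Od ^ 2))"
    by (simp add: mult.assoc power_mult mult.commute[of c c'])
  also have "\<dots> \<approx>\<^sub>O smul (c * c') (Ob ^ ?n * smul ?r (Oc ^ ?n * Od ^ (?n * ?n)) * (Od ^ ?n * Od ^ 2))"
    by (intro O.cong_smul O.cong_mult O.cong_refl O.cong_commute_power(2) dc_pow)
  also have "\<dots> = smul (c * c' * ?r) (mon ?n ?n (?n * ?n + (?n + 2)))"
    by (simp only: mon_def power_add mult.assoc smul_mult_left smul_mult_right smul_smul)
  finally have *: "v \<approx>\<^sub>O smul (c * c' * ?r) (mon ?n ?n (?n * ?n + (?n + 2))) + 0"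
    by simp
  have "0 \<in> tail ?n ?n"
  proof -
    have "mon 0 N 0 \<in> tail ?n ?n"
      using N_gt_1 by (intro tail.basis) simp
    from tail.smul[OF this, of 0] show ?thesis
      by simp
  qed
  then show ?thesis
    unfolding lead_def using * c(1) c'(1) q_nonzero
    by (intro exI[of _ "c * c' * ?r"] exI[of _ "?n * ?n + (?n + 2)"] exI[of _ 0]) (simp only: mult_eq_0_iff power_eq_0_iff simp_thms)
qed

text \<open>The factors \<open>Ob * Od ^ (N - 1)\<close> and \<open>Oc * Od\<close> have weight
  \<open>1\<close>, so only \<open>Od ^ 2\<close> contributes.\<close>

lemma v_weight: "pr v (h * K) = inverse (q ^ 2) * pr v h"
proof -
  have pow: "pr (x ^ n) (h * K) = t ^ n * pr (x ^ n) h" if "\<And>h. pr x (h * K) = t * pr x h" for x t n h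
  proof (induction n arbitrary: h)
    case 0
    show ?case
      by (simp add: pr_1_left scalar_map_id.free_ext_mult counit_U_gen)
  next
    case (Suc n)
    show ?case
      using weight_mult[OF that Suc] by simp
  qed
  have iq: "inverse q ^ N = 1"
    using q_pow_N by (simp add: power_inverse)
  have "pr v (h * K) = (inverse q * inverse q ^ (N - 1)) ^ (N - 1) * (q * inverse q) ^ (N - 1) * inverse q ^ 2 * pr v h"
    unfolding v_def by (intro weight_mult pow weight_gen)
  also have "inverse q * inverse q ^ (N - 1) = 1"
    using iq N_gt_1 by (cases N) simp_all
  finally show ?thesis
    using q_nonzero by (simp add: power_inverse)
qed

end

section \<open>The element w and its values at powers of K\<close>

locale coideal_integral = coideal_pairing q N \<phi> lam mu for q :: "'k::field" and N \<phi> lam mu +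
  fixes L :: "(U_gen, 'k) free_alg"
  assumes integral: "right_integral PU B (pcls PU L)" and L_nonzero: "pcls PU L \<noteq> \<zero>\<^bsub>U_alg q N\<^esub>"
begin

definition w where "w = v \<triangleleft> L"

definition \<epsilon>w where "\<epsilon>w = pr w 1"

lemma \<epsilon>w_nonzero: "\<epsilon>w \<noteq> 0"
  using pr_integral(1)[OF lead_v integral L_nonzero] by (simp add: \<epsilon>w_def w_def pr_act)

lemma invariant_w: "invariant w"
proof -
  have "v \<triangleleft> L \<triangleleft> t \<approx>\<^sub>O smul c (v \<triangleleft> L)" if "L * t \<approx>\<^sub>U smul c L" for t c
  proof -
    have "v \<triangleleft> L \<triangleleft> t \<approx>\<^sub>O v \<triangleleft> (L * t)"
      by (rule O.cong_sym[OF act_mult])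
    also have "\<dots> \<approx>\<^sub>O v \<triangleleft> smul c L"
      by (intro act_cong that O.cong_refl)
    also have "\<dots> \<approx>\<^sub>O smul c (v \<triangleleft> L)"
      by (rule act_smul_right)
    finally show ?thesis .
  qed
  then show ?thesis
    using pr_integral(2,3)[OF lead_v integral L_nonzero] by (simp add: invariant_def w_def)
qed

text \<open>By \<open>pr_act\<close> the left side is \<open>pr v (L * K ^ s)\<close>: the right
  action of the integral commutes with the left action of \<open>K\<close>, so \<open>w\<close>
  inherits the weight of \<open>v\<close>.\<close>

lemma pr_w_K_pow: "pr w (K ^ s) = \<epsilon>w * inverse (q ^ 2) ^ s"
proof -
  have "pr v (h * K ^ s) = inverse (q ^ 2) ^ s * pr v h" for h
  proof (induction s arbitrary: h)
    case (Suc s)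
    have "pr v (h * K ^ Suc s) = inverse (q ^ 2) ^ s * pr v (h * K)"
      using Suc[of "h * K"] by (simp add: mult.assoc del: power_inverse)
    then show ?case
      by (simp only: v_weight power_Suc2 mult.assoc)
  qed simp
  then show ?thesis
    by (simp add: w_def \<epsilon>w_def pr_act mult.commute del: power_inverse)
qed

lemma pr_w_inj: "inj_on (\<lambda>s. pr w (K ^ s)) {..<N}"
proof -
  have "i = j" if "pr w (K ^ i) = pr w (K ^ j)" "j < N" "i \<le> j" for i j
  proof -
    have "(q ^ 2) ^ i = (q ^ 2) ^ j"
      using that \<epsilon>w_nonzero by (simp add: pr_w_K_pow power_inverse)
    moreover have "(q ^ 2) ^ j = (q ^ 2) ^ i * (q ^ 2) ^ (j - i)"
      unfolding power_add[symmetric] using that(3) by simp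
    ultimately have "(q ^ 2) ^ i * (q ^ 2) ^ (j - i) = (q ^ 2) ^ i * 1"
      by simp
    then have "(q ^ 2) ^ (j - i) = 1"
      using q_nonzero by simp
    then have "\<not> 0 < j - i"
      using q2_primitive[of "j - i"] that(2) by linarith
    then show ?thesis
      using that(3) by simp
  qed
  then show ?thesis
    unfolding inj_on_def by (metis lessThan_iff nle_le)
qed

lemma invariant_poly_in: "invariant (poly_in r w)"
  using poly_in_mem_subalgebra[OF is_subalgebra_dagger dagger_memI[OF invariant_w]]
  by (rule invariantI)

lemma invariant_interpolation:
  "\<exists>r. \<forall>s<N. pr (poly_in r w) (K ^ s) = ys s"
  unfolding pr_poly_in by (rule interpolation[OF pr_w_inj])

text \<open>The values of \<open>w\<close> at the powers of \<open>K\<close> are distinct, so some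
  polynomial in \<open>w\<close> takes the same values as a given invariant, and invariants with
  equal values coincide.\<close>

lemma dagger_generated: "dagger q N \<phi> B = subalgebra_gen (O_alg q N) {pcls PO w}"
proof (intro equalityI subalgebra_gen_subset is_subalgebra_dagger subsetI)
  fix X
  assume "X \<in> dagger q N \<phi> B"
  then obtain u where u: "X = pcls PO u" "invariant u"
    by (auto simp: dagger_eq)
  obtain r where "\<forall>s<N. pr (poly_in r w) (K ^ s) = pr u (K ^ s)"
    using invariant_interpolation[of "\<lambda>s. pr u (K ^ s)"] by (elim exE)
  then have "poly_in r w \<approx>\<^sub>O u"
    by (intro invariant_eqI invariant_poly_in u) simp
  then have "X = pcls PO (poly_in r w)"
    unfolding u pcls_eq_iff O.cong_mod_def[symmetric] by (rule O.cong_sym)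
  then show "X \<in> subalgebra_gen (O_alg q N) {pcls PO w}"
    by (auto simp: subalgebra_gen_def intro: poly_in_mem_subalgebra)
qed (use dagger_memI[OF invariant_w] in simp)

text \<open>Each value of \<open>w\<close> at a power of \<open>K\<close> is
  \<open>\<epsilon>w\<close> times an \<open>N\<close>-th root of unity, so the polynomial
  annihilates \<open>w\<close>. Any annihilating polynomial has the \<open>N\<close> distinct values
  as roots.\<close>

lemma w_minimal_poly:
  "is_minimal_poly (O_alg q N) (pcls PO w) (Polynomial.monom 1 N - [:\<epsilon>w ^ N:])"
proof -
  let ?p = "Polynomial.monom 1 N - [:\<epsilon>w ^ N:]"
  have coeff: "Polynomial.coeff ?p N = 1"
    using N_gt_1 by (simp add: coeff_pCons split: nat.split)
  have deg: "Polynomial.degree ?p = N"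
  proof (rule antisym)
    show "Polynomial.degree ?p \<le> N"
      by (intro degree_diff_le degree_monom_le) simp
    show "N \<le> Polynomial.degree ?p"
      by (rule le_degree) (use coeff in simp)
  qed
  have "poly_in ?p w \<approx>\<^sub>O 0"
  proof (rule invariant_eq_0[OF invariant_poly_in])
    fix s
    have "(inverse (q ^ 2) ^ s) ^ N = 1"
      by (metis inverse_1 power_commuting_commutes power_inverse power_mult power_one mult.commute q2_pow_N)
    then show "pr (poly_in ?p w) (K ^ s) = 0"
      by (simp add: pr_poly_in pr_w_K_pow poly_monom power_mult_distrib del: power_inverse)
  qed
  moreover have "N \<le> Polynomial.degree r" if "r \<noteq> 0" "poly_in r w \<approx>\<^sub>O 0" for r
  proof -
    have "poly r (pr w (K ^ s)) = 0" for s
      using pr_cong[OF that(2) U.cong_refl] by (simp add: pr_poly_in[symmetric] pr_simps)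
    then have "(\<lambda>s. pr w (K ^ s)) ` {..<N} \<subseteq> {x. poly r x = 0}"
      by auto
    then have "card ((\<lambda>s. pr w (K ^ s)) ` {..<N}) \<le> card {x. poly r x = 0}"
      by (rule card_mono[OF poly_roots_finite[OF that(1)]])
    then show ?thesis
      using card_poly_roots_bound[OF that(1)] by (simp add: card_image[OF pr_w_inj])
  qed
  ultimately show ?thesis
    using coeff deg
    by (simp add: is_minimal_poly_def poly_eval_pcls zero_palg pcls_eq_iff O.cong_mod_def)
qed

abbreviation "D \<equiv> O_alg q N\<lparr>carrier := dagger q N \<phi> B\<rparr>"

lemma ring_D: "ring D"
  using ring.subring_is_ring[OF ring_palg] is_subalgebra_dagger by (auto simp: is_subalgebra_def)

section \<open>Left ideals of the invariants, and semisimplicity\<close>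

lemma left_ideal_vanishing:
  "left_ideal (pcls PO ` {u. invariant u \<and> (\<forall>s\<in>S. pr u (K ^ s) = 0)}) D"
proof -
  let ?V = "{u. invariant u \<and> (\<forall>s\<in>S. pr u (K ^ s) = 0)}"
  have zero: "invariant 0"
    using invariant_smul[OF invariant_1, of 0] by simp
  have "subgroup (pcls PO ` ?V) (add_monoid D)"
  proof (rule group.subgroupI[OF abelian_group.a_group[OF ring.is_abelian_group[OF ring_D]]])
    show "pcls PO ` ?V \<subseteq> carrier (add_monoid D)"
      by (auto simp: dagger_eq)
    show "pcls PO ` ?V \<noteq> {}"
      using zero by (auto simp: pr_simps)
    fix X Y
    assume "X \<in> pcls PO ` ?V"
    then obtain x where x: "X = pcls PO x" "x \<in> ?V"
      by blast
    have minus: "invariant (- x)"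
      using invariant_smul[of x "-1"] x by (simp add: uminus_smul)
    have "inv\<^bsub>add_monoid D\<^esub> X = pcls PO (- x)"
      using minus x
      by (intro group.inv_equality[OF abelian_group.a_group[OF ring.is_abelian_group[OF ring_D]]])
        (simp_all add: dagger_eq add_palg zero_palg)
    then show "inv\<^bsub>add_monoid D\<^esub> X \<in> pcls PO ` ?V"
      using x minus by (auto simp: pr_simps intro!: imageI)
    assume "Y \<in> pcls PO ` ?V"
    then obtain y where y: "Y = pcls PO y" "y \<in> ?V"
      by blast
    show "X \<otimes>\<^bsub>add_monoid D\<^esub> Y \<in> pcls PO ` ?V"
      using x y by (auto simp: add_palg pr_simps invariant_add intro!: imageI)
  qed
  then show ?thesis
    by (auto simp: left_ideal_def dagger_eq mult_palg pr_mult_K_pow invariant_mult intro!: imageI)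
qed

text \<open>The values at the powers of \<open>K\<close> identify the invariants with
  \<open>N\<close> copies of the field, whose ideals are the coordinate subspaces. \<open>S\<close>
  collects the coordinates in which some element of \<open>I\<close> is non-zero.\<close>

lemma left_ideal_eq_vanishing:
  assumes "left_ideal I D"
  shows "\<exists>S\<subseteq>{..<N}. I = pcls PO ` {u. invariant u \<and> (\<forall>s\<in>{..<N} - S. pr u (K ^ s) = 0)}"
proof -
  have I_sub: "I \<subseteq> pcls PO ` {u. invariant u}"
    using assms subgroup.subset by (force simp: left_ideal_def dagger_eq)
  then have inv: "invariant u" if "pcls PO u \<in> I" for u
    using that invariantI unfolding dagger_eq by blast
  have zero: "pcls PO 0 \<in> I"
    using assms subgroup.one_closed by (force simp: left_ideal_def zero_palg)
  have add: "pcls PO (x + y) \<in> I" if "pcls PO x \<in> I" "pcls PO y \<in> I" for x y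
    using assms subgroup.m_closed[of I "add_monoid D" "pcls PO x" "pcls PO y"] that
    by (simp add: left_ideal_def add_palg)
  have mult: "pcls PO (x * y) \<in> I" if "invariant x" "pcls PO y \<in> I" for x y
    using assms that by (auto simp: left_ideal_def mult_palg[symmetric] dagger_eq)
  have sum: "pcls PO (sum g A) \<in> I" if "\<And>i. i \<in> A \<Longrightarrow> pcls PO (g i) \<in> I" for g and A :: "nat set"
    using that by (induction A rule: infinite_finite_induct) (simp_all add: zero add)
  define S where "S = {s. s < N \<and> (\<exists>u. pcls PO u \<in> I \<and> pr u (K ^ s) \<noteq> 0)}"
  have "\<exists>u. pcls PO u \<in> I \<and> (\<forall>t<N. pr u (K ^ t) = (if t = s then 1 else 0))" if s: "s \<in> S" for s
  proof -
    obtain u where u: "pcls PO u \<in> I" "pr u (K ^ s) \<noteq> 0"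
      using s by (auto simp: S_def)
    \<comment> \<open>A polynomial in \<open>w\<close> that vanishes at all points other than
      \<open>s\<close> cuts \<open>u\<close> down to a multiple of the idempotent at
      \<open>s\<close>; its value at \<open>s\<close> normalises this multiple.\<close>
    obtain r where "\<forall>t<N. pr (poly_in r w) (K ^ t) = (if t = s then 1 / pr u (K ^ s) else 0)"
      using invariant_interpolation[of "\<lambda>t. if t = s then 1 / pr u (K ^ s) else 0"] by (elim exE)
    then show ?thesis
      using u by (intro exI[of _ "poly_in r w * u"]) (simp add: mult invariant_poly_in pr_mult_K_pow)
  qed
  then obtain \<delta> where \<delta>: "\<And>s. s \<in> S \<Longrightarrow> pcls PO (\<delta> s) \<in> I"
    "\<And>s t. s \<in> S \<Longrightarrow> t < N \<Longrightarrow> pr (\<delta> s) (K ^ t) = (if t = s then 1 else 0)"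
    by metis
  have S: "S \<subseteq> {..<N}"
    by (auto simp: S_def)
  have "I = pcls PO ` {u. invariant u \<and> (\<forall>s\<in>{..<N} - S. pr u (K ^ s) = 0)}"
  proof (intro equalityI subsetI)
    fix X
    assume "X \<in> I"
    then obtain u where "X = pcls PO u" "pcls PO u \<in> I"
      using I_sub by auto
    then show "X \<in> pcls PO ` {u. invariant u \<and> (\<forall>s\<in>{..<N} - S. pr u (K ^ s) = 0)}"
      using inv by (auto simp: S_def intro!: imageI)
  next
    fix X
    assume "X \<in> pcls PO ` {u. invariant u \<and> (\<forall>s\<in>{..<N} - S. pr u (K ^ s) = 0)}"
    then obtain u where u: "X = pcls PO u" "invariant u" "\<forall>s\<in>{..<N} - S. pr u (K ^ s) = 0"
      by auto
    let ?u = "\<Sum>s\<in>S. u * \<delta> s"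
    have "pcls PO ?u \<in> I"
      using \<delta> u by (intro sum mult)
    moreover have "?u \<approx>\<^sub>O u"
    proof (rule invariant_eqI[OF inv[OF calculation] u(2)])
      fix t
      assume t: "t < N"
      have "pr ?u (K ^ t) = (\<Sum>s\<in>S. if s = t then pr u (K ^ t) else 0)"
        unfolding pr_simps by (intro sum.cong refl) (simp add: pr_mult_K_pow \<delta>(2)[OF _ t])
      also have "\<dots> = pr u (K ^ t)"
        using u(3) t finite_subset[OF S] by (simp add: sum.delta)
      finally show "pr ?u (K ^ t) = pr u (K ^ t)" .
    qed
    then have "pcls PO ?u = X"
      by (simp add: u pcls_eq_iff O.cong_mod_def)
    ultimately show "X \<in> I"
      by simp
  qed
  then show ?thesis
    using S by blast
qed

text \<open>An ideal supported on the coordinates in \<open>S\<close> is complemented by the ideal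
  supported on the remaining ones.\<close>

lemma semisimple_dagger: "semisimple D"
  unfolding semisimple_def
proof (intro allI impI)
  fix I
  assume "left_ideal I D"
  then obtain S where S: "S \<subseteq> {..<N}"
    and I: "I = pcls PO ` {u. invariant u \<and> (\<forall>s\<in>{..<N} - S. pr u (K ^ s) = 0)}"
    using left_ideal_eq_vanishing by blast
  let ?J = "pcls PO ` {u. invariant u \<and> (\<forall>s\<in>S. pr u (K ^ s) = 0)}"
  have "I \<inter> ?J = {\<zero>\<^bsub>D\<^esub>}"
  proof (intro equalityI subsetI)
    fix X
    assume "X \<in> I \<inter> ?J"
    then obtain x y where x: "X = pcls PO x" "invariant x" "\<forall>s\<in>{..<N} - S. pr x (K ^ s) = 0"
      and y: "X = pcls PO y" "\<forall>s\<in>S. pr y (K ^ s) = 0"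
      unfolding I by auto
    have "x \<approx>\<^sub>O y"
      using x y by (simp add: O.cong_mod_def pcls_eq_iff[symmetric])
    then have "pr x (K ^ s) = pr y (K ^ s)" for s
      by (simp add: cong_O_iff)
    then have "x \<approx>\<^sub>O 0"
      using x y invariant_smul[OF invariant_1, of 0]
      by (intro invariant_eqI) (auto simp: pr_simps)
    then show "X \<in> {\<zero>\<^bsub>D\<^esub>}"
      by (simp add: x zero_palg pcls_eq_iff O.cong_mod_def)
  next
    fix X
    assume "X \<in> {\<zero>\<^bsub>D\<^esub>}"
    then show "X \<in> I \<inter> ?J"
      using invariant_smul[OF invariant_1, of 0] by (auto simp: I zero_palg pr_simps intro!: imageI)
  qed
  moreover have "I <+>\<^bsub>D\<^esub> ?J = carrier D"
  proof (intro equalityI subsetI)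
    fix X
    assume "X \<in> I <+>\<^bsub>D\<^esub> ?J"
    then show "X \<in> carrier D"
      by (auto simp: set_add_def' I add_palg dagger_eq invariant_add intro!: imageI)
  next
    fix X
    assume "X \<in> carrier D"
    then obtain u where u: "X = pcls PO u" "invariant u"
      by (auto simp: dagger_eq)
    \<comment> \<open>The component of \<open>u\<close> in \<open>I\<close> agrees with
      \<open>u\<close> on \<open>S\<close> and vanishes elsewhere.\<close>
    obtain r where r: "\<forall>s<N. pr (poly_in r w) (K ^ s) = (if s \<in> S then pr u (K ^ s) else 0)"
      using invariant_interpolation[of "\<lambda>s. if s \<in> S then pr u (K ^ s) else 0"] by (elim exE)
    have "pcls PO (poly_in r w) \<in> I"
      unfolding I using r by (auto simp: invariant_poly_in intro!: imageI)
    moreover have "pcls PO (u - poly_in r w) \<in> ?J"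
      using r u S by (auto simp: invariant_poly_in invariant_diff pr_simps intro!: imageI)
    ultimately have "pcls PO (poly_in r w) \<oplus>\<^bsub>D\<^esub> pcls PO (u - poly_in r w) \<in> I <+>\<^bsub>D\<^esub> ?J"
      unfolding set_add_def' by blast
    then show "X \<in> I <+>\<^bsub>D\<^esub> ?J"
      by (simp add: add_palg u)
  qed
  ultimately show "\<exists>J. left_ideal J D \<and> I \<inter> J = {\<zero>\<^bsub>D\<^esub>} \<and> I <+>\<^bsub>D\<^esub> J = carrier D"
    by (intro exI[of _ ?J] conjI left_ideal_vanishing)
qed

end

theorem theorem5p9:
  fixes q lam mu :: "'k::{alg_closed_field, field_char_0}"
    and N :: nat
    and \<phi> :: "(O_gen, 'k) free_alg set \<Rightarrow> (U_gen, 'k) free_alg set \<Rightarrow> 'k"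
    and \<Lambda> :: "(U_gen, 'k) free_alg set"
    and x y z w :: "(O_gen, 'k) free_alg set"
  assumes N: "N > 1" "odd N"
    and q: "q ^ N = 1" "\<forall>m. 0 < m \<and> m < N \<longrightarrow> q ^ m \<noteq> 1"
    and lam_mu: "(1 - q ^ 2) * lam * mu = 1"
    and \<phi>: "is_phi q N \<phi>"
    and \<Lambda>: "right_integral (U_pres q N) (B_alg q N lam mu) \<Lambda>" "\<Lambda> \<noteq> \<zero>\<^bsub>U_alg q N\<^esub>"
  defines "x \<equiv> O_elt q N Gen_b \<otimes>\<^bsub>O_alg q N\<^esub> inv\<^bsub>O_alg q N\<^esub> (O_elt q N Gen_d)"
    and "y \<equiv> O_elt q N Gen_c \<otimes>\<^bsub>O_alg q N\<^esub> O_elt q N Gen_d"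
    and "z \<equiv> O_elt q N Gen_d [^]\<^bsub>O_alg q N\<^esub> (2::nat)"
    and "w \<equiv> ract q N \<phi>
      (x [^]\<^bsub>O_alg q N\<^esub> (N - 1) \<otimes>\<^bsub>O_alg q N\<^esub> y [^]\<^bsub>O_alg q N\<^esub> (N - 1) \<otimes>\<^bsub>O_alg q N\<^esub> z) \<Lambda>"
  shows "dagger q N \<phi> (B_alg q N lam mu) = subalgebra_gen (O_alg q N) {w}
    \<and> is_minimal_poly (O_alg q N) w (Polynomial.monom 1 N - [:counit (O_pres q N) w ^ N:])
    \<and> counit (O_pres q N) w \<noteq> 0
    \<and> semisimple (O_alg q N \<lparr>carrier := dagger q N \<phi> (B_alg q N lam mu)\<rparr>)"
proof -
  interpret coideal_pairing q N \<phi> lam mu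
    using N q lam_mu \<phi> by unfold_locales auto
  have "\<Lambda> \<in> carrier (U_alg q N)"
    using \<Lambda>(1) B_subset by (auto simp: right_integral_def carrier_palg)
  then obtain L where L: "\<Lambda> = pcls PU L"
    by (auto simp: carrier_palg)
  interpret I: coideal_integral q N \<phi> lam mu L
    using \<Lambda> L by unfold_locales simp_all
  \<comment> \<open>The relation \<open>Od ^ N = 1\<close> identifies the inverse with the power
    used in \<open>v\<close>.\<close>
  have "inv\<^bsub>O_alg q N\<^esub> (pcls PO Od) = pcls PO (Od ^ (N - 1))"
  proof (rule monoid.inv_unique'[OF ring.is_monoid[OF ring_palg], symmetric])
    have "Od * Od ^ (N - 1) = Od ^ N" "Od ^ (N - 1) * Od = Od ^ N"
      using N by (cases N; simp add: power_commutes)+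
    then show "pcls PO Od \<otimes>\<^bsub>O_alg q N\<^esub> pcls PO (Od ^ (N - 1)) = \<one>\<^bsub>O_alg q N\<^esub>"
      "pcls PO (Od ^ (N - 1)) \<otimes>\<^bsub>O_alg q N\<^esub> pcls PO Od = \<one>\<^bsub>O_alg q N\<^esub>"
      using O_relations(6) by (simp_all add: mult_palg one_palg pcls_eq_iff O.cong_mod_def)
  qed (auto simp: carrier_palg)
  then have w: "w = pcls PO I.w"
    by (simp add: w_def x_def y_def z_def L mult_palg pow_palg ract_pcls I.w_def v_def)
  have "counit (O_pres q N) w = I.\<epsilon>w"
    by (simp add: w counit_O I.\<epsilon>w_def)
  then show ?thesis
    using I.dagger_generated I.w_minimal_poly I.\<epsilon>w_nonzero I.semisimple_dagger by (simp add: w)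
qed

end
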